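(* Let $X$ be a distribution on $\mathbb{R}^{d\times d}$ supported on the set of symmetric positive semidefinite matrices. Suppose that $\mathbb E[X]=\Sigma$ and that for every symmetric matrix $A$ we have $\mathrm{Var}(\mathrm{tr}(AX))=O(\sigma^2\|\Sigma^{1/2}A\Sigma^{1/2}\|_F^2)$. Then there exists a polynomial time algorithm that, given sample access to an $\epsilon$-corrupted version of $X$ with $\epsilon$ less than a sufficiently small constant multiple of $\sigma^{-2}$, returns a matrix $\hat\Sigma$ such that with high probability $\|\Sigma^{-1/2}(\Sigma-\hat\Sigma)\Sigma^{-1/2}\|_F=O(\sigma\sqrt{\epsilon})$.
   Context: An $\epsilon$-corrupted version of $X$ (strong contamination model): the algorithm picks $N$, then $N$ i.i.d. samples from $X$ are drawn, an adversary may inspect them and replace at most $\epsilon N$ of them by arbitrary points, and the algorithm receives the modified list. $\|\cdot\|_F$ is the Frobenius norm.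
   Formalization: Besides ε being less than a small constant multiple of σ^{-2}, ε itself is required to be positive and less than a small constant (automatic for σ ≥ 1); otherwise small σ would allow ε ≥ 1/2, where the claim fails. Σ is assumed invertible and σ > 0. *)

theory Defs
  imports
    "HOL-Probability.Probability"
    "Jordan_Normal_Form.Gauss_Jordan_Elimination"
begin

text \<open>The dimension \<open>d\<close> is an input of the algorithm, so it is a natural number and not a type:
  matrices are those of \<open>Jordan_Normal_Form\<close>.\<close>

section \<open>Matrices\<close>

definition mat_trace :: "real mat \<Rightarrow> real" where
  "mat_trace A = (\<Sum>i<dim_row A. A $$ (i, i))"

definition frob_norm :: "real mat \<Rightarrow> real" where
  "frob_norm A = sqrt (\<Sum>i<dim_row A. \<Sum>j<dim_col A. (A $$ (i, j))\<^sup>2)"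

definition symmetric_mat :: "nat \<Rightarrow> real mat \<Rightarrow> bool" where
  "symmetric_mat d A \<longleftrightarrow> A \<in> carrier_mat d d \<and> transpose_mat A = A"

definition psd_mat :: "nat \<Rightarrow> real mat \<Rightarrow> bool" where
  "psd_mat d A \<longleftrightarrow> symmetric_mat d A \<and>
     (\<forall>v\<in>carrier_vec d. 0 \<le> scalar_prod v (mult_mat_vec A v))"

definition psd_sqrt :: "real mat \<Rightarrow> real mat" where
  "psd_sqrt S = (THE R. psd_mat (dim_row S) R \<and> R * R = S)"

text \<open>Meaningful for invertible \<open>S\<close> only.\<close>

definition psd_inv_sqrt :: "real mat \<Rightarrow> real mat" where
  "psd_inv_sqrt S = the (mat_inverse (psd_sqrt S))"

section \<open>Distributions on square matrices and their contamination\<close>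

text \<open>The Borel sigma-algebra of \<open>\<real>\<^sup>d\<^sup>\<times>\<^sup>d\<close>, generated by the entries.\<close>

definition mat_borel :: "nat \<Rightarrow> real mat measure" where
  "mat_borel d = sigma (carrier_mat d d)
     {{A \<in> carrier_mat d d. A $$ (i, j) \<in> B} | i j B. i < d \<and> j < d \<and> B \<in> sets borel}"

definition mat_distribution :: "nat \<Rightarrow> real mat measure \<Rightarrow> bool" where
  "mat_distribution d X \<longleftrightarrow> prob_space X \<and> sets X = sets (mat_borel d)"

definition has_mean :: "nat \<Rightarrow> real mat measure \<Rightarrow> real mat \<Rightarrow> bool" where
  "has_mean d X S \<longleftrightarrow> S \<in> carrier_mat d d \<and>
     (\<forall>i<d. \<forall>j<d. integrable X (\<lambda>M. M $$ (i, j)) \<and> (\<integral>M. M $$ (i, j) \<partial>X) = S $$ (i, j))"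

text \<open>\<open>J\<close> is the joint law of the clean samples and of the list that the algorithm receives.
  The adversary sees all clean samples and may be randomized; it may change at most
  \<open>\<epsilon> N\<close> positions of the list.\<close>

definition contamination ::
  "real \<Rightarrow> nat \<Rightarrow> real mat measure \<Rightarrow> ((nat \<Rightarrow> real mat) \<times> (nat \<Rightarrow> real mat)) measure \<Rightarrow> bool" where
  "contamination \<epsilon> N X J \<longleftrightarrow>
     prob_space J \<and>
     sets J = sets (PiM {..<N} (\<lambda>_. X) \<Otimes>\<^sub>M PiM {..<N} (\<lambda>_. X)) \<and>
     distr J (PiM {..<N} (\<lambda>_. X)) fst = PiM {..<N} (\<lambda>_. X) \<and>
     (AE (xs, ys) in J. real (card {i\<in>{..<N}. xs i \<noteq> ys i}) \<le> \<epsilon> * real N)"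

section \<open>Real-RAM programs\<close>

text \<open>Real arithmetic, comparison and fair coin flips at unit cost. A memory
  cell holds a real number and is addressed by an array name and a list of indices; index variables
  hold natural numbers. There is no rounding from reals to indices, and the only constants are
  natural numbers, so that neither can be used to smuggle in extra computational power.
  Subtraction of indices is truncated and division by zero yields zero.\<close>

type_synonym name = string

datatype iexp =
    IConst nat
  | IVar name
  | IAdd iexp iexp
  | ISub iexp iexp

datatype rexp =
    RIdx iexp
  | RCell name "iexp list"
  | RAdd rexp rexp
  | RSub rexp rexp
  | RMul rexp rexp
  | RDiv rexp rexp

datatype bexp =
    ILess iexp iexp
  | RLess rexp rexp
  | Neg bexp
  | Conj bexp bexp

datatype com =
    Skip
  | ISet name iexp
  | RSet name "iexp list" rexp
  | Flip name
  | Seq com com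
  | Cond bexp com com
  | While bexp com

record state =
  idx :: "name \<Rightarrow> nat"
  mem :: "name \<Rightarrow> nat list \<Rightarrow> real"
  coins :: "bool stream"

primrec ival :: "state \<Rightarrow> iexp \<Rightarrow> nat" where
  "ival s (IConst n) = n"
| "ival s (IVar x) = idx s x"
| "ival s (IAdd a b) = ival s a + ival s b"
| "ival s (ISub a b) = ival s a - ival s b"

primrec rval :: "state \<Rightarrow> rexp \<Rightarrow> real" where
  "rval s (RIdx a) = real (ival s a)"
| "rval s (RCell x as) = mem s x (map (ival s) as)"
| "rval s (RAdd p q) = rval s p + rval s q"
| "rval s (RSub p q) = rval s p - rval s q"
| "rval s (RMul p q) = rval s p * rval s q"
| "rval s (RDiv p q) = rval s p / rval s q"

primrec bval :: "state \<Rightarrow> bexp \<Rightarrow> bool" where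
  "bval s (ILess a b) \<longleftrightarrow> ival s a < ival s b"
| "bval s (RLess p q) \<longleftrightarrow> rval s p < rval s q"
| "bval s (Neg b) \<longleftrightarrow> \<not> bval s b"
| "bval s (Conj b c) \<longleftrightarrow> bval s b \<and> bval s c"

text \<open>\<open>exec c s t s'\<close>: started in \<open>s\<close>, the program \<open>c\<close> halts in \<open>s'\<close> after \<open>t\<close> steps. Evaluating
  an expression is one step: the expressions of a fixed program have bounded size.\<close>

inductive exec :: "com \<Rightarrow> state \<Rightarrow> nat \<Rightarrow> state \<Rightarrow> bool" where
  Skip: "exec Skip s 1 s"
| ISet: "exec (ISet x a) s 1 (s\<lparr>idx := (idx s)(x := ival s a)\<rparr>)"
| RSet: "exec (RSet x as e) s 1
    (s\<lparr>mem := (mem s)(x := (mem s x)(map (ival s) as := rval s e))\<rparr>)"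
| Flip: "exec (Flip x) s 1
    (s\<lparr>idx := (idx s)(x := of_bool (shd (coins s))), coins := stl (coins s)\<rparr>)"
| Seq: "exec c1 s t1 s1 \<Longrightarrow> exec c2 s1 t2 s2 \<Longrightarrow> exec (Seq c1 c2) s (t1 + t2) s2"
| CondTrue: "bval s b \<Longrightarrow> exec c1 s t s' \<Longrightarrow> exec (Cond b c1 c2) s (1 + t) s'"
| CondFalse: "\<not> bval s b \<Longrightarrow> exec c2 s t s' \<Longrightarrow> exec (Cond b c1 c2) s (1 + t) s'"
| WhileFalse: "\<not> bval s b \<Longrightarrow> exec (While b c) s 1 s"
| WhileTrue: "bval s b \<Longrightarrow> exec c s t1 s1 \<Longrightarrow> exec (While b c) s1 t2 s2 \<Longrightarrow>
    exec (While b c) s (1 + t1 + t2) s2"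

inductive_cases exec_SkipE: "exec Skip s t s'"
inductive_cases exec_ISetE: "exec (ISet x a) s t s'"
inductive_cases exec_RSetE: "exec (RSet x as e) s t s'"
inductive_cases exec_FlipE: "exec (Flip x) s t s'"
inductive_cases exec_SeqE: "exec (Seq c1 c2) s t s'"
inductive_cases exec_CondE: "exec (Cond b c1 c2) s t s'"
inductive_cases exec_WhileE: "exec (While b c) s t s'"

lemma exec_deterministic:
  "exec c s t s' \<Longrightarrow> exec c s u s'' \<Longrightarrow> u = t \<and> s'' = s'"
proof (induction arbitrary: u s'' rule: exec.induct)
  case (Skip s) then show ?case by (auto elim: exec_SkipE)
next
  case (ISet x a s) then show ?case by (auto elim: exec_ISetE)
next
  case (RSet x as e s) then show ?case by (auto elim: exec_RSetE)
next
  case (Flip x s) then show ?case by (auto elim: exec_FlipE)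
next
  case (Seq c1 s t1 s1 c2 t2 s2)
  from Seq.prems show ?case
    by (rule exec_SeqE) (use Seq.IH in metis)
next
  case (CondTrue s b c1 t s' c2)
  from CondTrue.prems show ?case
    by (rule exec_CondE) (use CondTrue.IH CondTrue.hyps in force)+
next
  case (CondFalse s b c2 t s' c1)
  from CondFalse.prems show ?case
    by (rule exec_CondE) (use CondFalse.IH CondFalse.hyps in force)+
next
  case (WhileFalse s b c)
  from WhileFalse.prems show ?case
    by (rule exec_WhileE) (use WhileFalse.hyps in auto)
next
  case (WhileTrue s b c t1 s1 t2 s2)
  from WhileTrue.prems show ?case
    by (rule exec_WhileE) (use WhileTrue.hyps in \<open>auto dest!: WhileTrue.IH\<close>)
qed

section \<open>Estimators\<close>

text \<open>An estimator consists of two programs: the first one computes the number \<open>N\<close> of samples from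
  the parameters, the second one is run on the parameters and the \<open>N\<close> received samples. \<open>\<delta>\<close> is the
  admissible failure probability.\<close>

definition param_state :: "nat \<Rightarrow> real \<Rightarrow> real \<Rightarrow> real \<Rightarrow> bool stream \<Rightarrow> state" where
  "param_state d \<epsilon> \<sigma> \<delta> \<omega> =
     \<lparr>idx = (\<lambda>_. 0)(''d'' := d),
      mem = (\<lambda>_ _. 0)(''eps'' := (\<lambda>_. 0)([] := \<epsilon>),
                      ''sigma'' := (\<lambda>_. 0)([] := \<sigma>),
                      ''delta'' := (\<lambda>_. 0)([] := \<delta>)),
      coins = \<omega>\<rparr>"

definition sample_cells :: "nat \<Rightarrow> nat \<Rightarrow> (nat \<Rightarrow> real mat) \<Rightarrow> nat list \<Rightarrow> real" where
  "sample_cells d N ys l =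
     (case l of [k, i, j] \<Rightarrow> if k < N \<and> i < d \<and> j < d then ys k $$ (i, j) else 0 | _ \<Rightarrow> 0)"

definition sample_state ::
  "nat \<Rightarrow> real \<Rightarrow> real \<Rightarrow> real \<Rightarrow> nat \<Rightarrow> (nat \<Rightarrow> real mat) \<Rightarrow> bool stream \<Rightarrow> state" where
  "sample_state d \<epsilon> \<sigma> \<delta> N ys \<omega> =
     (let s = param_state d \<epsilon> \<sigma> \<delta> \<omega>
      in s\<lparr>idx := (idx s)(''N'' := N), mem := (mem s)(''X'' := sample_cells d N ys)\<rparr>)"

definition output_mat :: "nat \<Rightarrow> state \<Rightarrow> real mat" where
  "output_mat d s = mat d d (\<lambda>(i, j). mem s ''out'' [i, j])"

text \<open>By \<open>exec_deterministic\<close> there is at most one such \<open>T\<close>.\<close>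

definition estimates ::
  "com \<Rightarrow> nat \<Rightarrow> real \<Rightarrow> real \<Rightarrow> real \<Rightarrow> nat \<Rightarrow> (nat \<Rightarrow> real mat) \<Rightarrow> bool stream \<Rightarrow> real mat \<Rightarrow> bool"
where
  "estimates est d \<epsilon> \<sigma> \<delta> N ys \<omega> T \<longleftrightarrow>
     (\<exists>t s'. exec est (sample_state d \<epsilon> \<sigma> \<delta> N ys \<omega>) t s' \<and> T = output_mat d s')"

definition coin_space :: "bool stream measure" where
  "coin_space = stream_space (measure_pmf (bernoulli_pmf (1 / 2)))"

text \<open>Worst case over all parameters, all lists of matrices and all coin flips. The bound is a
  generic polynomial in \<open>d\<close>, \<open>1/\<epsilon>\<close> and \<open>1/\<delta>\<close>, whose sum is at least 1.\<close>

definition poly_time_estimator ::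
  "com \<Rightarrow> com \<Rightarrow> (nat \<Rightarrow> real \<Rightarrow> real \<Rightarrow> real \<Rightarrow> nat) \<Rightarrow> bool" where
  "poly_time_estimator pick est N \<longleftrightarrow>
     (\<exists>k::nat. \<forall>d \<epsilon> \<sigma> \<delta>. 1 \<le> d \<and> 0 < \<epsilon> \<and> \<epsilon> < 1 \<and> 0 < \<sigma> \<and> 0 < \<delta> \<and> \<delta> < 1 \<longrightarrow>
        (let bound = real k * (real d + 1 / \<epsilon> + 1 / \<delta>) ^ k; n = N d \<epsilon> \<sigma> \<delta>
         in real n \<le> bound \<and>
            (\<forall>\<omega>. \<exists>t s'. exec pick (param_state d \<epsilon> \<sigma> \<delta> \<omega>) t s' \<and> real t \<le> bound \<and>
               idx s' ''N'' = n) \<and>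
            (\<forall>ys \<omega>. (\<forall>i<n. ys i \<in> carrier_mat d d) \<longrightarrow>
               (\<exists>t s'. exec est (sample_state d \<epsilon> \<sigma> \<delta> n ys \<omega>) t s' \<and> real t \<le> bound))))"

end

theory Submission imports Defs begin

text \<open>
  Discard the samples that are not positive semidefinite and give the others weight one. For a
  symmetric matrix \<open>A\<close> compare the weighted variance of \<open>tr (A X)\<close> with a constant multiple of
  \<open>\<sigma>\<^sup>2 tr (A M A M)\<close>, where \<open>M\<close> is the weighted mean. The surviving samples are positive
  semidefinite, so outliers can only increase the mean and \<open>2 M - \<Sigma>\<close> is positive semidefinite;
  hence the good samples have variance at most a constant multiple of \<open>\<sigma>\<^sup>2 tr (A M A M)\<close>, and a
  direction \<open>A\<close> that violates the comparison sees mostly outliers. Reweighting by the squared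
  deviations in such a direction removes more outlier weight than inlier weight and annihilates one
  sample, so at most \<open>N\<close> rounds are needed. The comparison is a quadratic form in \<open>A\<close>, and
  Gram--Schmidt orthogonalisation in exact real arithmetic decides its positivity or produces a
  violating direction. Once no direction is violated, testing \<open>A = \<Sigma>\<^sup>-\<^sup>1\<^sup>/\<^sup>2 m \<Sigma>\<^sup>-\<^sup>1\<^sup>/\<^sup>2\<close> for the
  normalised error \<open>m\<close> bounds the Frobenius norm of \<open>m\<close>.

  The good samples come from truncation: only second moments are assumed, so samples far from the
  mean are counted as outliers, and Markov's inequality controls the empirical first and second
  moments of the rest.
\<close>

section \<open>Loop programs\<close>

text \<open>In the coordinates \<open>W * X * W\<close>, with \<open>W\<close> the inverse root of
  \<Sigma>, the samples are vectors in d^2 dimensions whose covariance is at most V = C \<sigma>^2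
  times the identity, and the goal is robust mean estimation in Euclidean norm. The obstacle is that
  these coordinates are unknown to the algorithm. The yardstick \<open>ip d A (M * A * M)\<close>
  replaces the squared norm of \<Sigma>^(1/2) A \<Sigma>^(1/2): it is polynomial in the data and
  asks for neither roots nor eigenvectors. But M is computed from corrupted data. If it were too
  small in some direction, honest variance would look like a violation; adding semidefinite outliers
  cannot cause this. If it were too large, outliers could hide behind it. This is excluded only at
  the end, where M is expressed through the normalised error itself: the inequality for the norm f
  of that error contains a term of order sqrt(lam \<epsilon>) f^2, with lam a multiple of
  \<sigma>^2, and smallness of \<epsilon> \<sigma>^2 absorbs it. The root of \<Sigma> occurs in the
  analysis only; it comes from a binomial series.\<close>

primrec iv :: "(name \<Rightarrow> nat) \<Rightarrow> iexp \<Rightarrow> nat" where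
  "iv \<rho> (IConst n) = n"
| "iv \<rho> (IVar x) = \<rho> x"
| "iv \<rho> (IAdd a b) = iv \<rho> a + iv \<rho> b"
| "iv \<rho> (ISub a b) = iv \<rho> a - iv \<rho> b"

primrec rv :: "(name \<Rightarrow> nat) \<Rightarrow> (name \<Rightarrow> nat list \<Rightarrow> real) \<Rightarrow> rexp \<Rightarrow> real" where
  "rv \<rho> m (RIdx a) = real (iv \<rho> a)"
| "rv \<rho> m (RCell x as) = m x (map (iv \<rho>) as)"
| "rv \<rho> m (RAdd p q) = rv \<rho> m p + rv \<rho> m q"
| "rv \<rho> m (RSub p q) = rv \<rho> m p - rv \<rho> m q"
| "rv \<rho> m (RMul p q) = rv \<rho> m p * rv \<rho> m q"
| "rv \<rho> m (RDiv p q) = rv \<rho> m p / rv \<rho> m q"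

primrec bv :: "(name \<Rightarrow> nat) \<Rightarrow> (name \<Rightarrow> nat list \<Rightarrow> real) \<Rightarrow> bexp \<Rightarrow> bool" where
  "bv \<rho> m (ILess a b) \<longleftrightarrow> iv \<rho> a < iv \<rho> b"
| "bv \<rho> m (RLess p q) \<longleftrightarrow> rv \<rho> m p < rv \<rho> m q"
| "bv \<rho> m (Neg b) \<longleftrightarrow> \<not> bv \<rho> m b"
| "bv \<rho> m (Conj b c) \<longleftrightarrow> bv \<rho> m b \<and> bv \<rho> m c"

primrec ivars :: "iexp \<Rightarrow> name set" where
  "ivars (IConst n) = {}"
| "ivars (IVar x) = {x}"
| "ivars (IAdd a b) = ivars a \<union> ivars b"
| "ivars (ISub a b) = ivars a \<union> ivars b"

primrec rvars :: "rexp \<Rightarrow> name set" where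
  "rvars (RIdx a) = ivars a"
| "rvars (RCell x as) = (\<Union>a\<in>set as. ivars a)"
| "rvars (RAdd p q) = rvars p \<union> rvars q"
| "rvars (RSub p q) = rvars p \<union> rvars q"
| "rvars (RMul p q) = rvars p \<union> rvars q"
| "rvars (RDiv p q) = rvars p \<union> rvars q"

primrec bvars :: "bexp \<Rightarrow> name set" where
  "bvars (ILess a b) = ivars a \<union> ivars b"
| "bvars (RLess p q) = rvars p \<union> rvars q"
| "bvars (Neg b) = bvars b"
| "bvars (Conj b c) = bvars b \<union> bvars c"

primrec arrays :: "rexp \<Rightarrow> name set" where
  "arrays (RIdx a) = {}"
| "arrays (RCell x as) = {x}"
| "arrays (RAdd p q) = arrays p \<union> arrays q"
| "arrays (RSub p q) = arrays p \<union> arrays q"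
| "arrays (RMul p q) = arrays p \<union> arrays q"
| "arrays (RDiv p q) = arrays p \<union> arrays q"

text \<open>The state is split into index variables and memory: loop counters become an environment
  \<open>\<rho>\<close>, so that the meaning of a program is a map on memories. Agreement is asked
  only on the variables that occur, since counters of finished loops keep stale values.\<close>

lemma ival_iv: "(\<And>x. x \<in> ivars a \<Longrightarrow> idx s x = \<rho> x) \<Longrightarrow> ival s a = iv \<rho> a"
  by (induction a) auto

lemma rval_rv: "(\<And>x. x \<in> rvars e \<Longrightarrow> idx s x = \<rho> x) \<Longrightarrow> rval s e = rv \<rho> (mem s) e"
proof (induction e)
  case (RCell x as)
  have "map (ival s) as = map (iv \<rho>) as"
    using RCell by (intro map_cong refl ival_iv) auto
  then show ?case by (simp only: rval.simps rv.simps)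
qed (auto simp: ival_iv)

lemma bval_bv: "(\<And>x. x \<in> bvars b \<Longrightarrow> idx s x = \<rho> x) \<Longrightarrow> bval s b = bv \<rho> (mem s) b"
proof (induction b)
  case (ILess a b)
  then show ?case using ival_iv[of a s \<rho>] ival_iv[of b s \<rho>] by auto
next
  case (RLess a b)
  then show ?case using rval_rv[of a s \<rho>] rval_rv[of b s \<rho>] by auto
qed auto

lemma rv_arrays: "(\<And>x. x \<in> arrays e \<Longrightarrow> m x = m' x) \<Longrightarrow> rv \<rho> m e = rv \<rho> m' e"
  by (induction e) auto

text \<open>Index expressions have no product; the bound \<open>BSq\<close>, which is \<open>d\<^sup>2\<close>, is computed as a real number.\<close>
datatype bound = BVar name | BSq

primrec bnd :: "(name \<Rightarrow> nat) \<Rightarrow> bound \<Rightarrow> nat" where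
  "bnd \<rho> (BVar x) = \<rho> x"
| "bnd \<rho> BSq = \<rho> ''d'' * \<rho> ''d''"

primrec bound_rexp :: "bound \<Rightarrow> rexp" where
  "bound_rexp (BVar x) = RIdx (IVar x)"
| "bound_rexp BSq = RMul (RIdx (IVar ''d'')) (RIdx (IVar ''d''))"

primrec bound_vars :: "bound \<Rightarrow> name set" where
  "bound_vars (BVar x) = {x}"
| "bound_vars BSq = {''d''}"

text \<open>Index variables cannot be assigned, only bound by loops. The trip count of a loop is
  therefore fixed on entry, termination is automatic, and the cost can be read off the
  syntax.\<close>

datatype lcom =
    LSkip
  | LSet name "name list" rexp
  | LSeq lcom lcom (infixr ";;" 60)
  | LCond bexp lcom lcom
  | LFor name bound lcom

primrec iter :: "nat \<Rightarrow> (nat \<Rightarrow> 'a \<Rightarrow> 'a) \<Rightarrow> 'a \<Rightarrow> 'a" where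
  "iter 0 f x = x"
| "iter (Suc n) f x = f n (iter n f x)"

lemma iter_invariant:
  assumes "P 0 x" "\<And>i y. i < n \<Longrightarrow> P i y \<Longrightarrow> P (Suc i) (f i y)"
  shows "P n (iter n f x)"
  using assms by (induction n) auto

text \<open>The counter is compared with its bound as a real number, because \<open>BSq\<close> is
  available only as a real expression.\<close>

primrec compile :: "lcom \<Rightarrow> com" where
  "compile LSkip = Skip"
| "compile (LSet x ys e) = RSet x (map IVar ys) e"
| "compile (c1 ;; c2) = Seq (compile c1) (compile c2)"
| "compile (LCond b c1 c2) = Cond b (compile c1) (compile c2)"
| "compile (LFor x b c) = Seq (ISet x (IConst 0))
     (While (RLess (RIdx (IVar x)) (bound_rexp b))
       (Seq (compile c) (ISet x (IAdd (IVar x) (IConst 1)))))"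

primrec den :: "lcom \<Rightarrow> (name \<Rightarrow> nat) \<Rightarrow> (name \<Rightarrow> nat list \<Rightarrow> real) \<Rightarrow> name \<Rightarrow> nat list \<Rightarrow> real" where
  "den LSkip \<rho> m = m"
| "den (LSet x ys e) \<rho> m = m(x := (m x)(map \<rho> ys := rv \<rho> m e))"
| "den (c1 ;; c2) \<rho> m = den c2 \<rho> (den c1 \<rho> m)"
| "den (LCond b c1 c2) \<rho> m = (if bv \<rho> m b then den c1 \<rho> m else den c2 \<rho> m)"
| "den (LFor x b c) \<rho> m = iter (bnd \<rho> b) (\<lambda>i. den c (\<rho>(x := i))) m"

text \<open>A loop may not rebind a name in scope: the compiled loop overwrites its counter for
  good, so shadowing would destroy an outer value that the environment still assumes.\<close>

primrec scoped :: "name set \<Rightarrow> lcom \<Rightarrow> bool" where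
  "scoped G LSkip \<longleftrightarrow> True"
| "scoped G (LSet x ys e) \<longleftrightarrow> set ys \<subseteq> G \<and> rvars e \<subseteq> G"
| "scoped G (c1 ;; c2) \<longleftrightarrow> scoped G c1 \<and> scoped G c2"
| "scoped G (LCond b c1 c2) \<longleftrightarrow> bvars b \<subseteq> G \<and> scoped G c1 \<and> scoped G c2"
| "scoped G (LFor x b c) \<longleftrightarrow> x \<notin> G \<and> bound_vars b \<subseteq> G \<and> scoped (insert x G) c"

text \<open>\<open>L\<close> stands for a bound on every trip count. A conditional is charged for
  both branches, which keeps the estimate additive.\<close>

primrec cost :: "nat \<Rightarrow> lcom \<Rightarrow> nat" where
  "cost L LSkip = 1"
| "cost L (LSet x ys e) = 1"
| "cost L (c1 ;; c2) = cost L c1 + cost L c2"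
| "cost L (LCond b c1 c2) = 1 + cost L c1 + cost L c2"
| "cost L (LFor x b c) = 2 + L * (2 + cost L c)"

text \<open>The nesting depth of a fixed program is fixed. The same \<open>k\<close> serves as
  factor and exponent, the shape required by \<open>poly_time_estimator\<close>.\<close>

lemma cost_polynomial: "\<exists>k. \<forall>L. cost L c \<le> k * (L + 1) ^ k"
proof (induction c)
  case LSkip
  show ?case by (rule exI[of _ 1]) auto
next
  case (LSet x ys e)
  show ?case by (rule exI[of _ 1]) auto
next
  case (LSeq c1 c2)
  then obtain k1 k2 where k: "\<forall>L. cost L c1 \<le> k1 * (L + 1) ^ k1" "\<forall>L. cost L c2 \<le> k2 * (L + 1) ^ k2"
    by blast
  have "cost L (LSeq c1 c2) \<le> (k1 + k2) * (L + 1) ^ (k1 + k2)" for L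
  proof -
    have "cost L (LSeq c1 c2) \<le> k1 * (L + 1) ^ k1 + k2 * (L + 1) ^ k2"
      using k by (simp add: add_mono)
    also have "\<dots> \<le> k1 * (L + 1) ^ (k1 + k2) + k2 * (L + 1) ^ (k1 + k2)"
      by (intro add_mono mult_left_mono power_increasing) auto
    finally show ?thesis by (simp add: algebra_simps)
  qed
  then show ?case by blast
next
  case (LCond b c1 c2)
  then obtain k1 k2 where k: "\<forall>L. cost L c1 \<le> k1 * (L + 1) ^ k1" "\<forall>L. cost L c2 \<le> k2 * (L + 1) ^ k2"
    by blast
  have "cost L (LCond b c1 c2) \<le> (1 + k1 + k2) * (L + 1) ^ (1 + k1 + k2)" for L
  proof -
    have "cost L (LCond b c1 c2) \<le> 1 * (L + 1) ^ 0 + k1 * (L + 1) ^ k1 + k2 * (L + 1) ^ k2"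
      using k by (simp add: add_mono)
    also have "\<dots> \<le> 1 * (L + 1) ^ (1 + k1 + k2) + k1 * (L + 1) ^ (1 + k1 + k2) + k2 * (L + 1) ^ (1 + k1 + k2)"
      by (intro add_mono mult_left_mono power_increasing) auto
    finally show ?thesis by (simp add: algebra_simps)
  qed
  then show ?case by blast
next
  case (LFor x b c)
  then obtain k where k: "\<forall>L. cost L c \<le> k * (L + 1) ^ k"
    by blast
  have "cost L (LFor x b c) \<le> (k + 4) * (L + 1) ^ (k + 4)" for L
  proof -
    have "cost L (LFor x b c) \<le> 2 + L * (2 + k * (L + 1) ^ k)"
      using k by (simp add: add_mono)
    also have "\<dots> \<le> 2 + (L + 1) * (2 + k * (L + 1) ^ k)"
      by (intro add_mono mult_right_mono) auto
    also have "\<dots> = 2 * (L + 1) ^ 0 + 2 * (L + 1) ^ 1 + k * (L + 1) ^ (k + 1)"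
      by (simp add: algebra_simps)
    also have "\<dots> \<le> 2 * (L + 1) ^ (k + 4) + 2 * (L + 1) ^ (k + 4) + k * (L + 1) ^ (k + 4)"
      by (intro add_mono mult_left_mono power_increasing) auto
    finally show ?thesis by (simp add: algebra_simps)
  qed
  then show ?case by blast
qed

lemma rval_bound_rexp:
  "(\<And>x. x \<in> bound_vars b \<Longrightarrow> idx s x = \<rho> x) \<Longrightarrow> rval s (bound_rexp b) = real (bnd \<rho> b)"
  by (cases b) auto

text \<open>The induction keeps state and environment in agreement on the scope \<open>G\<close>
  only. As \<open>G\<close> contains ''d'', a fresh counter differs from it, and binding the counter
  leaves the value of \<open>BSq\<close> alone.\<close>

lemma compile_correct:
  assumes "scoped G c" "{''d'', ''N''} \<subseteq> G"
    "\<And>x. x \<in> G \<Longrightarrow> idx s x = \<rho> x" "\<And>x. x \<in> G \<Longrightarrow> \<rho> x \<le> L" "\<rho> ''d'' * \<rho> ''d'' \<le> L"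
  shows "\<exists>t s'. exec (compile c) s t s' \<and> mem s' = den c \<rho> (mem s) \<and>
    (\<forall>x\<in>G. idx s' x = \<rho> x) \<and> t \<le> cost L c"
  using assms
proof (induction c arbitrary: G s \<rho>)
  case LSkip
  then show ?case by (auto intro!: exI exec.Skip)
next
  case (LSet x ys e)
  have 1: "rval s e = rv \<rho> (mem s) e"
    using LSet.prems by (intro rval_rv) auto
  have 2: "map (ival s) (map IVar ys) = map \<rho> ys"
    using LSet.prems by auto
  show ?case unfolding compile.simps
    apply (rule exI, rule exI, rule conjI, rule exec.RSet)
    using LSet.prems unfolding 1 2 by simp
next
  case (LSeq c1 c2)
  from LSeq.IH(1)[of G s \<rho>] LSeq.prems obtain t1 s1 where
    1: "exec (compile c1) s t1 s1" "mem s1 = den c1 \<rho> (mem s)"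
      "\<forall>x\<in>G. idx s1 x = \<rho> x" "t1 \<le> cost L c1" by auto
  from LSeq.IH(2)[of G s1 \<rho>] LSeq.prems 1 obtain t2 s2 where
    2: "exec (compile c2) s1 t2 s2" "mem s2 = den c2 \<rho> (mem s1)"
      "\<forall>x\<in>G. idx s2 x = \<rho> x" "t2 \<le> cost L c2" by auto
  show ?case
    by (rule exI[of _ "t1 + t2"], rule exI[of _ s2]) (use 1 2 in \<open>auto intro: exec.Seq\<close>)
next
  case (LCond b c1 c2)
  have b: "bval s b = bv \<rho> (mem s) b"
    using LCond.prems by (intro bval_bv) auto
  show ?case
  proof (cases "bval s b")
    case True
    from LCond.IH(1)[of G s \<rho>] LCond.prems obtain t1 s1 where
      1: "exec (compile c1) s t1 s1" "mem s1 = den c1 \<rho> (mem s)"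
        "\<forall>x\<in>G. idx s1 x = \<rho> x" "t1 \<le> cost L c1" by auto
    show ?thesis
      by (rule exI[of _ "1 + t1"], rule exI[of _ s1])
        (use 1 True b exec.CondTrue[OF True 1(1)] in auto)
  next
    case False
    from LCond.IH(2)[of G s \<rho>] LCond.prems obtain t1 s1 where
      1: "exec (compile c2) s t1 s1" "mem s1 = den c2 \<rho> (mem s)"
        "\<forall>x\<in>G. idx s1 x = \<rho> x" "t1 \<le> cost L c2" by auto
    show ?thesis
      by (rule exI[of _ "1 + t1"], rule exI[of _ s1])
        (use 1 False b exec.CondFalse[OF False 1(1)] in auto)
  qed
next
  case (LFor x b c)
  have x: "x \<notin> G" and bG: "bound_vars b \<subseteq> G" and sc: "scoped (insert x G) c"
    using LFor.prems by auto
  define n where "n = bnd \<rho> b"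
  have nL: "n \<le> L" using LFor.prems bG unfolding n_def by (cases b) auto
  have rb: "rval s' (bound_rexp b) = real n" if "\<forall>x\<in>G. idx s' x = \<rho> x" for s'
    unfolding n_def using that bG by (intro rval_bound_rexp) auto
  define f where "f = (\<lambda>i. den c (\<rho>(x := i)))"
  let ?W = "While (RLess (RIdx (IVar x)) (bound_rexp b))
       (Seq (compile c) (ISet x (IAdd (IVar x) (IConst 1))))"
  \<comment> \<open>Induction on the number of remaining rounds, started from an arbitrary round
    \<open>i\<close>; \<open>m0\<close> is the memory on entry to the loop.\<close>
  have loop: "\<exists>t s''. exec ?W s' t s'' \<and> mem s'' = iter n f m0 \<and> (\<forall>x\<in>G. idx s'' x = \<rho> x) \<and>
      t \<le> 1 + (n - i) * (2 + cost L c)"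
    if "i \<le> n" "idx s' x = i" "\<forall>x\<in>G. idx s' x = \<rho> x" "mem s' = iter i f m0" for i s' m0
    using that
  proof (induction "n - i" arbitrary: i s')
    case 0
    then have "i = n" by simp
    have "\<not> bval s' (RLess (RIdx (IVar x)) (bound_rexp b))"
      using rb[OF 0(4)] 0(3) \<open>i = n\<close> by simp
    from exec.WhileFalse[OF this] show ?case
      using 0 \<open>i = n\<close> by (intro exI[of _ 1] exI[of _ s']) auto
  next
    case (Suc j)
    have "i < n" using Suc by simp
    have T: "bval s' (RLess (RIdx (IVar x)) (bound_rexp b))"
      using rb[OF Suc.prems(3)] Suc.prems(2) \<open>i < n\<close> by simp
    have "\<exists>t1 s1. exec (compile c) s' t1 s1 \<and> mem s1 = den c (\<rho>(x := i)) (mem s') \<and>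
       (\<forall>y\<in>insert x G. idx s1 y = (\<rho>(x := i)) y) \<and> t1 \<le> cost L c"
    proof (rule LFor.IH[OF sc])
      show "{''d'', ''N''} \<subseteq> insert x G" using LFor.prems by auto
      show "idx s' y = (\<rho>(x := i)) y" if "y \<in> insert x G" for y using that Suc.prems x by auto
      show "(\<rho>(x := i)) y \<le> L" if "y \<in> insert x G" for y
        using that LFor.prems x \<open>i < n\<close> nL by auto
      show "(\<rho>(x := i)) ''d'' * (\<rho>(x := i)) ''d'' \<le> L" using LFor.prems x by auto
    qed
    then obtain t1 s1 where 1: "exec (compile c) s' t1 s1" "mem s1 = f i (mem s')"
       "\<forall>y\<in>insert x G. idx s1 y = (\<rho>(x := i)) y" "t1 \<le> cost L c"
      unfolding f_def by auto
    define s2 where "s2 = s1\<lparr>idx := (idx s1)(x := ival s1 (IAdd (IVar x) (IConst 1)))\<rparr>"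
    have "\<exists>t s''. exec ?W s2 t s'' \<and> mem s'' = iter n f m0 \<and> (\<forall>x\<in>G. idx s'' x = \<rho> x) \<and>
      t \<le> 1 + (n - Suc i) * (2 + cost L c)"
    proof (rule Suc.hyps(1))
      show "j = n - Suc i" using Suc by simp
      show "Suc i \<le> n" using \<open>i < n\<close> by simp
      show "idx s2 x = Suc i" using 1 by (simp add: s2_def)
      show "\<forall>y\<in>G. idx s2 y = \<rho> y" using 1 x by (auto simp: s2_def)
      show "mem s2 = iter (Suc i) f m0" using 1 Suc.prems by (simp add: s2_def)
    qed
    then obtain t s'' where 2: "exec ?W s2 t s''" "mem s'' = iter n f m0"
      "\<forall>x\<in>G. idx s'' x = \<rho> x" "t \<le> 1 + (n - Suc i) * (2 + cost L c)" by blast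
    have "exec ?W s' (1 + (t1 + 1) + t) s''"
      by (rule exec.WhileTrue[OF T _ 2(1)]) (unfold s2_def, rule exec.Seq[OF 1(1) exec.ISet])
    moreover have "1 + (t1 + 1) + t \<le> 1 + (n - i) * (2 + cost L c)"
    proof -
      have "n - i = Suc (n - Suc i)" using \<open>i < n\<close> by simp
      then show ?thesis using 1(4) 2(4) by simp
    qed
    ultimately show ?case using 2 by blast
  qed
  define s0 where "s0 = s\<lparr>idx := (idx s)(x := ival s (IConst 0))\<rparr>"
  have "\<exists>t s''. exec ?W s0 t s'' \<and> mem s'' = iter n f (mem s) \<and> (\<forall>x\<in>G. idx s'' x = \<rho> x) \<and>
      t \<le> 1 + (n - 0) * (2 + cost L c)"
    by (rule loop) (use LFor.prems x in \<open>auto simp: s0_def\<close>)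
  then obtain t s'' where 2: "exec ?W s0 t s''" "mem s'' = iter n f (mem s)"
      "\<forall>x\<in>G. idx s'' x = \<rho> x" "t \<le> 1 + n * (2 + cost L c)" by auto
  have "exec (compile (LFor x b c)) s (1 + t) s''"
    unfolding compile.simps by (rule exec.Seq[OF exec.ISet 2(1)[unfolded s0_def]])
  moreover have "1 + t \<le> cost L (LFor x b c)"
  proof -
    have "n * (2 + cost L c) \<le> L * (2 + cost L c)" using nL by (rule mult_right_mono) simp
    then show ?thesis using 2(4) by simp
  qed
  ultimately show ?case using 2 by (auto simp: n_def f_def)
qed

section \<open>Nested sums and tensor assignments\<close>

primrec nsum :: "(name \<times> bound) list \<Rightarrow> (name \<Rightarrow> nat) \<Rightarrow> (name \<Rightarrow> nat list \<Rightarrow> real) \<Rightarrow> rexp \<Rightarrow> real" where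
  "nsum [] \<rho> m e = rv \<rho> m e"
| "nsum (xb # zs) \<rho> m e = (\<Sum>i<bnd \<rho> (snd xb). nsum zs (\<rho>(fst xb := i)) m e)"

primrec loops :: "(name \<times> bound) list \<Rightarrow> lcom \<Rightarrow> lcom" where
  "loops [] c = c"
| "loops (xb # xs) c = LFor (fst xb) (snd xb) (loops xs c)"

text \<open>The tensor assignment \<open>A[ps, xs] := \<Sum>zs. e\<close>; the cell itself serves as the accumulator.\<close>
definition lten :: "name \<Rightarrow> name list \<Rightarrow> (name \<times> bound) list \<Rightarrow> (name \<times> bound) list \<Rightarrow> rexp \<Rightarrow> lcom" where
  "lten A ps xs zs e = loops xs (LSet A (ps @ map fst xs) (RIdx (IConst 0)) ;;
     loops zs (LSet A (ps @ map fst xs) (RAdd (RCell A (map IVar (ps @ map fst xs))) e)))"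

text \<open>A loop nest is unrolled along an index list: \<open>in_range\<close> says that the list
  addresses a cell visited by the nest, and \<open>env\<close> is the environment in force at that
  cell. Later bounds may depend on earlier counters.\<close>

fun in_range :: "(name \<Rightarrow> nat) \<Rightarrow> (name \<times> bound) list \<Rightarrow> nat list \<Rightarrow> bool" where
  "in_range \<rho> [] l \<longleftrightarrow> l = []"
| "in_range \<rho> (xb # xs) [] \<longleftrightarrow> False"
| "in_range \<rho> (xb # xs) (i # l) \<longleftrightarrow> i < bnd \<rho> (snd xb) \<and> in_range (\<rho>(fst xb := i)) xs l"

fun env :: "(name \<Rightarrow> nat) \<Rightarrow> (name \<times> bound) list \<Rightarrow> nat list \<Rightarrow> name \<Rightarrow> nat" where
  "env \<rho> (xb # xs) (i # l) = env (\<rho>(fst xb := i)) xs l"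
| "env \<rho> _ _ = \<rho>"

lemma nsum_arrays: "(\<And>x. x \<in> arrays e \<Longrightarrow> m x = m' x) \<Longrightarrow> nsum zs \<rho> m e = nsum zs \<rho> m' e"
proof (induction zs arbitrary: \<rho>)
  case Nil
  show ?case unfolding nsum.simps by (rule rv_arrays) (rule Nil.prems)
next
  case (Cons a zs)
  show ?case unfolding nsum.simps using Cons.IH Cons.prems by (intro sum.cong refl) blast
qed

text \<open>Every increment is computed from the original memory because \<open>e\<close> does not
  read \<open>A\<close>, and all increments reach the same cell because the summation counters do
  not occur in its address.\<close>

lemma den_accumulate:
  assumes "A \<notin> arrays e" "set ys \<inter> fst ` set zs = {}"
  shows "den (loops zs (LSet A ys (RAdd (RCell A (map IVar ys)) e))) \<rho> m =
    m(A := (m A)(map \<rho> ys := m A (map \<rho> ys) + nsum zs \<rho> m e))"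
  using assms
proof (induction zs arbitrary: \<rho> m)
  case Nil
  then show ?case by (simp add: comp_def fun_upd_def)
next
  case (Cons xb zs)
  let ?l = "map \<rho> ys"
  have eq: "map (\<rho>(fst xb := i)) ys = ?l" for i
    using Cons.prems by auto
  have "iter n (\<lambda>i. den (loops zs (LSet A ys (RAdd (RCell A (map IVar ys)) e))) (\<rho>(fst xb := i))) m =
     m(A := (m A)(?l := m A ?l + (\<Sum>i<n. nsum zs (\<rho>(fst xb := i)) m e)))" for n
  proof (induction n)
    case (Suc n)
    have S: "nsum zs \<rho>' (m(A := g)) e = nsum zs \<rho>' m e" for \<rho>' g
      using Cons.prems by (intro nsum_arrays) auto
    show ?case unfolding iter.simps Suc
      by (subst Cons.IH) (use Cons.prems in \<open>auto simp: eq S add_ac\<close>)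
  qed simp
  then show ?case by (simp only: loops.simps den.simps nsum.simps)
qed

text \<open>\<open>ps\<close> holds the counters of enclosing loops, which select the slice that is
  written. The induction moves the outermost tensor index into \<open>ps\<close>. Since
  \<open>e\<close> does not read \<open>A\<close>, cells written earlier do not influence later
  ones.\<close>

lemma den_lten:
  assumes "A \<notin> arrays e" "distinct (ps @ map fst xs)" "(set ps \<union> fst ` set xs) \<inter> fst ` set zs = {}"
  shows "den (lten A ps xs zs e) \<rho> m = m(A := (\<lambda>l.
    if take (length ps) l = map \<rho> ps \<and> in_range \<rho> xs (drop (length ps) l)
    then nsum zs (env \<rho> xs (drop (length ps) l)) m e else m A l))"
  using assms
proof (induction xs arbitrary: ps \<rho> m)
  case Nil
  have S: "nsum zs \<rho> (m(A := g)) e = nsum zs \<rho> m e" for g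
    using Nil.prems by (intro nsum_arrays) auto
  have "(take (length ps) l = map \<rho> ps \<and> drop (length ps) l = []) \<longleftrightarrow> l = map \<rho> ps" for l
    by (metis append_Nil2 append_take_drop_id drop_all length_map order_refl take_all)
  then show ?case using Nil
    by (auto simp: lten_def den_accumulate S fun_eq_iff)
next
  case (Cons xb xs)
  obtain x b where xb: "xb = (x, b)" by (cases xb)
  have px: "x \<notin> set ps" using Cons.prems xb by auto
  have len: "lten A ps ((x, b) # xs) zs e = LFor x b (lten A (ps @ [x]) xs zs e)"
    by (simp add: lten_def)
  have IH: "den (lten A (ps @ [x]) xs zs e) (\<rho>(x := i)) m' = m'(A := (\<lambda>l.
      if take (length ps) l = map \<rho> ps \<and> (\<exists>l'. drop (length ps) l = i # l' \<and> in_range (\<rho>(x := i)) xs l')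
      then nsum zs (env (\<rho>(x := i)) xs (drop (Suc (length ps)) l)) m' e else m' A l))" for i m'
  proof -
    have eq: "map (\<rho>(x := i)) ps = map \<rho> ps" using px by auto
    have *: "take (Suc (length ps)) l = map \<rho> ps @ [i] \<and> in_range (\<rho>(x := i)) xs (drop (Suc (length ps)) l)
      \<longleftrightarrow> take (length ps) l = map \<rho> ps \<and> (\<exists>l'. drop (length ps) l = i # l' \<and> in_range (\<rho>(x := i)) xs l')" for l
    proof (cases "length ps < length l")
      case True
      then have "drop (length ps) l = l ! length ps # drop (Suc (length ps)) l"
        by (simp add: Cons_nth_drop_Suc)
      then show ?thesis using True by (auto simp: take_Suc_conv_app_nth)
    next
      case False
      then have "length (take (Suc (length ps)) l) \<noteq> length (map \<rho> ps @ [i])" by simp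
      then have "take (Suc (length ps)) l \<noteq> map \<rho> ps @ [i]" by metis
      then show ?thesis using False by auto
    qed
    show ?thesis
      by (subst Cons.IH) (use Cons.prems xb px in \<open>auto simp: eq * fun_eq_iff\<close>)
  qed
  define F where "F = (\<lambda>i. den (lten A (ps @ [x]) xs zs e) (\<rho>(x := i)))"
  have "iter n F m = m(A := (\<lambda>l.
      if take (length ps) l = map \<rho> ps \<and> (\<exists>i l'. i < n \<and> drop (length ps) l = i # l' \<and> in_range (\<rho>(x := i)) xs l')
      then nsum zs (env \<rho> ((x, b) # xs) (drop (length ps) l)) m e else m A l))" for n
  proof (induction n)
    case 0
    then show ?case by (auto simp: fun_eq_iff)
  next
    case (Suc n)
    have S: "nsum zs \<rho>' (m(A := g)) e = nsum zs \<rho>' m e" for \<rho>' g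
      using Cons.prems by (intro nsum_arrays) auto
    have d: "drop (Suc (length ps)) l = l'" if "drop (length ps) l = i # l'" for l i l'
      using that by (metis drop_Suc list.sel(3) tl_drop)
    have "iter (Suc n) F m = F n (iter n F m)" by simp
    also have "\<dots> = m(A := (\<lambda>l.
      if take (length ps) l = map \<rho> ps \<and> (\<exists>i l'. i < Suc n \<and> drop (length ps) l = i # l' \<and> in_range (\<rho>(x := i)) xs l')
      then nsum zs (env \<rho> ((x, b) # xs) (drop (length ps) l)) m e else m A l))"
      unfolding Suc by (auto simp: F_def IH fun_eq_iff S d less_Suc_eq)
    finally show ?case .
  qed
  moreover have "(\<exists>i l'. i < n \<and> l'' = i # l' \<and> in_range (\<rho>(x := i)) xs l') \<longleftrightarrow> 
     (case l'' of [] \<Rightarrow> False | i # l' \<Rightarrow> i < n \<and> in_range (\<rho>(x := i)) xs l')" for l'' n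
    by (cases l'') auto
  moreover have "in_range \<rho> ((x, b) # xs) l'' \<longleftrightarrow> (case l'' of [] \<Rightarrow> False | i # l' \<Rightarrow> i < bnd \<rho> b \<and> in_range (\<rho>(x := i)) xs l')" for l''
    by (cases l'') auto
  ultimately show ?case unfolding xb len den.simps F_def by simp
qed

section \<open>Gram--Schmidt orthogonalisation for indefinite forms\<close>

text \<open>Directions with zero pivot are skipped, because \<open>x / 0 = 0\<close>.\<close>
function gs :: "(nat \<Rightarrow> nat \<Rightarrow> real) \<Rightarrow> nat \<Rightarrow> nat \<Rightarrow> nat \<Rightarrow> real" where
  "gs B n k = (\<lambda>j. (if j = k then 1 else 0) -
     (\<Sum>i<k. (\<Sum>l<n. B k l * gs B n i l) /
       (\<Sum>l<n. gs B n i l * (\<Sum>h<n. B l h * gs B n i h)) * gs B n i j))"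
  by auto
termination by (relation "Wellfounded.measure (\<lambda>(B, n, k). k)") auto

declare gs.simps [simp del]

text \<open>With \<open>u\<close> the vector \<open>gs B n i\<close>, this is \<open>B u\<close>,
  and \<open>gs_pivot\<close> is \<open>u^T B u\<close>. If no pivot breaks down, the vectors and
  pivots encode the factorisation of \<open>B\<close> into unit triangular and diagonal matrices,
  which takes field operations only.\<close>

definition gs_image :: "(nat \<Rightarrow> nat \<Rightarrow> real) \<Rightarrow> nat \<Rightarrow> nat \<Rightarrow> nat \<Rightarrow> real" where
  "gs_image B n i l = (\<Sum>j<n. B l j * gs B n i j)"

definition gs_pivot :: "(nat \<Rightarrow> nat \<Rightarrow> real) \<Rightarrow> nat \<Rightarrow> nat \<Rightarrow> real" where
  "gs_pivot B n i = (\<Sum>j<n. gs B n i j * gs_image B n i j)"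

lemma gs_eq: "gs B n k j = (if j = k then 1 else 0) -
    (\<Sum>i<k. gs_image B n i k / gs_pivot B n i * gs B n i j)"
  by (subst gs.simps) (simp add: gs_image_def gs_pivot_def)

section \<open>Definiteness of a bilinear form read off its pivots\<close>

definition bil :: "(nat \<Rightarrow> nat \<Rightarrow> real) \<Rightarrow> nat \<Rightarrow> (nat \<Rightarrow> real) \<Rightarrow> (nat \<Rightarrow> real) \<Rightarrow> real" where
  "bil B n x y = (\<Sum>a<n. \<Sum>b<n. x a * B a b * y b)"

text \<open>The programs hold \<open>B\<close> only inside the n by n block, so everything computed
  from it has to depend on that block alone.\<close>

lemma gs_cong:
  assumes "\<And>i j. i < n \<Longrightarrow> j < n \<Longrightarrow> B i j = B' i j" "k < n"
  shows "gs B n k = gs B' n k"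
  using assms(2)
proof (induction k rule: less_induct)
  case (less k)
  have *: "gs_image B n i l = gs_image B' n i l" "gs_pivot B n i = gs_pivot B' n i" if "i < k" "l < n" for i l
    unfolding gs_image_def gs_pivot_def using less that assms(1) by simp_all
  show ?case
    by (rule ext, subst (1 2) gs_eq) (use less * in simp)
qed

lemma gs_image_cong:
  assumes "\<And>i j. i < n \<Longrightarrow> j < n \<Longrightarrow> B i j = B' i j" "k < n" "l < n"
  shows "gs_image B n k l = gs_image B' n k l"
  unfolding gs_image_def using assms gs_cong[of n B B' k] by simp

lemma gs_pivot_cong:
  assumes "\<And>i j. i < n \<Longrightarrow> j < n \<Longrightarrow> B i j = B' i j" "k < n"
  shows "gs_pivot B n k = gs_pivot B' n k"
  unfolding gs_pivot_def using assms gs_cong[of n B B' k] gs_image_cong[of n B B' k] by simp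

text \<open>Row \<open>k\<close> starts as the k-th unit vector and is changed by earlier rows only.
  The diagonal entry 1 will guarantee that a selected test direction is nonzero.\<close>

lemma gs_triangular: "gs B n k k = 1" "k < j \<Longrightarrow> gs B n k j = 0"
proof -
  have *: "\<forall>j>k. gs B n k j = 0" for k
  proof (induction k rule: less_induct)
    case (less k)
    show ?case by (subst gs_eq) (auto intro!: sum.neutral simp: less)
  qed
  then show "k < j \<Longrightarrow> gs B n k j = 0" by auto
  show "gs B n k k = 1"
    by (subst gs_eq) (auto intro!: sum.neutral simp: *)
qed

lemma bil_cong:
  assumes "\<And>a. a < n \<Longrightarrow> x a = x' a" "\<And>a. a < n \<Longrightarrow> y a = y' a"
    "\<And>a b. a < n \<Longrightarrow> b < n \<Longrightarrow> B a b = B' a b"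
  shows "bil B n x y = bil B' n x' y'"
  unfolding bil_def using assms by (auto intro!: sum.cong)

lemma bil_diff_left: "bil B n (\<lambda>a. x a - x' a) y = bil B n x y - bil B n x' y"
  by (simp add: bil_def algebra_simps sum_subtractf)

lemma bil_sum_left: "bil B n (\<lambda>a. \<Sum>i\<in>I. c i * x i a) y = (\<Sum>i\<in>I. c i * bil B n (x i) y)"
  unfolding bil_def sum_distrib_left sum_distrib_right
  apply (subst sum.swap, subst (2) sum.swap, rule sum.cong[OF refl])
  by (simp add: mult_ac)

lemma bil_commute:
  assumes "\<And>i j. i < n \<Longrightarrow> j < n \<Longrightarrow> B i j = B j i"
  shows "bil B n x y = bil B n y x"
  unfolding bil_def by (subst sum.swap) (use assms in \<open>auto intro!: sum.cong\<close>)

lemma bil_unit_left: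
  assumes "k < n"
  shows "bil B n (\<lambda>a. if a = k then 1 else 0) (gs B n i) = gs_image B n i k"
proof -
  have "bil B n (\<lambda>a. if a = k then 1 else 0) (gs B n i) =
      (\<Sum>a<n. if a = k then gs_image B n i k else 0)"
    unfolding bil_def gs_image_def by (intro sum.cong) (auto simp: sum_distrib_left)
  then show ?thesis using assms by simp
qed

lemma bil_gs_self: "bil B n (gs B n i) (gs B n i) = gs_pivot B n i"
  by (simp add: bil_def gs_pivot_def gs_image_def sum_distrib_left mult_ac)

text \<open>A zero pivot is harmless when its vector lies in the kernel of \<open>B\<close>: such a
  vector is orthogonal to everything, and there is nothing to correct.\<close>

lemma gs_orthogonal:
  assumes sym: "\<And>i j. i < n \<Longrightarrow> j < n \<Longrightarrow> B i j = B j i"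
    and piv: "\<And>i. i < n \<Longrightarrow> gs_pivot B n i \<noteq> 0 \<or> (\<forall>l<n. gs_image B n i l = 0)"
    and "i < k" "k < n"
  shows "bil B n (gs B n k) (gs B n i) = 0"
  using assms(3,4)
proof (induction k arbitrary: i rule: less_induct)
  case (less k)
  have orth: "bil B n (gs B n i') (gs B n i) = 0" if "i' < k" "i' \<noteq> i" for i'
  proof (cases "i < i'")
    case True
    then show ?thesis using less that by simp
  next
    case False
    then have "i' < i" using that by simp
    then have "bil B n (gs B n i) (gs B n i') = 0" using less by simp
    then show ?thesis using bil_commute[of n B "gs B n i'" "gs B n i", OF sym] by simp
  qed
  let ?c = "\<lambda>i'. gs_image B n i' k / gs_pivot B n i'"
  have "bil B n (gs B n k) (gs B n i) =
      bil B n (\<lambda>j. (if j = k then 1 else 0) - (\<Sum>i<k. ?c i * gs B n i j)) (gs B n i)"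
    by (rule bil_cong) (simp_all add: gs_eq[of B n k])
  also have "\<dots> = gs_image B n i k - (\<Sum>i'<k. ?c i' * bil B n (gs B n i') (gs B n i))"
    unfolding bil_diff_left bil_sum_left using less by (simp add: bil_unit_left)
  \<comment> \<open>Only \<open>i' = i\<close> survives, and its term equals
    \<open>gs_image B n i k\<close>: by cancellation if the pivot is nonzero, and because both are
    zero otherwise.\<close>
  also have "(\<Sum>i'<k. ?c i' * bil B n (gs B n i') (gs B n i)) =
      (\<Sum>i'<k. if i' = i then ?c i * gs_pivot B n i else 0)"
    by (intro sum.cong) (auto simp: orth bil_gs_self)
  also have "\<dots> = gs_image B n i k"
    using less piv[of i] by auto
  finally show ?case by simp
qed

text \<open>Back substitution: the rows are unit triangular, so subtracting \<open>x m\<close> times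
  row \<open>m\<close> clears the last coordinate.\<close>

lemma gs_spans:
  fixes x :: "nat \<Rightarrow> real"
  shows "\<exists>c. \<forall>j<n. x j = (\<Sum>k<n. c k * gs B n k j)"
proof -
  have "\<exists>c. \<forall>j<n. x j = (\<Sum>k<m. c k * gs B n k j)" if "m \<le> n" "\<And>j. m \<le> j \<Longrightarrow> j < n \<Longrightarrow> x j = 0" for m x
    using that
  proof (induction m arbitrary: x)
    case 0
    then show ?case by simp
  next
    case (Suc m)
    let ?x = "\<lambda>j. x j - x m * gs B n m j"
    have "\<exists>c. \<forall>j<n. ?x j = (\<Sum>k<m. c k * gs B n k j)"
    proof (rule Suc.IH)
      show "m \<le> n" using Suc by simp
      show "?x j = 0" if "m \<le> j" "j < n" for j
        using Suc.prems(2)[of j] that by (cases "j = m") (auto simp: gs_triangular)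
    qed
    then obtain c where c: "\<forall>j<n. ?x j = (\<Sum>k<m. c k * gs B n k j)" by blast
    have "\<forall>j<n. x j = (\<Sum>k<Suc m. (c(m := x m)) k * gs B n k j)"
      using c by (auto simp: algebra_simps)
    then show ?case by blast
  qed
  from this[of n x] show ?thesis by auto
qed

lemma bil_gs_sum:
  assumes sym: "\<And>i j. i < n \<Longrightarrow> j < n \<Longrightarrow> B i j = B j i"
    and piv: "\<And>i. i < n \<Longrightarrow> gs_pivot B n i \<noteq> 0 \<or> (\<forall>l<n. gs_image B n i l = 0)"
    and x: "\<And>j. j < n \<Longrightarrow> x j = (\<Sum>k<n. c k * gs B n k j)"
  shows "bil B n x x = (\<Sum>k<n. (c k)\<^sup>2 * gs_pivot B n k)"
proof -
  have orth: "bil B n (gs B n k) (gs B n i) = (if i = k then gs_pivot B n k else 0)" if "k < n" "i < n" for i k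
    using gs_orthogonal[OF sym piv, of i k] gs_orthogonal[OF sym piv, of k i] that
      bil_commute[of n B "gs B n k" "gs B n i", OF sym]
    by (cases i k rule: linorder_cases) (auto simp: bil_gs_self)
  have "bil B n x x = (\<Sum>k<n. c k * bil B n (gs B n k) x)"
    unfolding bil_sum_left[symmetric] by (rule bil_cong) (use x in auto)
  also have "\<dots> = (\<Sum>k<n. (c k)\<^sup>2 * gs_pivot B n k)"
  proof (intro sum.cong refl)
    fix k assume k: "k \<in> {..<n}"
    have "bil B n (gs B n k) x = bil B n x (gs B n k)" by (rule bil_commute[of n B, OF sym])
    also have "\<dots> = (\<Sum>i<n. c i * bil B n (gs B n i) (gs B n k))"
      unfolding bil_sum_left[symmetric] by (rule bil_cong) (use x in auto)
    also have "\<dots> = (\<Sum>i<n. if i = k then c k * gs_pivot B n k else 0)"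
      using orth k by (intro sum.cong) auto
    finally show "c k * bil B n (gs B n k) x = (c k)\<^sup>2 * gs_pivot B n k"
      using k by (simp add: power2_eq_square)
  qed
  finally show ?thesis .
qed

text \<open>If the cross term were nonzero, moving far from \<open>y\<close> along \<open>u\<close>
  would make the form negative, since the term quadratic in the step length vanishes.\<close>

lemma bil_null_direction:
  assumes sym: "\<And>i j. i < n \<Longrightarrow> j < n \<Longrightarrow> B i j = B j i"
    and psd: "\<And>x. 0 \<le> bil B n x x" and null: "bil B n u u = 0"
  shows "bil B n y u = 0"
proof (rule ccontr)
  assume ne: "bil B n y u \<noteq> 0"
  define p q where "p = bil B n y u" and "q = bil B n y y"
  have sq: "bil B n (\<lambda>a. y a - t * u a) (\<lambda>a. y a - t * u a) = q - 2 * t * p" for t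
  proof -
    have r: "bil B n (\<lambda>a. t * u a) z = t * bil B n u z" for z
      by (simp add: bil_def sum_distrib_left mult_ac)
    have "bil B n (\<lambda>a. y a - t * u a) (\<lambda>a. y a - t * u a) =
       bil B n y (\<lambda>a. y a - t * u a) - t * bil B n u (\<lambda>a. y a - t * u a)"
      unfolding bil_diff_left r by simp
    also have "bil B n y (\<lambda>a. y a - t * u a) = bil B n (\<lambda>a. y a - t * u a) y"
      by (rule bil_commute[of n B, OF sym])
    also have "bil B n u (\<lambda>a. y a - t * u a) = bil B n (\<lambda>a. y a - t * u a) u"
      by (rule bil_commute[of n B, OF sym])
    also have "bil B n (\<lambda>a. y a - t * u a) y = q - t * p"
      unfolding bil_diff_left r q_def p_def using bil_commute[of n B u y, OF sym] by simp
    also have "bil B n (\<lambda>a. y a - t * u a) u = p - t * bil B n u u"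
      unfolding bil_diff_left r p_def by simp
    finally show ?thesis using null by (simp add: p_def algebra_simps)
  qed
  \<comment> \<open>The step length is chosen to reach exactly -1.\<close>
  have "q - 2 * ((q + 1) / (2 * p)) * p = - 1"
    using ne by (simp add: p_def field_simps)
  then show False using psd sq[of "(q + 1) / (2 * p)"] by (metis not_one_le_zero neg_0_le_iff_le)
qed

definition passes :: "(nat \<Rightarrow> nat \<Rightarrow> real) \<Rightarrow> nat \<Rightarrow> bool" where
  "passes B n \<longleftrightarrow> (\<forall>i<n. 0 < gs_pivot B n i \<or> gs_pivot B n i = 0 \<and> (\<forall>l<n. gs_image B n i l = 0))"

text \<open>One direction is the diagonalisation, the other uses that a null vector of a
  semidefinite form lies in its kernel. Honest samples may be singular, so this test has to admit
  zero pivots.\<close>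

lemma passes_iff_psd:
  assumes sym: "\<And>i j. i < n \<Longrightarrow> j < n \<Longrightarrow> B i j = B j i"
  shows "passes B n \<longleftrightarrow> (\<forall>x. 0 \<le> bil B n x x)"
proof
  assume p: "passes B n"
  show "\<forall>x. 0 \<le> bil B n x x"
  proof
    fix x
    obtain c where c: "\<forall>j<n. x j = (\<Sum>k<n. c k * gs B n k j)" using gs_spans by blast
    have "bil B n x x = (\<Sum>k<n. (c k)\<^sup>2 * gs_pivot B n k)"
    proof (rule bil_gs_sum[OF sym])
      show "gs_pivot B n i \<noteq> 0 \<or> (\<forall>l<n. gs_image B n i l = 0)" if "i < n" for i
        using p that by (auto simp: passes_def)
    qed (use c in auto)
    also have "\<dots> \<ge> 0" using p by (intro sum_nonneg) (fastforce simp: passes_def)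
    finally show "0 \<le> bil B n x x" .
  qed
next
  assume psd: "\<forall>x. 0 \<le> bil B n x x"
  show "passes B n" unfolding passes_def
  proof (intro allI impI)
    fix i assume "i < n"
    show "0 < gs_pivot B n i \<or> gs_pivot B n i = 0 \<and> (\<forall>l<n. gs_image B n i l = 0)"
    proof (cases "gs_pivot B n i = 0")
      case True
      have "bil B n y (gs B n i) = 0" for y
        by (rule bil_null_direction[of n B, OF sym]) (use psd True in \<open>auto simp: bil_gs_self\<close>)
      then have "gs_image B n i l = 0" if "l < n" for l
        using that by (metis bil_unit_left)
      then show ?thesis using True by simp
    next
      case False
      have "0 \<le> gs_pivot B n i" using psd bil_gs_self[of B n i] by metis
      then show ?thesis using False by simp
    qed
  qed
qed

lemma gs_pivots_positive:
  assumes "\<And>i j. i < n \<Longrightarrow> j < n \<Longrightarrow> B i j = B j i" "\<And>k. k < n \<Longrightarrow> 0 < gs_pivot B n k"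
  shows "0 \<le> bil B n x x"
  using passes_iff_psd[of n B, OF assms(1)] assms(2) by (simp add: passes_def)

section \<open>The filter as a loop program\<close>

abbreviation "cell A xs \<equiv> RCell A (map IVar xs)"
abbreviation "rnat n \<equiv> RIdx (IConst n)"
abbreviation "rvar x \<equiv> RIdx (IVar x)"

lemma row_cells_iff: "take (Suc 0) l = [k] \<and> in_range \<rho> [(x, b)] (drop (Suc 0) l) \<longleftrightarrow> (\<exists>i<bnd \<rho> b. l = [k, i])"
proof (cases l)
  case (Cons a l')
  then show ?thesis by (cases l'; cases "tl l'") auto
qed auto

lemma den_lten_nil:
  assumes "A \<notin> arrays e" "distinct (map fst xs)" "fst ` set xs \<inter> fst ` set zs = {}"
  shows "den (lten A [] xs zs e) \<rho> m =
    m(A := (\<lambda>l. if in_range \<rho> xs l then nsum zs (env \<rho> xs l) m e else m A l))"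
  using den_lten[of A e "[]" xs zs \<rho> m] assms by (simp cong: if_cong)

text \<open>Run with \<open>n = d\<close> on single samples and with \<open>n = d * d\<close> on the
  comparison form. \<open>T\<close> is a buffer, because \<open>lten\<close> must not read the array
  that it writes. Division by zero skips null pivots as in \<open>gs\<close>.\<close>

definition gs_com :: "bound \<Rightarrow> lcom" where
  "gs_com b = LFor ''k'' b (
    lten ''T'' [] [(''j'', b)] [(''i'', BVar ''k'')]
      (RMul (RDiv (cell ''BU'' [''i'', ''k'']) (cell ''D'' [''i''])) (cell ''U'' [''i'', ''j''])) ;;
    lten ''U'' [''k''] [(''j'', b)] [] (RSub (rnat 0) (cell ''T'' [''j''])) ;;
    LSet ''U'' [''k'', ''k''] (RAdd (cell ''U'' [''k'', ''k'']) (rnat 1)) ;;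
    lten ''BU'' [''k''] [(''i'', b)] [(''j'', b)] (RMul (cell ''B'' [''i'', ''j'']) (cell ''U'' [''k'', ''j''])) ;;
    lten ''D'' [''k''] [] [(''j'', b)] (RMul (cell ''U'' [''k'', ''j'']) (cell ''BU'' [''k'', ''j''])))"

lemma den_gs_com:
  fixes \<rho> m b
  defines "n \<equiv> bnd \<rho> b" and "B \<equiv> (\<lambda>i j. m ''B'' [i, j])" and "m' \<equiv> den (gs_com b) \<rho> m"
  assumes b: "b = BVar ''d'' \<or> b = BSq"
  shows "x \<notin> {''T'', ''U'', ''BU'', ''D''} \<Longrightarrow> m' x = m x"
    and "i < n \<Longrightarrow> j < n \<Longrightarrow> m' ''U'' [i, j] = gs B n i j"
    and "i < n \<Longrightarrow> j < n \<Longrightarrow> m' ''BU'' [i, j] = gs_image B n i j"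
    and "i < n \<Longrightarrow> m' ''D'' [i] = gs_pivot B n i"
proof -
  have bn[simp]: "bnd (\<rho>(''k'' := k)) b = n" "bnd (\<rho>(''k'' := k, ''j'' := j)) b = n"
    "bnd (\<rho>(''k'' := k, ''i'' := i)) b = n" "bnd (\<rho>(''k'' := k, ''i'' := i, ''j'' := j)) b = n" for k i j
    using b by (auto simp: n_def)
  define P where "P = (\<lambda>k m'. (\<forall>x. x \<notin> {''T'', ''U'', ''BU'', ''D''} \<longrightarrow> m' x = m x) \<and>
    (\<forall>i<k. (\<forall>j<n. m' ''U'' [i, j] = gs B n i j \<and> m' ''BU'' [i, j] = gs_image B n i j) \<and>
       m' ''D'' [i] = gs_pivot B n i))"
  have "P n m'" unfolding m'_def gs_com_def den.simps(5) n_def[symmetric]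
  proof (rule iter_invariant[where P = P])
    show "P 0 m" by (simp add: P_def)
  next
    fix k m0
    assume "k < n" "P k m0"
    then have fr: "\<And>x. x \<notin> {''T'', ''U'', ''BU'', ''D''} \<Longrightarrow> m0 x = m x"
      and U: "\<And>i j. i < k \<Longrightarrow> j < n \<Longrightarrow> m0 ''U'' [i, j] = gs B n i j"
      and BU: "\<And>i j. i < k \<Longrightarrow> j < n \<Longrightarrow> m0 ''BU'' [i, j] = gs_image B n i j"
      and D: "\<And>i. i < k \<Longrightarrow> m0 ''D'' [i] = gs_pivot B n i"
      unfolding P_def by blast+
    have [simp]: "m0 ''B'' [i, j] = B i j" for i j
      using fr[of "''B''"] by (simp add: B_def)
    define u where "u = gs B n k"
    define m1 where "m1 = m0(''T'' := (\<lambda>l. if in_range (\<rho>(''k'' := k)) [(''j'', b)] l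
        then nsum [(''i'', BVar ''k'')] (env (\<rho>(''k'' := k)) [(''j'', b)] l) m0
          (RMul (RDiv (cell ''BU'' [''i'', ''k'']) (cell ''D'' [''i''])) (cell ''U'' [''i'', ''j'']))
        else m0 ''T'' l))"
    have T: "m1 ''T'' [j] = (\<Sum>i<k. gs_image B n i k / gs_pivot B n i * gs B n i j)" if "j < n" for j
      unfolding m1_def using that \<open>k < n\<close> by (auto intro!: sum.cong simp: U BU D)
    have m1: "m1 x = m0 x" if "x \<noteq> ''T''" for x using that by (simp add: m1_def)
    define m2 where "m2 = m1(''U'' := (\<lambda>l. if \<exists>j<n. l = [k, j] then 0 - m1 ''T'' [l ! 1] else m1 ''U'' l))"
    define m3 where "m3 = m2(''U'' := (m2 ''U'')([k, k] := m2 ''U'' [k, k] + 1))"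
    have m3U: "m3 ''U'' [k, j] = u j" if "j < n" for j
      using that T[OF that] unfolding m3_def m2_def u_def by (subst gs_eq) auto
    have m3U': "m3 ''U'' [i, j] = gs B n i j" if "i < k" "j < n" for i j
      using that unfolding m3_def m2_def by (simp add: m1 U)
    have m3: "m3 x = m0 x" if "x \<noteq> ''T''" "x \<noteq> ''U''" for x using that by (simp add: m1 m2_def m3_def)
    define m4 where "m4 = m3(''BU'' := (\<lambda>l. if \<exists>j<n. l = [k, j] then (\<Sum>j<n. m3 ''B'' [l ! 1, j] * m3 ''U'' [k, j]) else m3 ''BU'' l))"
    have m4BU: "m4 ''BU'' [k, j] = gs_image B n k j" if "j < n" for j
      using that by (simp add: m4_def gs_image_def m3 m3U u_def)
    define m5 where "m5 = m4(''D'' := (m4 ''D'')([k] := (\<Sum>j<n. m4 ''U'' [k, j] * m4 ''BU'' [k, j])))"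
    have m5D: "m5 ''D'' [k] = gs_pivot B n k"
    proof -
      have "m4 ''U'' = m3 ''U''" by (simp add: m4_def)
      then show ?thesis by (simp add: m5_def gs_pivot_def m4BU m3U u_def)
    qed
    have "den (lten ''T'' [] [(''j'', b)] [(''i'', BVar ''k'')]
        (RMul (RDiv (cell ''BU'' [''i'', ''k'']) (cell ''D'' [''i''])) (cell ''U'' [''i'', ''j'']))) (\<rho>(''k'' := k)) m0 = m1"
      unfolding m1_def by (subst den_lten_nil) auto
    moreover have "den (lten ''U'' [''k''] [(''j'', b)] [] (RSub (rnat 0) (cell ''T'' [''j'']))) (\<rho>(''k'' := k)) m1 = m2"
      unfolding m2_def by (subst den_lten) (auto simp: row_cells_iff fun_eq_iff)
    moreover have "den (LSet ''U'' [''k'', ''k''] (RAdd (cell ''U'' [''k'', ''k'']) (rnat 1))) (\<rho>(''k'' := k)) m2 = m3"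
      unfolding m3_def by simp
    moreover have "den (lten ''BU'' [''k''] [(''i'', b)] [(''j'', b)] (RMul (cell ''B'' [''i'', ''j'']) (cell ''U'' [''k'', ''j''])))
        (\<rho>(''k'' := k)) m3 = m4"
      unfolding m4_def by (subst den_lten) (auto simp: row_cells_iff fun_eq_iff)
    moreover have "den (lten ''D'' [''k''] [] [(''j'', b)] (RMul (cell ''U'' [''k'', ''j'']) (cell ''BU'' [''k'', ''j''])))
        (\<rho>(''k'' := k)) m4 = m5"
    proof -
      have "take (Suc 0) l = [k] \<and> drop (Suc 0) l = [] \<longleftrightarrow> l = [k]" for l :: "nat list"
        by (cases l) auto
      then show ?thesis unfolding m5_def by (subst den_lten) (auto simp: fun_eq_iff)
    qed
    moreover have "P (Suc k) m5"
      unfolding P_def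
    proof (intro conjI allI impI)
      fix x assume "x \<notin> {''T'', ''U'', ''BU'', ''D''}"
      then show "m5 x = m x" using m3[of x] fr[of x] by (simp add: m5_def m4_def)
    next
      fix i j assume ij: "i < Suc k" "j < n"
      show "m5 ''U'' [i, j] = gs B n i j"
        using ij m3U[of j] m3U'[of i j] by (cases "i = k") (simp_all add: m5_def m4_def u_def)
      show "m5 ''BU'' [i, j] = gs_image B n i j"
        using ij m4BU[of j] BU[of i j] by (cases "i = k") (simp_all add: m5_def m4_def m3)
    next
      fix i assume "i < Suc k"
      then show "m5 ''D'' [i] = gs_pivot B n i"
        using m5D D[of i] by (cases "i = k") (simp_all add: m5_def m4_def m3)
    qed
    ultimately show "P (Suc k)
        (den (lten ''T'' [] [(''j'', b)] [(''i'', BVar ''k'')]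
            (RMul (RDiv (cell ''BU'' [''i'', ''k'']) (cell ''D'' [''i''])) (cell ''U'' [''i'', ''j''])) ;;
          lten ''U'' [''k''] [(''j'', b)] [] (RSub (rnat 0) (cell ''T'' [''j''])) ;;
          LSet ''U'' [''k'', ''k''] (RAdd (cell ''U'' [''k'', ''k'']) (rnat 1)) ;;
          lten ''BU'' [''k''] [(''i'', b)] [(''j'', b)] (RMul (cell ''B'' [''i'', ''j'']) (cell ''U'' [''k'', ''j''])) ;;
          lten ''D'' [''k''] [] [(''j'', b)] (RMul (cell ''U'' [''k'', ''j'']) (cell ''BU'' [''k'', ''j''])))
          (\<rho>(''k'' := k)) m0)"
      by (simp only: den.simps(3))
  qed
  then show "x \<notin> {''T'', ''U'', ''BU'', ''D''} \<Longrightarrow> m' x = m x"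
    "i < n \<Longrightarrow> j < n \<Longrightarrow> m' ''U'' [i, j] = gs B n i j"
    "i < n \<Longrightarrow> j < n \<Longrightarrow> m' ''BU'' [i, j] = gs_image B n i j"
    "i < n \<Longrightarrow> m' ''D'' [i] = gs_pivot B n i"
    unfolding P_def by blast+
qed

section \<open>Rejecting samples that are not positive semidefinite\<close>

abbreviation "bD \<equiv> BVar ''d''"
abbreviation "bN \<equiv> BVar ''N''"

text \<open>Corrupted samples are arbitrary matrices. Taking the symmetric part leaves honest
  samples unchanged and makes all forms built later symmetric, as orthogonalisation
  requires.\<close>

definition sym_part :: "(nat \<Rightarrow> nat \<Rightarrow> real) \<Rightarrow> nat \<Rightarrow> nat \<Rightarrow> real" where
  "sym_part Y i j = (Y i j + Y j i) / 2"

text \<open>Reals can only be tested with \<open><\<close>: for a pivot \<open>D \<le> 0\<close>, the test \<open>0 < D\<^sup>2 + BU\<^sup>2\<close> detects a negative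
  pivot or a null vector outside the kernel.\<close>
abbreviation "flag_com \<equiv>
  LCond (Conj (Neg (RLess (rnat 0) (cell ''D'' [''i''])))
            (RLess (rnat 0) (RAdd (RMul (cell ''D'' [''i'']) (cell ''D'' [''i'']))
              (RMul (cell ''BU'' [''i'', ''k'']) (cell ''BU'' [''i'', ''k''])))))
          (LSet ''w'' [''s''] (rnat 0)) LSkip"

definition init_com :: lcom where
  "init_com = lten ''Y'' [] [(''s'', bN), (''i'', bD), (''j'', bD)] []
      (RDiv (RAdd (cell ''X'' [''s'', ''i'', ''j'']) (cell ''X'' [''s'', ''j'', ''i''])) (rnat 2)) ;;
    LFor ''s'' bN (
      lten ''B'' [] [(''i'', bD), (''j'', bD)] [] (cell ''Y'' [''s'', ''i'', ''j'']) ;;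
      gs_com bD ;;
      LSet ''w'' [''s''] (rnat 1) ;;
      LFor ''i'' bD (LFor ''k'' bD flag_com))"

lemma den_init_com:
  fixes \<rho> m
  defines "n \<equiv> \<rho> ''d''" and "Y \<equiv> (\<lambda>s. sym_part (\<lambda>i j. m ''X'' [s, i, j]))" and "m' \<equiv> den init_com \<rho> m"
  shows "m' ''sigma'' = m ''sigma''"
    and "s < \<rho> ''N'' \<Longrightarrow> i < n \<Longrightarrow> j < n \<Longrightarrow> m' ''Y'' [s, i, j] = Y s i j"
    and "s < \<rho> ''N'' \<Longrightarrow> m' ''w'' [s] = of_bool (passes (Y s) n)"
proof -
  define m1 where "m1 = den (lten ''Y'' [] [(''s'', bN), (''i'', bD), (''j'', bD)] []
      (RDiv (RAdd (cell ''X'' [''s'', ''i'', ''j'']) (cell ''X'' [''s'', ''j'', ''i''])) (rnat 2))) \<rho> m"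
  have m1: "m1 x = m x" if "x \<noteq> ''Y''" for x
    unfolding m1_def using that by (subst den_lten_nil) auto
  have m1Y: "m1 ''Y'' [s, i, j] = Y s i j" if "s < \<rho> ''N''" "i < n" "j < n" for s i j
    unfolding m1_def using that by (subst den_lten_nil) (auto simp: Y_def sym_part_def n_def)
  define P where "P = (\<lambda>k m'. m' ''sigma'' = m ''sigma'' \<and> m' ''Y'' = m1 ''Y'' \<and>
    (\<forall>s<k. m' ''w'' [s] = of_bool (passes (Y s) n)))"
  have "P (\<rho> ''N'') m'" unfolding m'_def init_com_def den.simps(3) m1_def[symmetric]
    unfolding den.simps(5) bnd.simps
  proof (rule iter_invariant[where P = P])
    show "P 0 m1" by (simp add: P_def m1)
  next
    fix s m0
    assume s: "s < \<rho> ''N''" and P0: "P s m0"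
    let ?r = "\<rho>(''s'' := s)"
    define m2 where "m2 = den (lten ''B'' [] [(''i'', bD), (''j'', bD)] [] (cell ''Y'' [''s'', ''i'', ''j''])) ?r m0"
    have m2: "m2 x = m0 x" if "x \<noteq> ''B''" for x
      unfolding m2_def using that by (subst den_lten_nil) auto
    have m2B: "m2 ''B'' [i, j] = Y s i j" if "i < n" "j < n" for i j
      unfolding m2_def using that P0 m1Y[OF s] by (subst den_lten_nil) (auto simp: P_def n_def)
    define m3 where "m3 = den (gs_com bD) ?r m2"
    have bn: "bnd ?r bD = n" by (simp add: n_def)
    note gsc = den_gs_com[where b = bD and \<rho> = ?r and m = m2, unfolded bn m3_def[symmetric]]
    have m3: "m3 ''w'' = m0 ''w''" "m3 ''Y'' = m0 ''Y''" "m3 ''sigma'' = m0 ''sigma''"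
      using gsc(1)[of "''w''"] gsc(1)[of "''Y''"] gsc(1)[of "''sigma''"] by (simp_all add: m2)
    have D: "m3 ''D'' [i] = gs_pivot (Y s) n i" if "i < n" for i
      using gsc(4)[of i] that gs_pivot_cong[of n "\<lambda>i j. m2 ''B'' [i, j]" "Y s"] m2B by simp
    have BU: "m3 ''BU'' [i, j] = gs_image (Y s) n i j" if "i < n" "j < n" for i j
      using gsc(3)[of i j] that gs_image_cong[of n "\<lambda>i j. m2 ''B'' [i, j]" "Y s"] m2B by simp
    define m4 where "m4 = den (LSet ''w'' [''s''] (rnat 1)) ?r m3"
    define bad where "bad = (\<lambda>i k. \<not> 0 < gs_pivot (Y s) n i \<and>
      0 < gs_pivot (Y s) n i * gs_pivot (Y s) n i + gs_image (Y s) n i k * gs_image (Y s) n i k)"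
    define m5 where "m5 = den (LFor ''i'' bD (LFor ''k'' bD flag_com)) ?r m4"
    define Q where "Q = (\<lambda>(b :: bool) y. (\<forall>x. x \<noteq> ''w'' \<longrightarrow> y x = m4 x) \<and> y ''w'' = (m4 ''w'')([s] := of_bool (\<not> b)))"
    \<comment> \<open>The double loop accumulates a disjunction: the weight is cleared at a bad pair
      and never restored.\<close>
    have Qstep: "Q (b \<or> bad i k) (den flag_com (?r(''i'' := i, ''k'' := k)) y)"
      if "Q b y" "i < n" "k < n" for b i k y
    proof -
      have "y ''D'' [i] = gs_pivot (Y s) n i" "y ''BU'' [i, k] = gs_image (Y s) n i k"
        using that D BU by (auto simp: Q_def m4_def)
      then show ?thesis using that(1) by (auto simp: Q_def bad_def)
    qed
    have "Q (\<exists>i<n. \<exists>c<n. bad i c) m5" unfolding m5_def den.simps(5)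
    proof -
      have b: "bnd ?r bD = n" "bnd (?r(''i'' := i)) bD = n" for i by (simp_all add: n_def)
      show "Q (\<exists>i<n. \<exists>c<n. bad i c) (iter (bnd ?r bD) (\<lambda>i. iter (bnd (?r(''i'' := i)) bD)
         (\<lambda>k. den flag_com (?r(''i'' := i, ''k'' := k)))) m4)"
        unfolding b
      proof (rule iter_invariant[where P = "\<lambda>i'. Q (\<exists>a<i'. \<exists>c<n. bad a c)"])
        show "Q (\<exists>i<0. \<exists>c<n. bad i c) m4"
          by (auto simp: Q_def m4_def fun_eq_iff)
      next
        fix i y assume i: "i < n" and Qi: "Q (\<exists>a<i. \<exists>c<n. bad a c) y"
        have "Q ((\<exists>a<i. \<exists>c<n. bad a c) \<or> (\<exists>c<n. bad i c)) (iter n (\<lambda>k. den flag_com (?r(''i'' := i, ''k'' := k))) y)"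
        proof (rule iter_invariant[where P = "\<lambda>k'. Q ((\<exists>a<i. \<exists>c<n. bad a c) \<or> (\<exists>c<k'. bad i c))"])
          show "Q ((\<exists>a<i. \<exists>c<n. bad a c) \<or> (\<exists>c<0. bad i c)) y" using Qi by simp
        next
          fix k z assume k: "k < n" and "Q ((\<exists>a<i. \<exists>c<n. bad a c) \<or> (\<exists>c<k. bad i c)) z"
          have eq: "((\<exists>a<i. \<exists>c<n. bad a c) \<or> (\<exists>c<Suc k. bad i c)) =
              (((\<exists>a<i. \<exists>c<n. bad a c) \<or> (\<exists>c<k. bad i c)) \<or> bad i k)"
            by (auto simp: less_Suc_eq)
          from Qstep[OF \<open>Q _ z\<close> i k]
          show "Q ((\<exists>a<i. \<exists>c<n. bad a c) \<or> (\<exists>c<Suc k. bad i c)) (den flag_com (?r(''i'' := i, ''k'' := k)) z)"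
            unfolding eq .
        qed
        moreover have eq: "(\<exists>a<Suc i. \<exists>c<n. bad a c) = ((\<exists>a<i. \<exists>c<n. bad a c) \<or> (\<exists>c<n. bad i c))"
          by (auto simp: less_Suc_eq)
        ultimately show "Q (\<exists>a<Suc i. \<exists>c<n. bad a c) (iter n (\<lambda>k. den flag_com (?r(''i'' := i, ''k'' := k))) y)"
          by simp
      qed
    qed
    \<comment> \<open>A negative pivot is bad at every \<open>k\<close>, and some \<open>k\<close>
      exists because \<open>i < n\<close>; a zero pivot is bad exactly at the nonzero entries of its
      image.\<close>
    moreover have "(\<exists>i<n. \<exists>c<n. bad i c) \<longleftrightarrow> \<not> passes (Y s) n"
    proof -
      have "bad i k \<longleftrightarrow> \<not> (0 < gs_pivot (Y s) n i \<or> gs_pivot (Y s) n i = 0 \<and> gs_image (Y s) n i k = 0)" for i k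
        unfolding bad_def
        by (metis add.commute add_nonneg_pos add_pos_nonneg mult_eq_0_iff add_0 less_irrefl
            not_real_square_gt_zero zero_le_square)
      then show ?thesis unfolding passes_def by (metis (full_types))
    qed
    ultimately have "Q (\<not> passes (Y s) n) m5" by simp
    then have "P (Suc s) m5"
      using P0 m3 unfolding P_def Q_def by (auto simp: m4_def less_Suc_eq)
    then show "P (Suc s) (den (lten ''B'' [] [(''i'', bD), (''j'', bD)] [] (cell ''Y'' [''s'', ''i'', ''j'']) ;;
      gs_com bD ;;
      LSet ''w'' [''s''] (rnat 1) ;;
      LFor ''i'' bD (LFor ''k'' bD flag_com)) ?r m0)"
      by (simp only: den.simps(3) m2_def[symmetric] m3_def[symmetric] m4_def[symmetric] m5_def[symmetric])
  qed
  then show "m' ''sigma'' = m ''sigma''"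
    "s < \<rho> ''N'' \<Longrightarrow> i < n \<Longrightarrow> j < n \<Longrightarrow> m' ''Y'' [s, i, j] = Y s i j"
    "s < \<rho> ''N'' \<Longrightarrow> m' ''w'' [s] = of_bool (passes (Y s) n)"
    unfolding P_def using m1Y by auto
qed

text \<open>A pair \<open>(i, j)\<close> is flattened to \<open>a = i * d + j\<close>. The factor \<open>1 - x / x\<close> is the indicator of \<open>x = 0\<close>,
  because \<open>0 / 0 = 0\<close>.\<close>
lemma unflatten_sum:
  fixes f :: "nat \<Rightarrow> nat \<Rightarrow> real"
  assumes "a < d * d"
  shows "(\<Sum>i<d. \<Sum>j<d. (1 - (real a - (real i * real d + real j)) / (real a - (real i * real d + real j))) * f i j) =
    f (a div d) (a mod d)"
proof -
  have d: "0 < d" using assms by (cases d) auto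
  have q: "a div d < d" using assms by (simp add: less_mult_imp_div_less)
  have r: "a mod d < d" using d by simp
  have eq: "real a - (real i * real d + real j) = 0 \<longleftrightarrow> i = a div d \<and> j = a mod d" if "j < d" for i j
  proof -
    have "real a - (real i * real d + real j) = 0 \<longleftrightarrow> real a = real (i * d + j)" by simp
    also have "\<dots> \<longleftrightarrow> a = i * d + j" by (rule of_nat_eq_iff)
    also have "\<dots> \<longleftrightarrow> i = a div d \<and> j = a mod d" using that d by auto
    finally show ?thesis .
  qed
  have "(\<Sum>i<d. \<Sum>j<d. (1 - (real a - (real i * real d + real j)) / (real a - (real i * real d + real j))) * f i j) =
    (\<Sum>i<d. \<Sum>j<d. if i = a div d \<and> j = a mod d then f i j else 0)"
  proof (intro sum.cong refl)
    fix i j assume "j \<in> {..<d}"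
    then show "(1 - (real a - (real i * real d + real j)) / (real a - (real i * real d + real j))) * f i j =
      (if i = a div d \<and> j = a mod d then f i j else 0)"
      using eq[of j i] by (cases "i = a div d \<and> j = a mod d") auto
  qed
  also have "\<dots> = (\<Sum>i<d. if i = a div d then f i (a mod d) else 0)"
    using r by (intro sum.cong refl) (auto simp: if_distrib)
  also have "\<dots> = f (a div d) (a mod d)" using q by simp
  finally show ?thesis .
qed

section \<open>Weighted moments and one round of the filter\<close>

definition wsum :: "nat \<Rightarrow> (nat \<Rightarrow> real) \<Rightarrow> real" where
  "wsum N w = (\<Sum>s<N. w s)"

definition wmean :: "nat \<Rightarrow> (nat \<Rightarrow> nat \<Rightarrow> nat \<Rightarrow> real) \<Rightarrow> (nat \<Rightarrow> real) \<Rightarrow> nat \<Rightarrow> nat \<Rightarrow> real" where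
  "wmean N Y w i j = (\<Sum>s<N. w s * Y s i j / wsum N w)"

definition wdev :: "nat \<Rightarrow> nat \<Rightarrow> (nat \<Rightarrow> nat \<Rightarrow> nat \<Rightarrow> real) \<Rightarrow> (nat \<Rightarrow> real) \<Rightarrow> nat \<Rightarrow> nat \<Rightarrow> real" where
  "wdev d N Y w s a = Y s (a div d) (a mod d) - wmean N Y w (a div d) (a mod d)"

text \<open>In flattened indices, the coefficients of \<open>lam * <A, M A M>\<close> minus the
  weighted variance of \<open><A, Y s>\<close>, as a form in \<open>A\<close>. The first part is the
  Kronecker square of the weighted mean \<open>M\<close>.\<close>

definition wform :: "real \<Rightarrow> nat \<Rightarrow> nat \<Rightarrow> (nat \<Rightarrow> nat \<Rightarrow> nat \<Rightarrow> real) \<Rightarrow> (nat \<Rightarrow> real) \<Rightarrow> nat \<Rightarrow> nat \<Rightarrow> real" where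
  "wform lam d N Y w a b = lam * (wmean N Y w (a div d) (b div d) * wmean N Y w (a mod d) (b mod d)) -
     (\<Sum>s<N. w s * wdev d N Y w s a * wdev d N Y w s b / wsum N w)"

text \<open>The zero vector encodes that no direction is violated.\<close>
definition selects :: "(nat \<Rightarrow> nat \<Rightarrow> real) \<Rightarrow> nat \<Rightarrow> (nat \<Rightarrow> real) \<Rightarrow> bool" where
  "selects B n v \<longleftrightarrow>
     (\<exists>k<n. gs_pivot B n k \<le> 0 \<and> (\<forall>a<n. v a = gs B n k a)) \<or>
     ((\<forall>k<n. 0 < gs_pivot B n k) \<and> (\<forall>a<n. v a = 0))"

text \<open>If the maximum \<open>t\<close> is \<open>0\<close>, then \<open>\<tau> s / t = 0\<close> and the weights do not change.\<close>
definition reweights :: "nat \<Rightarrow> (nat \<Rightarrow> real) \<Rightarrow> (nat \<Rightarrow> real) \<Rightarrow> (nat \<Rightarrow> real) \<Rightarrow> bool" where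
  "reweights N \<tau> w w' \<longleftrightarrow> (\<exists>t\<ge>0. (\<forall>s<N. 0 < w s \<longrightarrow> \<tau> s \<le> t) \<and>
     (t = 0 \<or> (\<exists>s<N. 0 < w s \<and> \<tau> s = t)) \<and> (\<forall>s<N. w' s = w s * (1 - \<tau> s / t)))"

definition filter_step ::
  "real \<Rightarrow> nat \<Rightarrow> nat \<Rightarrow> (nat \<Rightarrow> nat \<Rightarrow> nat \<Rightarrow> real) \<Rightarrow> (nat \<Rightarrow> real) \<Rightarrow> (nat \<Rightarrow> real) \<Rightarrow> bool" where
  "filter_step lam d N Y w w' \<longleftrightarrow> (\<exists>v. selects (wform lam d N Y w) (d * d) v \<and>
     reweights N (\<lambda>s. (\<Sum>a<d * d. v a * wdev d N Y w s a)\<^sup>2) w w')"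

section \<open>The round as a program\<close>

definition mean_com :: lcom where
  "mean_com = lten ''S'' [] [] [(''s'', bN)] (cell ''w'' [''s'']) ;;
    lten ''M'' [] [(''i'', bD), (''j'', bD)] [(''s'', bN)]
      (RDiv (RMul (cell ''w'' [''s'']) (cell ''Y'' [''s'', ''i'', ''j''])) (cell ''S'' []))"

definition position_rexp :: "name \<Rightarrow> name \<Rightarrow> name \<Rightarrow> rexp" where
  "position_rexp a i j = RSub (rvar a) (RAdd (RMul (rvar i) (rvar ''d'')) (rvar j))"

definition indicator_rexp :: "name \<Rightarrow> name \<Rightarrow> name \<Rightarrow> rexp" where
  "indicator_rexp a i j = RSub (rnat 1) (RDiv (position_rexp a i j) (position_rexp a i j))"

text \<open>Indices admit no division, so the entry at \<open>(a div d, a mod d)\<close> is fetched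
  by summing all entries against an indicator. This makes the assignment of \<open>Q\<close> a
  six-fold loop, still of polynomial length.\<close>

definition form_com :: "nat \<Rightarrow> lcom" where
  "form_com K =
    lten ''Z'' [] [(''s'', bN), (''a'', BSq)] [(''i'', bD), (''j'', bD)]
      (RMul (indicator_rexp ''a'' ''i'' ''j'') (RSub (cell ''Y'' [''s'', ''i'', ''j'']) (cell ''M'' [''i'', ''j'']))) ;;
    lten ''Q'' [] [(''a'', BSq), (''b'', BSq)] [(''i'', bD), (''j'', bD), (''k'', bD), (''l'', bD)]
      (RMul (indicator_rexp ''a'' ''i'' ''j'') (RMul (indicator_rexp ''b'' ''k'' ''l'')
        (RMul (cell ''M'' [''i'', ''k'']) (cell ''M'' [''j'', ''l''])))) ;;
    lten ''H'' [] [(''a'', BSq), (''b'', BSq)] [(''s'', bN)]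
      (RDiv (RMul (RMul (cell ''w'' [''s'']) (cell ''Z'' [''s'', ''a''])) (cell ''Z'' [''s'', ''b''])) (cell ''S'' [])) ;;
    lten ''B'' [] [(''a'', BSq), (''b'', BSq)] []
      (RSub (RMul (RMul (rnat K) (RMul (cell ''sigma'' []) (cell ''sigma'' []))) (cell ''Q'' [''a'', ''b'']))
        (cell ''H'' [''a'', ''b'']))"

text \<open>The last nonpositive pivot wins. Any would do: the form at the k-th vector equals the
  k-th pivot even when earlier pivots have destroyed orthogonality.\<close>

definition select_com :: lcom where
  "select_com = lten ''V'' [] [(''a'', BSq)] [] (rnat 0) ;;
    LFor ''k'' BSq (LCond (RLess (rnat 0) (cell ''D'' [''k''])) LSkip
      (lten ''V'' [] [(''a'', BSq)] [] (cell ''U'' [''k'', ''a''])))"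

abbreviation "max_com \<equiv> LCond (Conj (RLess (rnat 0) (cell ''w'' [''s'']))
        (RLess (cell ''t'' []) (RMul (cell ''P'' [''s'']) (cell ''P'' [''s'']))))
      (LSet ''t'' [] (RMul (cell ''P'' [''s'']) (cell ''P'' [''s'']))) LSkip"

definition reweight_com :: lcom where
  "reweight_com = lten ''P'' [] [(''s'', bN)] [(''a'', BSq)] (RMul (cell ''V'' [''a'']) (cell ''Z'' [''s'', ''a''])) ;;
    LSet ''t'' [] (rnat 0) ;;
    LFor ''s'' bN max_com ;;
    lten ''W'' [] [(''s'', bN)] []
      (RMul (cell ''w'' [''s'']) (RSub (rnat 1) (RDiv (RMul (cell ''P'' [''s'']) (cell ''P'' [''s''])) (cell ''t'' [])))) ;;
    lten ''w'' [] [(''s'', bN)] [] (cell ''W'' [''s''])"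

definition filter_com :: "nat \<Rightarrow> lcom" where
  "filter_com K = mean_com ;; form_com K ;; gs_com BSq ;; select_com ;; reweight_com"

text \<open>Exactly \<open>N\<close> rounds are run without a stopping test: once all pivots are
  positive, the selected vector is zero and further rounds leave the weights alone.\<close>

definition estimate_com :: "nat \<Rightarrow> lcom" where
  "estimate_com K = init_com ;; LFor ''r'' bN (filter_com K) ;; mean_com ;;
    lten ''out'' [] [(''i'', bD), (''j'', bD)] [] (cell ''M'' [''i'', ''j''])"

lemma scoped_estimate_com: "scoped {''d'', ''N''} (estimate_com K)"
  by (simp add: estimate_com_def init_com_def mean_com_def filter_com_def form_com_def select_com_def
      reweight_com_def gs_com_def lten_def indicator_rexp_def position_rexp_def)

abbreviation weights_of :: "(name \<Rightarrow> nat list \<Rightarrow> real) \<Rightarrow> nat \<Rightarrow> real" where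
  "weights_of m s \<equiv> m ''w'' [s]"

abbreviation samples_of :: "(name \<Rightarrow> nat list \<Rightarrow> real) \<Rightarrow> nat \<Rightarrow> nat \<Rightarrow> nat \<Rightarrow> real" where
  "samples_of m s i j \<equiv> m ''Y'' [s, i, j]"

lemma den_mean_com:
  fixes \<rho> m
  defines "m' \<equiv> den mean_com \<rho> m"
  shows "x \<notin> {''S'', ''M''} \<Longrightarrow> m' x = m x"
    and "m' ''S'' [] = wsum (\<rho> ''N'') (weights_of m)"
    and "i < \<rho> ''d'' \<Longrightarrow> j < \<rho> ''d'' \<Longrightarrow> m' ''M'' [i, j] = wmean (\<rho> ''N'') (samples_of m) (weights_of m) i j"
proof -
  define m1 where "m1 = den (lten ''S'' [] [] [(''s'', bN)] (cell ''w'' [''s''])) \<rho> m"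
  have m1: "m1 = m(''S'' := (\<lambda>l. if l = [] then wsum (\<rho> ''N'') (weights_of m) else m ''S'' l))"
    unfolding m1_def by (subst den_lten_nil) (auto simp: wsum_def fun_eq_iff)
  have m': "m' = m1(''M'' := (\<lambda>l. if in_range \<rho> [(''i'', bD), (''j'', bD)] l then
     nsum [(''s'', bN)] (env \<rho> [(''i'', bD), (''j'', bD)] l) m1
       (RDiv (RMul (cell ''w'' [''s'']) (cell ''Y'' [''s'', ''i'', ''j''])) (cell ''S'' [])) else m1 ''M'' l))"
    unfolding m'_def mean_com_def den.simps(3) m1_def[symmetric] by (subst den_lten_nil) auto
  show "x \<notin> {''S'', ''M''} \<Longrightarrow> m' x = m x" unfolding m' by (simp add: m1)
  show "m' ''S'' [] = wsum (\<rho> ''N'') (weights_of m)" unfolding m' by (simp add: m1)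
  show "i < \<rho> ''d'' \<Longrightarrow> j < \<rho> ''d'' \<Longrightarrow> m' ''M'' [i, j] = wmean (\<rho> ''N'') (samples_of m) (weights_of m) i j"
    unfolding m' by (simp add: m1 wmean_def)
qed

lemma den_form_com:
  fixes \<rho> m K
  defines "m' \<equiv> den (form_com K) \<rho> m" and "d \<equiv> \<rho> ''d''" and "N \<equiv> \<rho> ''N''"
  assumes S: "m ''S'' [] = wsum N (weights_of m)"
    and M: "\<And>i j. i < d \<Longrightarrow> j < d \<Longrightarrow> m ''M'' [i, j] = wmean N (samples_of m) (weights_of m) i j"
  shows "x \<notin> {''Z'', ''Q'', ''H'', ''B''} \<Longrightarrow> m' x = m x"
    and "s < N \<Longrightarrow> a < d * d \<Longrightarrow> m' ''Z'' [s, a] = wdev d N (samples_of m) (weights_of m) s a"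
    and "a < d * d \<Longrightarrow> b < d * d \<Longrightarrow> m' ''B'' [a, b] =
      wform (real K * (m ''sigma'' [])\<^sup>2) d N (samples_of m) (weights_of m) a b"
proof -
  have div: "a div d < d" "a mod d < d" if "a < d * d" for a
    using that by (auto simp: less_mult_imp_div_less intro!: mod_less_divisor gr0I)
  let ?w = "weights_of m" and ?Y = "samples_of m"
  define m1 where "m1 = den (lten ''Z'' [] [(''s'', bN), (''a'', BSq)] [(''i'', bD), (''j'', bD)]
      (RMul (indicator_rexp ''a'' ''i'' ''j'') (RSub (cell ''Y'' [''s'', ''i'', ''j'']) (cell ''M'' [''i'', ''j''])))) \<rho> m"
  have m1: "m1 x = m x" if "x \<noteq> ''Z''" for x
    unfolding m1_def using that by (subst den_lten_nil) (auto simp: indicator_rexp_def position_rexp_def)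
  have m1Z: "m1 ''Z'' [s, a] = wdev d N ?Y ?w s a" if "s < N" "a < d * d" for s a
  proof -
    have "m1 ''Z'' [s, a] = (\<Sum>i<d. \<Sum>j<d. (1 - (real a - (real i * real d + real j)) / (real a - (real i * real d + real j))) *
        (m ''Y'' [s, i, j] - m ''M'' [i, j]))"
      unfolding m1_def using that
      by (subst den_lten_nil) (auto simp: indicator_rexp_def position_rexp_def d_def N_def)
    then show ?thesis unfolding unflatten_sum[OF that(2)] using div[OF that(2)] by (simp add: wdev_def M)
  qed
  define m2 where "m2 = den (lten ''Q'' [] [(''a'', BSq), (''b'', BSq)] [(''i'', bD), (''j'', bD), (''k'', bD), (''l'', bD)]
      (RMul (indicator_rexp ''a'' ''i'' ''j'') (RMul (indicator_rexp ''b'' ''k'' ''l'')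
        (RMul (cell ''M'' [''i'', ''k'']) (cell ''M'' [''j'', ''l'']))))) \<rho> m1"
  have m2: "m2 x = m1 x" if "x \<noteq> ''Q''" for x
    unfolding m2_def using that by (subst den_lten_nil) (auto simp: indicator_rexp_def position_rexp_def)
  have m2Q: "m2 ''Q'' [a, b] = wmean N ?Y ?w (a div d) (b div d) * wmean N ?Y ?w (a mod d) (b mod d)"
    if "a < d * d" "b < d * d" for a b
  proof -
    let ?I = "\<lambda>a i j. 1 - (real a - (real i * real d + real j)) / (real a - (real i * real d + real j))"
    have "m2 ''Q'' [a, b] = (\<Sum>i<d. \<Sum>j<d. \<Sum>k<d. \<Sum>l<d. ?I a i j * (?I b k l * (m ''M'' [i, k] * m ''M'' [j, l])))"
      unfolding m2_def using that
      by (subst den_lten_nil) (auto simp: indicator_rexp_def position_rexp_def d_def N_def m1)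
    also have "\<dots> = (\<Sum>i<d. \<Sum>j<d. ?I a i j * (\<Sum>k<d. \<Sum>l<d. ?I b k l * (m ''M'' [i, k] * m ''M'' [j, l])))"
      by (simp only: sum_distrib_left)
    also have "\<dots> = m ''M'' [a div d, b div d] * m ''M'' [a mod d, b mod d]"
      by (simp only: unflatten_sum[OF that(1)] unflatten_sum[OF that(2)])
    finally show ?thesis using div[OF that(1)] div[OF that(2)] by (simp add: M)
  qed
  define m3 where "m3 = den (lten ''H'' [] [(''a'', BSq), (''b'', BSq)] [(''s'', bN)]
      (RDiv (RMul (RMul (cell ''w'' [''s'']) (cell ''Z'' [''s'', ''a''])) (cell ''Z'' [''s'', ''b''])) (cell ''S'' []))) \<rho> m2"
  have m3: "m3 x = m2 x" if "x \<noteq> ''H''" for x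
    unfolding m3_def using that by (subst den_lten_nil) auto
  have m3H: "m3 ''H'' [a, b] = (\<Sum>s<N. ?w s * wdev d N ?Y ?w s a * wdev d N ?Y ?w s b / wsum N ?w)"
    if "a < d * d" "b < d * d" for a b
    unfolding m3_def using that m1Z
    by (subst den_lten_nil) (auto simp: d_def N_def m1 m2 S[unfolded N_def] intro!: sum.cong)
  have m': "m' = den (lten ''B'' [] [(''a'', BSq), (''b'', BSq)] []
      (RSub (RMul (RMul (rnat K) (RMul (cell ''sigma'' []) (cell ''sigma'' []))) (cell ''Q'' [''a'', ''b'']))
        (cell ''H'' [''a'', ''b'']))) \<rho> m3"
    unfolding m'_def form_com_def by (simp only: den.simps(3) m1_def m2_def m3_def)
  have m'x: "m' x = m3 x" if "x \<noteq> ''B''" for x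
    unfolding m' using that by (subst den_lten_nil) auto
  show "m' x = m x" if "x \<notin> {''Z'', ''Q'', ''H'', ''B''}"
    using that by (simp add: m'x m3 m2 m1)
  show "m' ''Z'' [s, a] = wdev d N ?Y ?w s a" if "s < N" "a < d * d"
    using that by (simp add: m'x m3 m2 m1Z)
  show "m' ''B'' [a, b] = wform (real K * (m ''sigma'' [])\<^sup>2) d N ?Y ?w a b" if "a < d * d" "b < d * d"
    unfolding m' using that m2Q[OF that] m3H[OF that]
    by (subst den_lten_nil) (auto simp: d_def N_def m3 m2 m1 wform_def power2_eq_square)
qed

lemma den_select_com:
  fixes \<rho> m
  defines "m' \<equiv> den select_com \<rho> m" and "n \<equiv> \<rho> ''d'' * \<rho> ''d''"
  assumes D: "\<And>k. k < n \<Longrightarrow> m ''D'' [k] = gs_pivot B n k"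
    and U: "\<And>k a. k < n \<Longrightarrow> a < n \<Longrightarrow> m ''U'' [k, a] = gs B n k a"
  shows "x \<noteq> ''V'' \<Longrightarrow> m' x = m x" and "selects B n (\<lambda>a. m' ''V'' [a])"
proof -
  define m1 where "m1 = den (lten ''V'' [] [(''a'', BSq)] [] (rnat 0)) \<rho> m"
  have m1: "m1 x = m x" if "x \<noteq> ''V''" for x
    unfolding m1_def using that by (subst den_lten_nil) auto
  have m1V: "m1 ''V'' [a] = 0" if "a < n" for a
    unfolding m1_def using that by (subst den_lten_nil) (auto simp: n_def)
  define P where "P = (\<lambda>k' m'. (\<forall>x. x \<noteq> ''V'' \<longrightarrow> m' x = m x) \<and>
    ((\<exists>k<k'. gs_pivot B n k \<le> 0 \<and> (\<forall>a<n. m' ''V'' [a] = gs B n k a)) \<or>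
     ((\<forall>k<k'. 0 < gs_pivot B n k) \<and> (\<forall>a<n. m' ''V'' [a] = 0))))"
  have "P n m'" unfolding m'_def select_com_def den.simps(3) m1_def[symmetric]
    unfolding den.simps(5) bnd.simps n_def[symmetric]
  proof (rule iter_invariant[where P = P])
    show "P 0 m1" by (simp add: P_def m1 m1V)
  next
    fix k y assume k: "k < n" and P: "P k y"
    let ?c = "lten ''V'' [] [(''a'', BSq)] [] (cell ''U'' [''k'', ''a''])"
    let ?r = "\<rho>(''k'' := k)"
    have c: "den ?c ?r y x = y x" if "x \<noteq> ''V''" for x
      using that by (subst den_lten_nil) auto
    have cV: "den ?c ?r y ''V'' [a] = gs B n k a" if "a < n" for a
      using that P U[OF k that] by (subst den_lten_nil) (auto simp: n_def P_def)
    have Dk: "y ''D'' [k] = gs_pivot B n k" using P D[OF k] by (simp add: P_def)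
    show "P (Suc k) (den (LCond (RLess (rnat 0) (cell ''D'' [''k''])) LSkip ?c) ?r y)"
    proof (cases "0 < gs_pivot B n k")
      case True
      then show ?thesis using P Dk by (auto simp: P_def less_Suc_eq)
    next
      case False
      then have "den (LCond (RLess (rnat 0) (cell ''D'' [''k''])) LSkip ?c) ?r y = den ?c ?r y"
        using Dk by simp
      moreover have "P (Suc k) (den ?c ?r y)"
        unfolding P_def
      proof (intro conjI disjI1)
        show "\<forall>x. x \<noteq> ''V'' \<longrightarrow> den ?c ?r y x = m x" using P c by (auto simp: P_def)
        show "\<exists>h<Suc k. gs_pivot B n h \<le> 0 \<and> (\<forall>a<n. den ?c ?r y ''V'' [a] = gs B n h a)"
          using False cV by (intro exI[of _ k]) auto
      qed
      ultimately show ?thesis by simp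
    qed
  qed
  then show "x \<noteq> ''V'' \<Longrightarrow> m' x = m x" and "selects B n (\<lambda>a. m' ''V'' [a])"
    unfolding P_def selects_def by auto
qed

lemma den_reweight_com:
  fixes \<rho> m
  defines "m' \<equiv> den reweight_com \<rho> m" and "n \<equiv> \<rho> ''d'' * \<rho> ''d''" and "N \<equiv> \<rho> ''N''"
  shows "x \<notin> {''P'', ''t'', ''W'', ''w''} \<Longrightarrow> m' x = m x"
    and "reweights N (\<lambda>s. (\<Sum>a<n. m ''V'' [a] * m ''Z'' [s, a])\<^sup>2) (weights_of m) (weights_of m')"
proof -
  define p where "p = (\<lambda>s. \<Sum>a<n. m ''V'' [a] * m ''Z'' [s, a])"
  define m1 where "m1 = den (lten ''P'' [] [(''s'', bN)] [(''a'', BSq)] (RMul (cell ''V'' [''a'']) (cell ''Z'' [''s'', ''a'']))) \<rho> m"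
  have m1: "m1 x = m x" if "x \<noteq> ''P''" for x
    unfolding m1_def using that by (subst den_lten_nil) auto
  have m1P: "m1 ''P'' [s] = p s" if "s < N" for s
    unfolding m1_def using that by (subst den_lten_nil) (auto simp: n_def N_def p_def)
  define m2 where "m2 = den (LSet ''t'' [] (rnat 0)) \<rho> m1"
  define m3 where "m3 = den (LFor ''s'' bN max_com) \<rho> m2"
  define Q where "Q = (\<lambda>h y. (\<forall>x. x \<noteq> ''t'' \<longrightarrow> y x = m1 x) \<and> 0 \<le> y ''t'' [] \<and>
     (\<forall>s<h. 0 < weights_of m s \<longrightarrow> (p s)\<^sup>2 \<le> y ''t'' []) \<and>
     (y ''t'' [] = 0 \<or> (\<exists>s<h. 0 < weights_of m s \<and> (p s)\<^sup>2 = y ''t'' [])))"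
  have "Q N m3" unfolding m3_def den.simps(5) bnd.simps N_def[symmetric]
  proof (rule iter_invariant[where P = Q])
    show "Q 0 m2" by (simp add: Q_def m2_def)
  next
    fix s y assume s: "s < N" and Q: "Q s y"
    have y: "y ''P'' [s] = p s" "y ''w'' = m ''w''" using Q m1P[OF s] m1 by (auto simp: Q_def)
    show "Q (Suc s) (den max_com (\<rho>(''s'' := s)) y)"
    proof (cases "0 < weights_of m s \<and> y ''t'' [] < p s * p s")
      case True
      then have e: "den max_com (\<rho>(''s'' := s)) y
        = y(''t'' := (y ''t'')([] := (p s)\<^sup>2))"
        by (simp add: y power2_eq_square)
      have 1: "\<forall>h<s. 0 < weights_of m h \<longrightarrow> (p h)\<^sup>2 \<le> (p s)\<^sup>2"
      proof -
        have "y ''t'' [] \<le> (p s)\<^sup>2" using True by (simp add: power2_eq_square)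
        moreover have "\<forall>h<s. 0 < weights_of m h \<longrightarrow> (p h)\<^sup>2 \<le> y ''t'' []"
          using Q unfolding Q_def by blast
        ultimately show ?thesis by (blast intro: order_trans)
      qed
      show ?thesis unfolding e Q_def
      proof (intro conjI)
        show "\<forall>x. x \<noteq> ''t'' \<longrightarrow> (y(''t'' := (y ''t'')([] := (p s)\<^sup>2))) x = m1 x"
          using Q by (simp add: Q_def)
        show "\<forall>h<Suc s. 0 < weights_of m h \<longrightarrow> (p h)\<^sup>2 \<le> (y(''t'' := (y ''t'')([] := (p s)\<^sup>2))) ''t'' []"
          using 1 by (simp add: less_Suc_eq)
        show "(y(''t'' := (y ''t'')([] := (p s)\<^sup>2))) ''t'' [] = 0 \<or>
            (\<exists>h<Suc s. 0 < weights_of m h \<and> (p h)\<^sup>2 = (y(''t'' := (y ''t'')([] := (p s)\<^sup>2))) ''t'' [])"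
          using True by (intro disjI2 exI[of _ s]) simp
      qed simp
    next
      case False
      then have e: "den max_com (\<rho>(''s'' := s)) y = y"
        by (auto simp: y)
      have "0 < weights_of m s \<longrightarrow> (p s)\<^sup>2 \<le> y ''t'' []"
        using False by (auto simp: power2_eq_square not_less)
      moreover have "Q s y" by (rule Q)
      ultimately show ?thesis unfolding e Q_def less_Suc_eq by blast
    qed
  qed
  define m4 where "m4 = den (lten ''W'' [] [(''s'', bN)] []
      (RMul (cell ''w'' [''s'']) (RSub (rnat 1) (RDiv (RMul (cell ''P'' [''s'']) (cell ''P'' [''s''])) (cell ''t'' []))))) \<rho> m3"
  have m4: "m4 x = m3 x" if "x \<noteq> ''W''" for x
    unfolding m4_def using that by (subst den_lten_nil) auto
  have m3x: "m3 x = m1 x" if "x \<noteq> ''t''" for x using \<open>Q N m3\<close> that by (simp add: Q_def)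
  have m4W: "m4 ''W'' [s] = weights_of m s * (1 - (p s)\<^sup>2 / m3 ''t'' [])" if "s < N" for s
    unfolding m4_def using that m1P[OF that]
    by (subst den_lten_nil) (auto simp: N_def m3x m1 power2_eq_square)
  have m': "m' = den (lten ''w'' [] [(''s'', bN)] [] (cell ''W'' [''s''])) \<rho> m4"
    unfolding m'_def reweight_com_def by (simp only: den.simps(3) m1_def m2_def m3_def m4_def)
  have m'x: "m' x = m4 x" if "x \<noteq> ''w''" for x
    unfolding m' using that by (subst den_lten_nil) auto
  have m'w: "m' ''w'' [s] = weights_of m s * (1 - (p s)\<^sup>2 / m3 ''t'' [])" if "s < N" for s
    unfolding m' using that m4W[OF that] by (subst den_lten_nil) (auto simp: N_def)
  show "x \<notin> {''P'', ''t'', ''W'', ''w''} \<Longrightarrow> m' x = m x" by (simp add: m'x m4 m3x m1)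
  have "reweights N (\<lambda>s. (p s)\<^sup>2) (weights_of m) (weights_of m')"
    using \<open>Q N m3\<close> m'w unfolding reweights_def Q_def by (intro exI[of _ "m3 ''t'' []"]) blast
  then show "reweights N (\<lambda>s. (\<Sum>a<n. m ''V'' [a] * m ''Z'' [s, a])\<^sup>2) (weights_of m) (weights_of m')"
    by (simp add: p_def)
qed

lemma selects_cong:
  assumes "\<And>i j. i < n \<Longrightarrow> j < n \<Longrightarrow> B i j = B' i j" "selects B n v"
  shows "selects B' n v"
proof -
  have *: "gs_pivot B n k = gs_pivot B' n k" "gs B n k = gs B' n k" if "k < n" for k
    using gs_pivot_cong[of n B B' k] gs_cong[of n B B' k] assms(1) that by auto
  from assms(2) show ?thesis unfolding selects_def using * by (metis (no_types, lifting))
qed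

lemma reweights_cong:
  assumes "\<And>s. s < N \<Longrightarrow> \<tau> s = \<tau>' s" "w = w0" "reweights N \<tau> w w'"
  shows "reweights N \<tau>' w0 w'"
proof -
  from assms(3) obtain t where t: "0 \<le> t" "\<forall>s<N. 0 < w s \<longrightarrow> \<tau> s \<le> t"
    "t = 0 \<or> (\<exists>s<N. 0 < w s \<and> \<tau> s = t)" "\<forall>s<N. w' s = w s * (1 - \<tau> s / t)"
    unfolding reweights_def by blast
  show ?thesis unfolding reweights_def
    using t assms(1,2) by (intro exI[of _ t]) auto
qed

lemma den_filter_com:
  fixes \<rho> m K
  defines "m' \<equiv> den (filter_com K) \<rho> m"
  shows "m' ''Y'' = m ''Y''" "m' ''sigma'' = m ''sigma''"
    and "filter_step (real K * (m ''sigma'' [])\<^sup>2) (\<rho> ''d'') (\<rho> ''N'') (samples_of m) (weights_of m) (weights_of m')"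
proof -
  define n where "n = \<rho> ''d'' * \<rho> ''d''"
  let ?lam = "real K * (m ''sigma'' [])\<^sup>2"
  define m1 where "m1 = den mean_com \<rho> m"
  note 1 = den_mean_com[where \<rho> = \<rho> and m = m, folded m1_def]
  define m2 where "m2 = den (form_com K) \<rho> m1"
  have w1: "weights_of m1 = weights_of m" "samples_of m1 = samples_of m" "m1 ''sigma'' = m ''sigma''"
    using 1(1)[of "''w''"] 1(1)[of "''Y''"] 1(1)[of "''sigma''"] by auto
  have S1: "m1 ''S'' [] = wsum (\<rho> ''N'') (weights_of m1)"
    using 1(2) by (simp add: w1)
  have M1: "m1 ''M'' [i, j] = wmean (\<rho> ''N'') (samples_of m1) (weights_of m1) i j"
    if "i < \<rho> ''d''" "j < \<rho> ''d''" for i j using 1(3)[OF that] by (simp add: w1)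
  note 2 = den_form_com[where \<rho> = \<rho> and m = m1 and K = K, OF S1 M1, folded m2_def, unfolded w1]
  define m3 where "m3 = den (gs_com BSq) \<rho> m2"
  note 3 = den_gs_com[where b = BSq and \<rho> = \<rho> and m = m2, folded m3_def, unfolded bnd.simps n_def[symmetric]]
  define m4 where "m4 = den select_com \<rho> m3"
  have D3: "m3 ''D'' [k] = gs_pivot (\<lambda>i j. m2 ''B'' [i, j]) (\<rho> ''d'' * \<rho> ''d'') k" if "k < \<rho> ''d'' * \<rho> ''d''" for k
    using 3(4)[of k] that by (simp add: n_def)
  have U3: "m3 ''U'' [k, a] = gs (\<lambda>i j. m2 ''B'' [i, j]) (\<rho> ''d'' * \<rho> ''d'') k a"
    if "k < \<rho> ''d'' * \<rho> ''d''" "a < \<rho> ''d'' * \<rho> ''d''" for k a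
    using 3(2)[of k a] that by (simp add: n_def)
  note 4 = den_select_com[where \<rho> = \<rho> and m = m3 and B = "\<lambda>i j. m2 ''B'' [i, j]", OF D3 U3, folded m4_def n_def]
  have m': "m' = den reweight_com \<rho> m4"
    unfolding m'_def filter_com_def by (simp only: den.simps(3) m1_def m2_def m3_def m4_def)
  note 5 = den_reweight_com[where \<rho> = \<rho> and m = m4, folded m' n_def]
  have fr: "m4 x = m x" if "x \<in> {''w'', ''Y'', ''sigma''}" for x
    using that 4(1)[of x] 3(1)[of x] 2(1)[of x] 1(1)[of x] by auto
  show "m' ''Y'' = m ''Y''" "m' ''sigma'' = m ''sigma''"
    using 5(1)[of "''Y''"] 5(1)[of "''sigma''"] by (simp_all add: fr)
  have Z: "m4 ''Z'' [s, a] = wdev (\<rho> ''d'') (\<rho> ''N'') (samples_of m) (weights_of m) s a" if "s < \<rho> ''N''" "a < n" for s a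
    using 4(1)[of "''Z''"] 3(1)[of "''Z''"] 2(2)[of s a] that by (simp add: n_def)
  have "selects (wform ?lam (\<rho> ''d'') (\<rho> ''N'') (samples_of m) (weights_of m)) n (\<lambda>a. m4 ''V'' [a])"
    by (rule selects_cong[OF _ 4(2)]) (use 2(3) in \<open>simp add: n_def\<close>)
  moreover have "reweights (\<rho> ''N'') (\<lambda>s. (\<Sum>a<n. m4 ''V'' [a] * wdev (\<rho> ''d'') (\<rho> ''N'') (samples_of m) (weights_of m) s a)\<^sup>2)
      (weights_of m) (weights_of m')"
    using 5(2) by (rule reweights_cong[rotated -1]) (auto simp: Z fr intro!: sum.cong)
  ultimately show "filter_step ?lam (\<rho> ''d'') (\<rho> ''N'') (samples_of m) (weights_of m) (weights_of m')"
    unfolding filter_step_def n_def by blast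
qed

text \<open>The interface to the accuracy proof, which sees only a sequence of weight vectors linked
  by \<open>filter_step\<close> and the final weighted mean.\<close>

lemma den_estimate_com:
  fixes \<rho> m K
  defines "m' \<equiv> den (estimate_com K) \<rho> m" and "d \<equiv> \<rho> ''d''" and "N \<equiv> \<rho> ''N''"
  shows "\<exists>Y ws. (\<forall>s<N. \<forall>i<d. \<forall>j<d. Y s i j = sym_part (\<lambda>i j. m ''X'' [s, i, j]) i j) \<and>
    (\<forall>s<N. ws 0 s = of_bool (passes (sym_part (\<lambda>i j. m ''X'' [s, i, j])) d)) \<and>
    (\<forall>r<N. filter_step (real K * (m ''sigma'' [])\<^sup>2) d N Y (ws r) (ws (Suc r))) \<and>
    (\<forall>i<d. \<forall>j<d. m' ''out'' [i, j] = wmean N Y (ws N) i j)"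
proof -
  define m0 where "m0 = den init_com \<rho> m"
  note 0 = den_init_com[where \<rho> = \<rho> and m = m, folded m0_def d_def N_def]
  define mm where "mm = (\<lambda>r. iter r (\<lambda>i. den (filter_com K) (\<rho>(''r'' := i))) m0)"
  have mm_Suc: "mm (Suc r) = den (filter_com K) (\<rho>(''r'' := r)) (mm r)" for r
    by (simp add: mm_def)
  have inv: "mm r ''Y'' = m0 ''Y'' \<and> mm r ''sigma'' = m0 ''sigma''" for r
    by (induction r) (simp_all add: mm_def mm_Suc[unfolded mm_def] den_filter_com)
  define m1 where "m1 = den mean_com \<rho> (mm N)"
  note 1 = den_mean_com[where \<rho> = \<rho> and m = "mm N", folded m1_def d_def N_def]
  have m': "m' = den (lten ''out'' [] [(''i'', bD), (''j'', bD)] [] (cell ''M'' [''i'', ''j''])) \<rho> m1"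
    unfolding m'_def estimate_com_def
    by (simp only: den.simps(3,5) bnd.simps m1_def mm_def m0_def N_def)
  show ?thesis
  proof (intro exI conjI allI impI)
    fix s i j assume "s < N" "i < d" "j < d"
    then show "samples_of m0 s i j = sym_part (\<lambda>i j. m ''X'' [s, i, j]) i j" by (rule 0(2))
  next
    fix s assume "s < N"
    then show "weights_of (mm 0) s = of_bool (passes (sym_part (\<lambda>i j. m ''X'' [s, i, j])) d)"
      using 0(3) by (simp add: mm_def)
  next
    fix r assume "r < N"
    show "filter_step (real K * (m ''sigma'' [])\<^sup>2) d N (samples_of m0) (weights_of (mm r)) (weights_of (mm (Suc r)))"
      using den_filter_com(3)[where m = "mm r" and K = K and \<rho> = "\<rho>(''r'' := r)"] inv[of r] 0(1)
      by (simp add: mm_Suc d_def N_def)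
  next
    fix i j assume "i < d" "j < d"
    then show "m' ''out'' [i, j] = wmean N (samples_of m0) (weights_of (mm N)) i j"
      unfolding m' using 1(3)[of i j] inv[of N]
      by (subst den_lten_nil) (auto simp: d_def)
  qed
qed

section \<open>Sample size and running time\<close>

text \<open>The concentration bound asks for \<open>9 * n^2 / (\<epsilon> * \<delta>^2)\<close>
  samples in dimension \<open>n = d * d\<close>.\<close>

definition sample_size :: "nat \<Rightarrow> real \<Rightarrow> real \<Rightarrow> real \<Rightarrow> nat" where
  "sample_size d \<epsilon> \<sigma> \<delta> = nat \<lceil>9 * real d ^ 4 / (\<epsilon> * \<delta>\<^sup>2)\<rceil>"

abbreviation "pick_cond \<equiv> RLess (RMul (rvar ''N'') (RMul (RCell ''eps'' []) (RMul (RCell ''delta'' []) (RCell ''delta'' []))))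
       (RMul (rnat 9) (RMul (RMul (rvar ''d'') (rvar ''d'')) (RMul (rvar ''d'') (rvar ''d''))))"

text \<open>Reals cannot be rounded to indices, so the ceiling is found by counting \<open>N\<close>
  up while \<open>N * \<epsilon> * \<delta>^2 < 9 * d^4\<close>. The number of steps is linear in
  the result.\<close>

definition pick_com :: com where
  "pick_com = While pick_cond (ISet ''N'' (IAdd (IVar ''N'') (IConst 1)))"

lemma exec_pick_com:
  assumes "0 < \<epsilon>" "0 < \<delta>"
  shows "\<exists>t s'. exec pick_com (param_state d \<epsilon> \<sigma> \<delta> \<omega>) t s' \<and>
    t \<le> 1 + 2 * sample_size d \<epsilon> \<sigma> \<delta> \<and> idx s' ''N'' = sample_size d \<epsilon> \<sigma> \<delta>"
proof -
  define n where "n = sample_size d \<epsilon> \<sigma> \<delta>"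
  have pos: "0 < \<epsilon> * \<delta>\<^sup>2" using assms by simp
  have cond: "real k * (\<epsilon> * (\<delta> * \<delta>)) < 9 * (real d * real d * (real d * real d)) \<longleftrightarrow> k < n" for k
  proof -
    have "real k * (\<epsilon> * (\<delta> * \<delta>)) < 9 * (real d * real d * (real d * real d)) \<longleftrightarrow>
        real k < 9 * real d ^ 4 / (\<epsilon> * \<delta>\<^sup>2)"
      using pos by (simp add: pos_less_divide_eq power2_eq_square power4_eq_xxxx mult_ac)
    also have "\<dots> \<longleftrightarrow> k < n" unfolding n_def sample_size_def by linarith
    finally show ?thesis .
  qed
  have "\<exists>t s'. exec pick_com s t s' \<and> t \<le> 1 + 2 * (n - k) \<and> idx s' ''N'' = n"
    if "k \<le> n" "idx s ''N'' = k" "idx s ''d'' = d" "mem s ''eps'' [] = \<epsilon>" "mem s ''delta'' [] = \<delta>" for k s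
    using that
  proof (induction "n - k" arbitrary: k s)
    case 0
    then have "\<not> bval s pick_cond" using cond[of k] by simp
    from exec.WhileFalse[OF this] show ?case
      using 0 unfolding pick_com_def by (intro exI[of _ 1] exI[of _ s]) simp
  next
    case (Suc j)
    have T: "bval s pick_cond" using cond[of k] Suc by simp
    define s1 where "s1 = s\<lparr>idx := (idx s)(''N'' := ival s (IAdd (IVar ''N'') (IConst 1)))\<rparr>"
    have "\<exists>t s'. exec pick_com s1 t s' \<and> t \<le> 1 + 2 * (n - Suc k) \<and> idx s' ''N'' = n"
      by (rule Suc.hyps(1)) (use Suc in \<open>auto simp: s1_def\<close>)
    then obtain t s' where t: "exec pick_com s1 t s'" "t \<le> 1 + 2 * (n - Suc k)" "idx s' ''N'' = n"
      by blast
    have "exec pick_com s (1 + 1 + t) s'"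
      unfolding pick_com_def
      by (rule exec.WhileTrue[OF T exec.ISet t(1)[unfolded pick_com_def s1_def]])
    moreover have "1 + 1 + t \<le> 1 + 2 * (n - k)" using t(2) Suc.hyps(2) by simp
    ultimately show ?case using t(3) by blast
  qed
  from this[of 0 "param_state d \<epsilon> \<sigma> \<delta> \<omega>"] show ?thesis
    by (simp add: param_state_def n_def)
qed

lemma exec_estimate_com:
  fixes K d \<epsilon> \<sigma> \<delta> N ys \<omega>
  defines "\<rho> \<equiv> idx (sample_state d \<epsilon> \<sigma> \<delta> N ys \<omega>)"
  shows "\<exists>t s'. exec (compile (estimate_com K)) (sample_state d \<epsilon> \<sigma> \<delta> N ys \<omega>) t s' \<and>
    mem s' = den (estimate_com K) \<rho> (mem (sample_state d \<epsilon> \<sigma> \<delta> N ys \<omega>)) \<and>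
    t \<le> cost (max N (d * d)) (estimate_com K)"
proof -
  have r: "\<rho> ''d'' = d" "\<rho> ''N'' = N"
    by (simp_all add: \<rho>_def sample_state_def param_state_def Let_def)
  have "d \<le> d * d" by simp
  then have b: "\<rho> x \<le> max N (d * d)" if "x \<in> {''d'', ''N''}" for x
    using that r by (auto simp: le_max_iff_disj)
  have "\<exists>t s'. exec (compile (estimate_com K)) (sample_state d \<epsilon> \<sigma> \<delta> N ys \<omega>) t s' \<and>
      mem s' = den (estimate_com K) \<rho> (mem (sample_state d \<epsilon> \<sigma> \<delta> N ys \<omega>)) \<and>
      (\<forall>x\<in>{''d'', ''N''}. idx s' x = \<rho> x) \<and> t \<le> cost (max N (d * d)) (estimate_com K)"
    by (rule compile_correct[OF scoped_estimate_com]) (use b r in \<open>simp_all add: \<rho>_def\<close>)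
  then show ?thesis by blast
qed

lemma poly_time_estimate: "poly_time_estimator pick_com (compile (estimate_com K)) sample_size"
proof -
  obtain k where k: "\<And>L. cost L (estimate_com K) \<le> k * (L + 1) ^ k"
    using cost_polynomial by blast
  \<comment> \<open>The estimator takes at most \<open>k * (12 * Q^7)^k\<close> steps, which asks
    for the factor \<open>k * 12^k\<close> and the exponent \<open>7 * k\<close>. The 21 covers the
    sample size and the counting loop, both at most \<open>21 * Q^7\<close>.\<close>
  define k' where "k' = k * 12 ^ k + 7 * k + 21"
  have "let bound = real k' * (real d + 1 / \<epsilon> + 1 / \<delta>) ^ k'; n = sample_size d \<epsilon> \<sigma> \<delta>
         in real n \<le> bound \<and>
            (\<forall>\<omega>. \<exists>t s'. exec pick_com (param_state d \<epsilon> \<sigma> \<delta> \<omega>) t s' \<and> real t \<le> bound \<and> idx s' ''N'' = n) \<and>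
            (\<forall>ys \<omega>. (\<forall>i<n. ys i \<in> carrier_mat d d) \<longrightarrow>
               (\<exists>t s'. exec (compile (estimate_com K)) (sample_state d \<epsilon> \<sigma> \<delta> n ys \<omega>) t s' \<and> real t \<le> bound))"
    if A: "1 \<le> d" "0 < \<epsilon>" "\<epsilon> < 1" "0 < \<delta>" "\<delta> < 1" for d \<epsilon> \<sigma> \<delta>
  proof -
    define Q where "Q = real d + 1 / \<epsilon> + 1 / \<delta>"
    define n where "n = sample_size d \<epsilon> \<sigma> \<delta>"
    have Q: "real d \<le> Q" "1 / \<epsilon> \<le> Q" "1 / \<delta> \<le> Q" "1 \<le> Q"
      using A by (auto simp: Q_def add_increasing2)
    \<comment> \<open>Degree 7 is 4 + 1 + 2, from \<open>d^4\<close>, \<open>1 / \<epsilon>\<close>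
      and \<open>1 / \<delta>^2\<close>; the factor 10 is 9 plus the rounding.\<close>
    have n: "real n \<le> 10 * Q ^ 7"
    proof -
      have "real n \<le> 9 * real d ^ 4 / (\<epsilon> * \<delta>\<^sup>2) + 1"
      proof -
        have "0 \<le> 9 * real d ^ 4 / (\<epsilon> * \<delta>\<^sup>2)" using A by simp
        then show ?thesis unfolding n_def sample_size_def by linarith
      qed
      also have "9 * real d ^ 4 / (\<epsilon> * \<delta>\<^sup>2) = 9 * (real d ^ 4 * (1 / \<epsilon>) * (1 / \<delta>) ^ 2)"
        by (simp add: power_divide)
      also have "real d ^ 4 * (1 / \<epsilon>) * (1 / \<delta>) ^ 2 \<le> Q ^ 4 * Q * Q ^ 2"
        using A Q by (intro mult_mono power_mono) auto
      also have "Q ^ 4 * Q * Q ^ 2 = Q ^ 7"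
        by (simp add: power_add[symmetric] power_Suc2[symmetric] del: power_Suc)
      finally show ?thesis using one_le_power[OF Q(4), of 7] by simp
    qed
    have big: "c * Q ^ e \<le> real k' * Q ^ k'" if "0 \<le> c" "c \<le> real k'" "e \<le> k'" for c e
      using that Q(4) by (intro mult_mono power_increasing) auto
    have 1: "real n \<le> real k' * Q ^ k'"
      using n big[of 10 7] by (simp add: k'_def)
    have 2: "\<exists>t s'. exec pick_com (param_state d \<epsilon> \<sigma> \<delta> \<omega>) t s' \<and> real t \<le> real k' * Q ^ k' \<and> idx s' ''N'' = n" for \<omega>
    proof -
      obtain t s' where t: "exec pick_com (param_state d \<epsilon> \<sigma> \<delta> \<omega>) t s'"
        "t \<le> 1 + 2 * n" "idx s' ''N'' = n"
        using exec_pick_com[OF A(2,4)] unfolding n_def by blast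
      have "real t \<le> 1 + 2 * real n" using t(2) by linarith
      also have "\<dots> \<le> 21 * Q ^ 7" using n one_le_power[OF Q(4), of 7] by simp
      also have "\<dots> \<le> real k' * Q ^ k'" by (rule big) (auto simp: k'_def)
      finally show ?thesis using t by blast
    qed
    have 3: "\<exists>t s'. exec (compile (estimate_com K)) (sample_state d \<epsilon> \<sigma> \<delta> n ys \<omega>) t s' \<and> real t \<le> real k' * Q ^ k'" for ys \<omega>
    proof -
      obtain t s' where t: "exec (compile (estimate_com K)) (sample_state d \<epsilon> \<sigma> \<delta> n ys \<omega>) t s'"
        "t \<le> cost (max n (d * d)) (estimate_com K)"
        using exec_estimate_com by blast
      have L: "real (max n (d * d)) + 1 \<le> 12 * Q ^ 7"
      proof -
        have "real d * real d \<le> Q * Q" using Q by (intro mult_mono) auto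
        also have "Q * Q = Q ^ 2" by (simp add: power2_eq_square)
        also have "\<dots> \<le> Q ^ 7" using Q by (intro power_increasing) auto
        finally have "real d * real d \<le> Q ^ 7" .
        then show ?thesis using n one_le_power[OF Q(4), of 7] by (cases "n \<le> d * d") (simp_all add: max_def)
      qed
      have "real t \<le> real (k * (max n (d * d) + 1) ^ k)"
        using t(2) k[of "max n (d * d)"] by linarith
      also have "\<dots> = real k * (real (max n (d * d)) + 1) ^ k" by (simp add: add.commute)
      also have "\<dots> \<le> real k * (12 * Q ^ 7) ^ k" using L by (intro mult_left_mono power_mono) auto
      also have "\<dots> = real (k * 12 ^ k) * Q ^ (7 * k)" by (simp add: power_mult_distrib power_mult)
      also have "\<dots> \<le> real k' * Q ^ k'" by (rule big) (auto simp: k'_def)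
      finally show ?thesis using t(1) by blast
    qed
    show ?thesis using 1 2 3 unfolding Let_def Q_def n_def by blast
  qed
  then show ?thesis unfolding poly_time_estimator_def by blast
qed

lemma estimates_estimate_com:
  defines "X \<equiv> \<lambda>ys s. sym_part (\<lambda>i j. ys s $$ (i, j))"
  shows "\<exists>Y ws. (\<forall>s<N. \<forall>i<d. \<forall>j<d. Y s i j = X ys s i j) \<and>
    (\<forall>s<N. ws 0 s = of_bool (passes (X ys s) d)) \<and>
    (\<forall>r<N. filter_step (real K * \<sigma>\<^sup>2) d N Y (ws r) (ws (Suc r))) \<and>
    estimates (compile (estimate_com K)) d \<epsilon> \<sigma> \<delta> N ys \<omega> (mat d d (\<lambda>(i, j). wmean N Y (ws N) i j))"
proof -
  define s0 where "s0 = sample_state d \<epsilon> \<sigma> \<delta> N ys \<omega>"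
  have i: "idx s0 ''d'' = d" "idx s0 ''N'' = N" "mem s0 ''sigma'' [] = \<sigma>"
    "\<And>s i j. s < N \<Longrightarrow> i < d \<Longrightarrow> j < d \<Longrightarrow> mem s0 ''X'' [s, i, j] = ys s $$ (i, j)"
    by (simp_all add: s0_def sample_state_def param_state_def Let_def sample_cells_def)
  obtain t s' where t: "exec (compile (estimate_com K)) s0 t s'"
    "mem s' = den (estimate_com K) (idx s0) (mem s0)"
    using exec_estimate_com[of K d \<epsilon> \<sigma> \<delta> N ys \<omega>] unfolding s0_def by blast
  from den_estimate_com[where \<rho> = "idx s0" and m = "mem s0" and K = K, folded t(2), unfolded i(1-3)]
  obtain Y ws where Y: "\<forall>s<N. \<forall>i<d. \<forall>j<d. Y s i j = sym_part (\<lambda>i j. mem s0 ''X'' [s, i, j]) i j"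
    and ws: "\<forall>s<N. ws 0 s = of_bool (passes (sym_part (\<lambda>i j. mem s0 ''X'' [s, i, j])) d)"
    and st: "\<forall>r<N. filter_step (real K * \<sigma>\<^sup>2) d N Y (ws r) (ws (Suc r))"
    and out: "\<forall>i<d. \<forall>j<d. mem s' ''out'' [i, j] = wmean N Y (ws N) i j"
    by (elim exE conjE) (rule that)
  have e: "sym_part (\<lambda>i j. mem s0 ''X'' [s, i, j]) i j = X ys s i j" if "s < N" "i < d" "j < d" for s i j
    using that by (simp add: sym_part_def X_def i)
  have p: "passes (sym_part (\<lambda>i j. mem s0 ''X'' [s, i, j])) d = passes (X ys s) d" if "s < N" for s
    unfolding passes_def using e[OF that]
      gs_pivot_cong[of d "sym_part (\<lambda>i j. mem s0 ''X'' [s, i, j])" "X ys s"]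
      gs_image_cong[of d "sym_part (\<lambda>i j. mem s0 ''X'' [s, i, j])" "X ys s"] by auto
  have "output_mat d s' = mat d d (\<lambda>(i, j). wmean N Y (ws N) i j)"
    unfolding output_mat_def by (intro eq_matI) (auto simp: out)
  then have "estimates (compile (estimate_com K)) d \<epsilon> \<sigma> \<delta> N ys \<omega> (mat d d (\<lambda>(i, j). wmean N Y (ws N) i j))"
    unfolding estimates_def using t(1) unfolding s0_def by metis
  then show ?thesis using Y ws st e p by (intro exI[of _ Y] exI[of _ ws]) auto
qed

section \<open>Concentration of truncated samples\<close>

text \<open>The product of two coordinates is written as a product of one factor \<open>f i\<close>
  per coordinate, equal to 1 except at \<open>s\<close> and \<open>t\<close>. Independence is then
  the product rule for integrals, and for \<open>s = t\<close> the two factors merge into a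
  square.\<close>

lemma PiM_two_point_moment:
  fixes h :: "'a \<Rightarrow> real" and s t N :: nat
  assumes X: "prob_space X" and [measurable]: "h \<in> borel_measurable X"
    and sq: "integrable X (\<lambda>x. (h x)\<^sup>2)" and "s < N" "t < N"
  shows "integrable (PiM {..<N} (\<lambda>_. X)) (\<lambda>xs. h (xs s) * h (xs t))"
    and "(\<integral>xs. h (xs s) * h (xs t) \<partial>PiM {..<N} (\<lambda>_. X)) =
      (if s = t then (\<integral>x. (h x)\<^sup>2 \<partial>X) else (\<integral>x. h x \<partial>X)\<^sup>2)"
proof -
  interpret X: prob_space X by (rule X)
  interpret product_sigma_finite "\<lambda>_ :: nat. X" by unfold_locales
  define f where "f = (\<lambda>(i :: nat) x. (if i = s then h x else 1) * (if i = t then h x else 1))"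
  have int_h: "integrable X h"
    by (rule X.square_integrable_imp_integrable[OF _ sq]) simp
  have int: "integrable X (f i)" for i
    using int_h sq by (cases "i = s"; cases "i = t") (auto simp: f_def power2_eq_square)
  have prod: "(\<Prod>i<N. f i (xs i)) = h (xs s) * h (xs t)" for xs :: "nat \<Rightarrow> 'a"
    using assms(4,5) by (simp add: f_def prod.distrib)
  show "integrable (PiM {..<N} (\<lambda>_. X)) (\<lambda>xs. h (xs s) * h (xs t))"
    using product_integrable_prod[of "{..<N}" f, OF _ int] by (simp add: prod)
  have "(\<integral>xs. h (xs s) * h (xs t) \<partial>PiM {..<N} (\<lambda>_. X)) = (\<Prod>i<N. \<integral>x. f i x \<partial>X)"
    using product_integral_prod[of "{..<N}" f, OF _ int] by (simp add: prod)
  also have "\<dots> = (if s = t then (\<integral>x. (h x)\<^sup>2 \<partial>X) else (\<integral>x. h x \<partial>X)\<^sup>2)"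
  proof (cases "s = t")
    case True
    have "(\<Prod>i<N. \<integral>x. f i x \<partial>X) = (\<Prod>i<N. if i = s then \<integral>x. (h x)\<^sup>2 \<partial>X else 1)"
      using True by (intro prod.cong) (auto simp: f_def power2_eq_square X.prob_space)
    then show ?thesis using True assms(4) by simp
  next
    case False
    have "(\<Prod>i<N. \<integral>x. f i x \<partial>X) =
        (\<Prod>i<N. (if i = s then \<integral>x. h x \<partial>X else 1) * (if i = t then \<integral>x. h x \<partial>X else 1))"
      using False by (intro prod.cong) (auto simp: f_def X.prob_space)
    then show ?thesis using False assms(4,5) by (simp add: prod.distrib power2_eq_square)
  qed
  finally show "(\<integral>xs. h (xs s) * h (xs t) \<partial>PiM {..<N} (\<lambda>_. X)) =
      (if s = t then (\<integral>x. (h x)\<^sup>2 \<partial>X) else (\<integral>x. h x \<partial>X)\<^sup>2)" .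
qed

lemma PiM_component_expectation:
  fixes g :: "'a \<Rightarrow> real" and s N :: nat
  assumes X: "prob_space X" and int: "integrable X g" and "s < N"
  shows "integrable (PiM {..<N} (\<lambda>_. X)) (\<lambda>xs. g (xs s))"
    and "(\<integral>xs. g (xs s) \<partial>PiM {..<N} (\<lambda>_. X)) = (\<integral>x. g x \<partial>X)"
proof -
  interpret X: prob_space X by (rule X)
  interpret product_sigma_finite "\<lambda>_ :: nat. X" by unfold_locales
  define f where "f = (\<lambda>(i :: nat) x. if i = s then g x else 1)"
  have int_f: "integrable X (f i)" for i using int by (cases "i = s") (auto simp: f_def)
  have prod: "(\<Prod>i<N. f i (xs i)) = g (xs s)" for xs :: "nat \<Rightarrow> 'a"
    using assms(3) by (simp add: f_def)
  show "integrable (PiM {..<N} (\<lambda>_. X)) (\<lambda>xs. g (xs s))"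
    using product_integrable_prod[of "{..<N}" f, OF _ int_f] by (simp add: prod)
  have "(\<integral>xs. g (xs s) \<partial>PiM {..<N} (\<lambda>_. X)) = (\<Prod>i<N. \<integral>x. f i x \<partial>X)"
    using product_integral_prod[of "{..<N}" f, OF _ int_f] by (simp add: prod)
  also have "\<dots> = (\<Prod>i<N. if i = s then \<integral>x. g x \<partial>X else 1)"
    by (intro prod.cong) (auto simp: f_def X.prob_space)
  also have "\<dots> = (\<integral>x. g x \<partial>X)" using assms(3) by simp
  finally show "(\<integral>xs. g (xs s) \<partial>PiM {..<N} (\<lambda>_. X)) = (\<integral>x. g x \<partial>X)" .
qed

text \<open>The cross terms of the centred variables vanish, which leaves the variance divided by
  \<open>N\<close>; the second moment bounds the variance.\<close>

lemma PiM_average_deviation: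
  fixes g :: "'a \<Rightarrow> real" and N :: nat
  assumes X: "prob_space X" and [measurable]: "g \<in> borel_measurable X"
    and sq: "integrable X (\<lambda>x. (g x)\<^sup>2)" and "0 < N"
  defines "dev \<equiv> \<lambda>xs. ((\<Sum>s<N. g (xs s)) / N - (\<integral>x. g x \<partial>X))\<^sup>2"
  shows "integrable (PiM {..<N} (\<lambda>_. X)) dev"
    and "(\<integral>xs. dev xs \<partial>PiM {..<N} (\<lambda>_. X)) \<le> (\<integral>x. (g x)\<^sup>2 \<partial>X) / N"
proof -
  interpret X: prob_space X by (rule X)
  define \<mu> where "\<mu> = (\<integral>x. g x \<partial>X)"
  define h where "h = (\<lambda>x. g x - \<mu>)"
  have [measurable]: "h \<in> borel_measurable X" unfolding h_def by measurable
  have int_g: "integrable X g" by (rule X.square_integrable_imp_integrable[OF _ sq]) simp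
  have sq_h: "integrable X (\<lambda>x. (h x)\<^sup>2)"
    unfolding h_def power2_diff using sq int_g by (auto intro!: Bochner_Integration.integrable_add Bochner_Integration.integrable_diff)
  have h0: "(\<integral>x. h x \<partial>X) = 0" using int_g by (simp add: h_def \<mu>_def X.prob_space)
  have h2: "(\<integral>x. (h x)\<^sup>2 \<partial>X) \<le> (\<integral>x. (g x)\<^sup>2 \<partial>X)"
  proof -
    have "(\<integral>x. (h x)\<^sup>2 \<partial>X) = (\<integral>x. (g x)\<^sup>2 \<partial>X) - \<mu>\<^sup>2"
      using X.variance_eq[OF int_g sq] by (simp add: h_def \<mu>_def)
    then show ?thesis by simp
  qed
  have eq: "dev = (\<lambda>xs. (\<Sum>s<N. \<Sum>t<N. h (xs s) * h (xs t)) / (real N)\<^sup>2)"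
  proof
    fix xs :: "nat \<Rightarrow> 'a"
    have "(\<Sum>s<N. g (xs s)) / N - \<mu> = (\<Sum>s<N. h (xs s)) / N"
      using assms(4) by (simp add: h_def sum_subtractf diff_divide_distrib)
    then show "dev xs = (\<Sum>s<N. \<Sum>t<N. h (xs s) * h (xs t)) / (real N)\<^sup>2"
      by (simp add: dev_def \<mu>_def[symmetric] power_divide power2_eq_square[of "sum _ _"] sum_product)
  qed
  show "integrable (PiM {..<N} (\<lambda>_. X)) dev"
    unfolding eq by (intro integrable_divide_zero Bochner_Integration.integrable_sum)
      (use PiM_two_point_moment(1)[OF X _ sq_h] in auto)
  have "(\<integral>xs. dev xs \<partial>PiM {..<N} (\<lambda>_. X)) =
      (\<Sum>s<N. \<Sum>t<N. \<integral>xs. h (xs s) * h (xs t) \<partial>PiM {..<N} (\<lambda>_. X)) / (real N)\<^sup>2"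
  proof -
    have tp: "integrable (PiM {..<N} (\<lambda>_. X)) (\<lambda>xs. h (xs s) * h (xs t))" if "s < N" "t < N" for s t
      using PiM_two_point_moment(1)[OF X _ sq_h] that by simp
    have "(\<integral>xs. (\<Sum>s<N. \<Sum>t<N. h (xs s) * h (xs t)) \<partial>PiM {..<N} (\<lambda>_. X)) =
        (\<Sum>s<N. \<integral>xs. (\<Sum>t<N. h (xs s) * h (xs t)) \<partial>PiM {..<N} (\<lambda>_. X))"
      by (rule Bochner_Integration.integral_sum) (use tp in \<open>auto intro!: Bochner_Integration.integrable_sum\<close>)
    also have "\<dots> = (\<Sum>s<N. \<Sum>t<N. \<integral>xs. h (xs s) * h (xs t) \<partial>PiM {..<N} (\<lambda>_. X))"
      by (intro sum.cong refl Bochner_Integration.integral_sum) (use tp in auto)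
    finally show ?thesis unfolding eq by simp
  qed
  also have "\<dots> = (\<Sum>s<N. \<Sum>t<N. if s = t then (\<integral>x. (h x)\<^sup>2 \<partial>X) else 0) / (real N)\<^sup>2"
    using PiM_two_point_moment(2)[OF X _ sq_h] h0 by (intro arg_cong2[where f = "(/)"] sum.cong refl) auto
  also have "\<dots> = (\<integral>x. (h x)\<^sup>2 \<partial>X) / N"
    using assms(4) by (simp add: power2_eq_square)
  also have "\<dots> \<le> (\<integral>x. (g x)\<^sup>2 \<partial>X) / N"
    using h2 by (intro divide_right_mono) auto
  finally show "(\<integral>xs. dev xs \<partial>PiM {..<N} (\<lambda>_. X)) \<le> (\<integral>x. (g x)\<^sup>2 \<partial>X) / N" .
qed

lemma Cauchy_Schwarz_abs:
  fixes a b :: "'i \<Rightarrow> real"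
  shows "\<bar>\<Sum>i\<in>I. a i * b i\<bar> \<le> sqrt (\<Sum>i\<in>I. (a i)\<^sup>2) * sqrt (\<Sum>i\<in>I. (b i)\<^sup>2)"
  using Cauchy_Schwarz_ineq_sum[of a b I] by (metis real_sqrt_abs real_sqrt_le_mono real_sqrt_mult)

lemma abs_mult_le_squares: "\<bar>a * b\<bar> \<le> a\<^sup>2 + (b :: real)\<^sup>2"
proof -
  have "0 \<le> (\<bar>a\<bar> - \<bar>b\<bar>)\<^sup>2" by simp
  then have "2 * (\<bar>a\<bar> * \<bar>b\<bar>) \<le> a\<^sup>2 + b\<^sup>2" by (simp add: power2_diff)
  moreover have "0 \<le> \<bar>a\<bar> * \<bar>b\<bar>" by simp
  ultimately show ?thesis unfolding abs_mult by linarith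
qed

lemma integrable_mult_of_squares:
  fixes f u :: "'a \<Rightarrow> real"
  assumes [measurable]: "f \<in> borel_measurable M" "u \<in> borel_measurable M"
    and "integrable M (\<lambda>x. (f x)\<^sup>2)" "integrable M (\<lambda>x. (u x)\<^sup>2)"
  shows "integrable M (\<lambda>x. f x * u x)"
  by (rule Bochner_Integration.integrable_bound[OF Bochner_Integration.integrable_add[OF assms(3,4)]])
    (use abs_mult_le_squares in \<open>auto\<close>)

text \<open>The quadratic is minimal at \<open>t = b / c\<close>. For \<open>c = 0\<close> it is
  affine in \<open>t\<close> and bounded below, hence constant.\<close>

lemma nonneg_quadratic_discriminant:
  fixes a b c :: real
  assumes "\<And>t. 0 \<le> a - 2 * t * b + t\<^sup>2 * c" "0 \<le> c"
  shows "b\<^sup>2 \<le> a * c"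
proof (cases "c = 0")
  case True
  have "b = 0"
  proof (rule ccontr)
    assume "b \<noteq> 0"
    then show False using assms(1)[of "(a + 1) / (2 * b)"] True by simp
  qed
  then show ?thesis using True by simp
next
  case False
  then have c: "0 < c" using assms(2) by simp
  have "0 \<le> a - b\<^sup>2 / c" using assms(1)[of "b / c"] c by (simp add: power2_eq_square field_simps)
  then show ?thesis using c by (simp add: pos_divide_le_eq)
qed

lemma Cauchy_Schwarz_integral:
  fixes f u :: "'a \<Rightarrow> real"
  assumes [measurable]: "f \<in> borel_measurable M" "u \<in> borel_measurable M"
    and f: "integrable M (\<lambda>x. (f x)\<^sup>2)" and u: "integrable M (\<lambda>x. (u x)\<^sup>2)"
  shows "(\<integral>x. f x * u x \<partial>M)\<^sup>2 \<le> (\<integral>x. (f x)\<^sup>2 \<partial>M) * (\<integral>x. (u x)\<^sup>2 \<partial>M)"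
proof -
  define A B D where "A = (\<integral>x. (f x)\<^sup>2 \<partial>M)" "B = (\<integral>x. f x * u x \<partial>M)" "D = (\<integral>x. (u x)\<^sup>2 \<partial>M)"
  have fu: "integrable M (\<lambda>x. f x * u x)" by (rule integrable_mult_of_squares) (use f u in auto)
  have q: "0 \<le> A - 2 * t * B + t\<^sup>2 * D" for t
  proof -
    have "0 \<le> (\<integral>x. (f x - t * u x)\<^sup>2 \<partial>M)" by (rule Bochner_Integration.integral_nonneg) simp
    also have "(\<lambda>x. (f x - t * u x)\<^sup>2) = (\<lambda>x. (f x)\<^sup>2 - (2 * t) * (f x * u x) + t\<^sup>2 * (u x)\<^sup>2)"
      by (simp add: power2_diff power_mult_distrib algebra_simps)
    also have "(\<integral>x. (f x)\<^sup>2 - (2 * t) * (f x * u x) + t\<^sup>2 * (u x)\<^sup>2 \<partial>M) = A - 2 * t * B + t\<^sup>2 * D"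
      using f u fu by (simp add: A_B_D_def)
    finally show ?thesis .
  qed
  have "B\<^sup>2 \<le> A * D"
    by (rule nonneg_quadratic_discriminant[OF q]) (simp add: A_B_D_def)
  then show ?thesis by (simp add: A_B_D_def)
qed

text \<open>No fourth moments are assumed: \<open>G\<close> consists of the samples with \<open>\<Sum>a<n. (z a x)\<^sup>2 \<le> R\<close>. For the chosen \<open>R\<close>,
  each of the three bounds contributes at most \<open>\<delta> / 3\<close> to the failure probability.\<close>
lemma truncated_concentration:
  fixes z :: "nat \<Rightarrow> 'a \<Rightarrow> real" and n N :: nat
  assumes X: "prob_space X" and meas: "\<And>a. a < n \<Longrightarrow> z a \<in> borel_measurable X"
    and sq: "\<And>a. a < n \<Longrightarrow> integrable X (\<lambda>x. (z a x)\<^sup>2)"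
    and mean: "\<And>a. a < n \<Longrightarrow> (\<integral>x. z a x \<partial>X) = 0"
    and var: "\<And>c. (\<integral>x. (\<Sum>a<n. c a * z a x)\<^sup>2 \<partial>X) \<le> V * (\<Sum>a<n. (c a)\<^sup>2)"
    and par: "0 < V" "0 < \<epsilon>" "0 < \<delta>" "\<delta> < 1" "1 \<le> n" and N: "9 * (real n)\<^sup>2 / (\<epsilon> * \<delta>\<^sup>2) \<le> real N"
  shows "\<exists>Good\<in>sets (PiM {..<N} (\<lambda>_. X)). 1 - \<delta> \<le> measure (PiM {..<N} (\<lambda>_. X)) Good \<and>
    (\<forall>xs\<in>Good. \<exists>G\<subseteq>{..<N}. real (card ({..<N} - G)) \<le> \<epsilon> * real N \<and>
      (\<forall>c. (\<Sum>s\<in>G. (\<Sum>a<n. c a * z a (xs s))\<^sup>2) \<le> 2 * V * real N * (\<Sum>a<n. (c a)\<^sup>2)) \<and>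
      (\<forall>c. \<bar>\<Sum>s\<in>G. \<Sum>a<n. c a * z a (xs s)\<bar> \<le> 2 * sqrt (V * \<epsilon>) * real N * sqrt (\<Sum>a<n. (c a)\<^sup>2)))"
proof -
  interpret X: prob_space X by (rule X)
  interpret P: prob_space "PiM {..<N} (\<lambda>_. X)" by (intro prob_space_PiM X)
  note [measurable] = meas
  have Npos: "0 < N"
  proof -
    have "0 < 9 * (real n)\<^sup>2 / (\<epsilon> * \<delta>\<^sup>2)" using par by simp
    then have "0 < real N" using N by linarith
    then show ?thesis by simp
  qed
  \<comment> \<open>By Markov's inequality a sample is truncated with probability at most
    \<open>V * n / R\<close>, which is \<open>\<epsilon> * \<delta> / 3\<close> for this
    choice.\<close>
  define R where "R = 3 * V * real n / (\<epsilon> * \<delta>)"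
  have Rpos: "0 < R" using par by (simp add: R_def)
  define q where "q = (\<lambda>x. \<Sum>a<n. (z a x)\<^sup>2)"
  define ind where "ind = (\<lambda>x. if q x \<le> R then 1 else 0 :: real)"
  have [measurable]: "q \<in> borel_measurable X" unfolding q_def by measurable
  have [measurable]: "ind \<in> borel_measurable X" unfolding ind_def by measurable
  have q0: "0 \<le> q x" for x by (auto simp: q_def intro: sum_nonneg)
  have zq: "(z a x)\<^sup>2 \<le> q x" if "a < n" for a x
    unfolding q_def by (rule member_le_sum) (use that in auto)
  have int_q: "integrable X q" unfolding q_def by (intro Bochner_Integration.integrable_sum sq) auto
  have z2: "(\<integral>x. (z a x)\<^sup>2 \<partial>X) \<le> V" if "a < n" for a
  proof -
    have "(\<Sum>b<n. (if b = a then 1 else 0) * z b x) = z a x" for x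
      using that by (simp add: if_distrib[of "\<lambda>y. y * _"] cong: if_cong)
    moreover have "(\<Sum>b<n. (if b = a then 1 else 0 :: real)\<^sup>2) = 1"
      using that by (simp add: if_distrib[of "\<lambda>y. y\<^sup>2"] cong: if_cong)
    ultimately show ?thesis using var[of "\<lambda>b. if b = a then 1 else 0"] by simp
  qed
  have Eq: "(\<integral>x. q x \<partial>X) \<le> V * n"
  proof -
    have "(\<integral>x. q x \<partial>X) = (\<Sum>a<n. \<integral>x. (z a x)\<^sup>2 \<partial>X)"
      unfolding q_def using sq by (intro Bochner_Integration.integral_sum) auto
    also have "\<dots> \<le> (\<Sum>a<n. V)" by (intro sum_mono z2) auto
    finally show ?thesis by (simp add: mult.commute)
  qed
  have int_tail: "integrable X (\<lambda>x. 1 - ind x)"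
    by (rule X.integrable_const_bound[where B = 1]) (auto simp: ind_def)
  have tail: "(\<integral>x. 1 - ind x \<partial>X) \<le> \<epsilon> * \<delta> / 3"
  proof -
    have "(\<integral>x. 1 - ind x \<partial>X) \<le> (\<integral>x. q x / R \<partial>X)"
      using int_tail int_q Rpos q0 by (intro Bochner_Integration.integral_mono) (auto simp: ind_def field_simps)
    also have "\<dots> \<le> V * n / R" using Eq Rpos by (simp add: divide_right_mono)
    also have "\<dots> = \<epsilon> * \<delta> / 3" using par by (simp add: R_def)
    finally show ?thesis .
  qed
  define I where "I = {..<n} \<times> {..<n}"
  define g where "g = (\<lambda>p x. z (fst p) x * z (snd p) x * ind x)"
  define h where "h = (\<lambda>a x. z a x * ind x)"
  have [measurable]: "g p \<in> borel_measurable X" if "p \<in> I" for p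
    using that unfolding g_def I_def by (auto intro!: borel_measurable_times)
  have [measurable]: "h a \<in> borel_measurable X" if "a < n" for a
    using that unfolding h_def by (auto intro!: borel_measurable_times)
  have g_sq: "integrable X (\<lambda>x. (g p x)\<^sup>2)" "integrable X (g p)" if p: "p \<in> I" for p
  proof -
    have bd: "\<bar>g p x\<bar> \<le> R" for x
    proof (cases "q x \<le> R")
      case True
      have "\<bar>z (fst p) x\<bar> \<le> sqrt (q x)" "\<bar>z (snd p) x\<bar> \<le> sqrt (q x)"
        using zq p by (auto simp: I_def intro!: real_le_rsqrt)
      then have "\<bar>z (fst p) x\<bar> * \<bar>z (snd p) x\<bar> \<le> sqrt (q x) * sqrt (q x)"
        using q0 by (intro mult_mono) auto
      then show ?thesis using True q0[of x] by (simp add: g_def ind_def abs_mult)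
    next
      case False
      then show ?thesis using Rpos by (simp add: g_def ind_def)
    qed
    show "integrable X (g p)"
      by (rule X.integrable_const_bound[where B = R]) (use p bd in auto)
    show "integrable X (\<lambda>x. (g p x)\<^sup>2)"
    proof (rule X.integrable_const_bound[where B = "R\<^sup>2"])
      have "(g p x)\<^sup>2 \<le> R\<^sup>2" for x using bd[of x] Rpos by (simp add: abs_le_square_iff[symmetric])
      then show "AE x in X. norm ((g p x)\<^sup>2) \<le> R\<^sup>2" by simp
    qed (use p in measurable)
  qed
  have h_sq: "integrable X (\<lambda>x. (h a x)\<^sup>2)" if "a < n" for a
    by (rule Bochner_Integration.integrable_bound[OF sq[OF that]]) (use that in \<open>auto simp: h_def ind_def\<close>)
  have int_z: "integrable X (z a)" if "a < n" for a
    by (rule X.square_integrable_imp_integrable[OF _ sq[OF that]]) (use that in simp)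
  have int_h: "integrable X (h a)" if "a < n" for a
    by (rule Bochner_Integration.integrable_bound[OF int_z[OF that]]) (use that in \<open>auto simp: h_def ind_def\<close>)
  define dev where "dev = (\<lambda>g xs. (\<Sum>s<N. g (xs s)) / N - (\<integral>x. g x \<partial>X))"
  define F1 where "F1 = (\<lambda>xs. \<Sum>s<N. 1 - ind (xs s))"
  \<comment> \<open>The squared Frobenius error of the empirical second-moment matrix of the
    truncated samples; a bound on it serves all directions \<open>c\<close> at once.\<close>
  define F2 where "F2 = (\<lambda>xs. \<Sum>p\<in>I. (dev (g p) xs)\<^sup>2)"
  define F3 where "F3 = (\<lambda>xs. \<Sum>a<n. (dev (h a) xs)\<^sup>2)"
  have F0: "0 \<le> F1 xs" "0 \<le> F2 xs" "0 \<le> F3 xs" for xs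
    by (auto simp: F1_def F2_def F3_def ind_def intro!: sum_nonneg)
  let ?P = "PiM {..<N} (\<lambda>_. X)"
  have i1: "integrable ?P F1" "(\<integral>xs. F1 xs \<partial>?P) \<le> N * (\<epsilon> * \<delta> / 3)"
  proof -
    show "integrable ?P F1" unfolding F1_def
      by (intro Bochner_Integration.integrable_sum PiM_component_expectation(1)[OF X int_tail]) auto
    have "(\<integral>xs. F1 xs \<partial>?P) = (\<Sum>s<N. \<integral>x. 1 - ind x \<partial>X)"
      unfolding F1_def
      by (subst Bochner_Integration.integral_sum)
        (use PiM_component_expectation[OF X int_tail] in \<open>auto intro!: sum.cong\<close>)
    also have "\<dots> = N * (\<integral>x. 1 - ind x \<partial>X)" by simp
    also have "\<dots> \<le> N * (\<epsilon> * \<delta> / 3)" using tail by (rule mult_left_mono) simp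
    finally show "(\<integral>xs. F1 xs \<partial>?P) \<le> N * (\<epsilon> * \<delta> / 3)" .
  qed
  have i2: "integrable ?P F2" "(\<integral>xs. F2 xs \<partial>?P) \<le> R * (V * n) / N"
  proof -
    have d: "integrable ?P (\<lambda>xs. (dev (g p) xs)\<^sup>2)"
      "(\<integral>xs. (dev (g p) xs)\<^sup>2 \<partial>?P) \<le> (\<integral>x. (g p x)\<^sup>2 \<partial>X) / N" if "p \<in> I" for p
      using PiM_average_deviation[OF X _ g_sq(1) Npos, of p] that unfolding dev_def by auto
    show "integrable ?P F2" unfolding F2_def by (intro Bochner_Integration.integrable_sum d)
    have "(\<integral>xs. F2 xs \<partial>?P) = (\<Sum>p\<in>I. \<integral>xs. (dev (g p) xs)\<^sup>2 \<partial>?P)"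
      unfolding F2_def by (intro Bochner_Integration.integral_sum d)
    also have "\<dots> \<le> (\<Sum>p\<in>I. (\<integral>x. (g p x)\<^sup>2 \<partial>X) / N)" by (intro sum_mono d)
    also have "\<dots> = (\<integral>x. (\<Sum>p\<in>I. (g p x)\<^sup>2) \<partial>X) / N"
      by (subst Bochner_Integration.integral_sum) (use g_sq in \<open>auto simp: sum_divide_distrib\<close>)
    also have "\<dots> \<le> (\<integral>x. R * q x \<partial>X) / N"
    proof (intro divide_right_mono Bochner_Integration.integral_mono)
      show "integrable X (\<lambda>x. \<Sum>p\<in>I. (g p x)\<^sup>2)" by (intro Bochner_Integration.integrable_sum g_sq)
      show "integrable X (\<lambda>x. R * q x)" using int_q by simp
      fix x
      \<comment> \<open>Truncation stands in for fourth moments: the sum of all squared products is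
        \<open>q^2\<close> on retained samples, hence at most \<open>R * q\<close>.\<close>
      have "(\<Sum>p\<in>I. (g p x)\<^sup>2) = (\<Sum>a<n. \<Sum>b<n. (z a x)\<^sup>2 * (z b x)\<^sup>2) * (ind x)\<^sup>2"
        unfolding I_def g_def sum.cartesian_product[symmetric]
        by (simp add: sum_distrib_right power_mult_distrib case_prod_unfold sum.cartesian_product)
      also have "(\<Sum>a<n. \<Sum>b<n. (z a x)\<^sup>2 * (z b x)\<^sup>2) = q x * q x"
        by (simp add: q_def sum_product)
      also have "q x * q x * (ind x)\<^sup>2 \<le> R * q x"
        using q0[of x] Rpos by (auto simp: ind_def mult_right_mono)
      finally show "(\<Sum>p\<in>I. (g p x)\<^sup>2) \<le> R * q x" .
    qed simp
    also have "\<dots> \<le> R * (V * n) / N"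
      using Eq Rpos by (intro divide_right_mono) (auto intro: mult_left_mono)
    finally show "(\<integral>xs. F2 xs \<partial>?P) \<le> R * (V * n) / N" .
  qed
  have i3: "integrable ?P F3" "(\<integral>xs. F3 xs \<partial>?P) \<le> V * n / N"
  proof -
    have d: "integrable ?P (\<lambda>xs. (dev (h a) xs)\<^sup>2)"
      "(\<integral>xs. (dev (h a) xs)\<^sup>2 \<partial>?P) \<le> (\<integral>x. (h a x)\<^sup>2 \<partial>X) / N" if "a < n" for a
      using PiM_average_deviation[OF X _ h_sq Npos, of a] that unfolding dev_def by auto
    show "integrable ?P F3" unfolding F3_def by (intro Bochner_Integration.integrable_sum d) auto
    have "(\<integral>xs. F3 xs \<partial>?P) = (\<Sum>a<n. \<integral>xs. (dev (h a) xs)\<^sup>2 \<partial>?P)"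
      unfolding F3_def by (intro Bochner_Integration.integral_sum d) auto
    also have "\<dots> \<le> (\<Sum>a<n. V / N)"
    proof (intro sum_mono)
      fix a assume a: "a \<in> {..<n}"
      have "(\<integral>x. (h a x)\<^sup>2 \<partial>X) \<le> (\<integral>x. (z a x)\<^sup>2 \<partial>X)"
        using a by (intro Bochner_Integration.integral_mono h_sq sq) (auto simp: h_def ind_def)
      also have "\<dots> \<le> V" using a z2 by auto
      finally have "(\<integral>x. (h a x)\<^sup>2 \<partial>X) / N \<le> V / N" by (intro divide_right_mono) auto
      then show "(\<integral>xs. (dev (h a) xs)\<^sup>2 \<partial>?P) \<le> V / N" using d(2)[of a] a by auto
    qed
    finally show "(\<integral>xs. F3 xs \<partial>?P) \<le> V * n / N" by (simp add: mult.commute)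
  qed
  \<comment> \<open>Dividing by the three thresholds gives one variable of expectation at most
    \<delta>. A single application of Markov's inequality yields the event \<open>F < 1\<close>, on
    which every threshold holds.\<close>
  define F where "F = (\<lambda>xs. F1 xs / (\<epsilon> * N) + F2 xs / V\<^sup>2 + F3 xs / (V * \<epsilon>))"
  have int_F: "integrable ?P F"
    unfolding F_def using i1 i2 i3 by auto
  have [measurable]: "F \<in> borel_measurable ?P" using int_F by (rule borel_measurable_integrable)
  have EF: "(\<integral>xs. F xs \<partial>?P) \<le> \<delta>"
  proof -
    have "(\<integral>xs. F xs \<partial>?P) = (\<integral>xs. F1 xs \<partial>?P) / (\<epsilon> * N) + (\<integral>xs. F2 xs \<partial>?P) / V\<^sup>2 + (\<integral>xs. F3 xs \<partial>?P) / (V * \<epsilon>)"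
      unfolding F_def using i1 i2 i3 by simp
    also have "(\<integral>xs. F1 xs \<partial>?P) / (\<epsilon> * N) \<le> (N * (\<epsilon> * \<delta> / 3)) / (\<epsilon> * N)"
      using i1 par by (intro divide_right_mono) auto
    also have "\<dots> = \<delta> / 3" using par Npos by simp
    also have "(\<integral>xs. F2 xs \<partial>?P) / V\<^sup>2 \<le> (R * (V * n) / N) / V\<^sup>2"
      using i2 by (intro divide_right_mono) auto
    also have "(R * (V * n) / N) / V\<^sup>2 = 3 * (real n)\<^sup>2 / (\<epsilon> * \<delta>) / N"
      using par by (simp add: R_def power2_eq_square field_simps)
    \<comment> \<open>This term determines the sample size: it equals \<open>\<delta> / 3\<close> at
      the smallest admissible \<open>N\<close>.\<close>
    also have "\<dots> \<le> \<delta> / 3"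
    proof -
      have "3 * (real n)\<^sup>2 / (\<epsilon> * \<delta>) = (\<delta> / 3) * (9 * (real n)\<^sup>2 / (\<epsilon> * \<delta>\<^sup>2))"
        using par by (simp add: power2_eq_square field_simps)
      also have "\<dots> \<le> (\<delta> / 3) * N" using N par by (intro mult_left_mono) auto
      finally show ?thesis unfolding pos_divide_le_eq[OF of_nat_0_less_iff[THEN iffD2, OF Npos]] .
    qed
    also have "(\<integral>xs. F3 xs \<partial>?P) / (V * \<epsilon>) \<le> (V * n / N) / (V * \<epsilon>)"
      using i3 par by (intro divide_right_mono) auto
    also have "\<dots> = real n / \<epsilon> / N" using par by (simp add: field_simps)
    also have "\<dots> \<le> \<delta> / 3"
    proof -
      have "real n * 1 * (\<delta> * 1) \<le> real n * real n * (1 * 3)"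
        using par by (intro mult_mono) auto
      then have "real n / \<epsilon> \<le> 3 * (real n)\<^sup>2 / (\<epsilon> * \<delta>)"
        using par by (simp add: power2_eq_square field_simps)
      also have "\<dots> = (\<delta> / 3) * (9 * (real n)\<^sup>2 / (\<epsilon> * \<delta>\<^sup>2))"
        using par by (simp add: power2_eq_square field_simps)
      also have "\<dots> \<le> (\<delta> / 3) * N" using N par by (intro mult_left_mono) auto
      finally show ?thesis unfolding pos_divide_le_eq[OF of_nat_0_less_iff[THEN iffD2, OF Npos]] .
    qed
    finally show ?thesis by simp
  qed
  define Good where "Good = {xs \<in> space ?P. F xs < 1}"
  have GoodS: "Good \<in> sets ?P" unfolding Good_def by measurable
  have "measure ?P {xs \<in> space ?P. 1 \<le> F xs} \<le> (\<integral>xs. F xs \<partial>?P) / 1"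
    using F0 par by (intro integral_Markov_inequality_measure[where A = "{}"] int_F) (auto simp: F_def)
  moreover have "Good = space ?P - {xs \<in> space ?P. 1 \<le> F xs}" by (auto simp: Good_def)
  then have "measure ?P Good = 1 - measure ?P {xs \<in> space ?P. 1 \<le> F xs}"
    by (simp add: P.prob_compl)
  ultimately have prob: "1 - \<delta> \<le> measure ?P Good" using EF by simp
  have "\<exists>G\<subseteq>{..<N}. real (card ({..<N} - G)) \<le> \<epsilon> * real N \<and>
      (\<forall>c. (\<Sum>s\<in>G. (\<Sum>a<n. c a * z a (xs s))\<^sup>2) \<le> 2 * V * real N * (\<Sum>a<n. (c a)\<^sup>2)) \<and>
      (\<forall>c. \<bar>\<Sum>s\<in>G. \<Sum>a<n. c a * z a (xs s)\<bar> \<le> 2 * sqrt (V * \<epsilon>) * real N * sqrt (\<Sum>a<n. (c a)\<^sup>2))"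
    if "xs \<in> Good" for xs
  proof -
    have "F xs < 1" using that by (simp add: Good_def)
    moreover have "0 \<le> F1 xs / (\<epsilon> * N)" "0 \<le> F2 xs / V\<^sup>2" "0 \<le> F3 xs / (V * \<epsilon>)"
      using F0 par by auto
    ultimately have "F1 xs / (\<epsilon> * N) \<le> 1" "F2 xs / V\<^sup>2 \<le> 1" "F3 xs / (V * \<epsilon>) \<le> 1"
      unfolding F_def by linarith+
    then have F: "F1 xs \<le> \<epsilon> * N" "F2 xs \<le> V\<^sup>2" "F3 xs \<le> V * \<epsilon>"
      using par Npos by (simp_all add: pos_divide_le_eq)
    define G where "G = {s\<in>{..<N}. q (xs s) \<le> R}"
    have sumG: "(\<Sum>s\<in>G. f s) = (\<Sum>s<N. f s * ind (xs s))" for f :: "nat \<Rightarrow> real"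
      unfolding G_def ind_def by (subst sum.inter_filter) (auto intro!: sum.cong)
    have "real (card ({..<N} - G)) = F1 xs"
    proof -
      have "F1 xs = (\<Sum>s\<in>{s\<in>{..<N}. \<not> q (xs s) \<le> R}. 1)"
        unfolding F1_def ind_def by (subst sum.inter_filter) (auto intro!: sum.cong)
      also have "{s\<in>{..<N}. \<not> q (xs s) \<le> R} = {..<N} - G" by (auto simp: G_def)
      finally show ?thesis by simp
    qed
    then have c1: "real (card ({..<N} - G)) \<le> \<epsilon> * real N" using F by simp
    have avg: "(\<Sum>s<N. f (xs s)) = N * ((\<integral>x. f x \<partial>X) + dev f xs)" for f
      using Npos by (simp add: dev_def field_simps)
    \<comment> \<open>One \<open>V\<close> comes from the true second moment, which truncation only
      decreases; the other bounds the fluctuation, by Cauchy-Schwarz against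
      \<open>F2\<close>.\<close>
    have c2: "(\<Sum>s\<in>G. (\<Sum>a<n. c a * z a (xs s))\<^sup>2) \<le> 2 * V * real N * (\<Sum>a<n. (c a)\<^sup>2)" for c
    proof -
      let ?c = "\<lambda>p. c (fst p) * c (snd p)"
      have sq_eq: "(\<Sum>a<n. c a * z a x)\<^sup>2 * ind x = (\<Sum>p\<in>I. ?c p * g p x)" for x
      proof -
        have "(\<Sum>a<n. f a)\<^sup>2 = (\<Sum>p\<in>I. f (fst p) * f (snd p))" for f :: "nat \<Rightarrow> real"
          unfolding power2_eq_square sum_product I_def sum.cartesian_product by (simp add: case_prod_unfold)
        then show ?thesis by (simp add: g_def sum_distrib_left mult_ac)
      qed
      have "(\<Sum>s\<in>G. (\<Sum>a<n. c a * z a (xs s))\<^sup>2) = (\<Sum>s<N. \<Sum>p\<in>I. ?c p * g p (xs s))"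
        unfolding sumG sq_eq ..
      also have "\<dots> = (\<Sum>p\<in>I. ?c p * (\<Sum>s<N. g p (xs s)))"
        by (subst sum.swap) (simp add: sum_distrib_left)
      also have "\<dots> = N * ((\<Sum>p\<in>I. ?c p * (\<integral>x. g p x \<partial>X)) + (\<Sum>p\<in>I. ?c p * dev (g p) xs))"
        unfolding avg by (simp add: sum_distrib_left algebra_simps sum.distrib)
      also have "(\<Sum>p\<in>I. ?c p * (\<integral>x. g p x \<partial>X)) = (\<integral>x. (\<Sum>p\<in>I. ?c p * g p x) \<partial>X)"
        by (subst Bochner_Integration.integral_sum) (use g_sq in auto)
      also have "\<dots> \<le> (\<integral>x. (\<Sum>a<n. c a * z a x)\<^sup>2 \<partial>X)"
        unfolding sq_eq[symmetric]
      proof (rule Bochner_Integration.integral_mono)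
        show "integrable X (\<lambda>x. (\<Sum>a<n. c a * z a x)\<^sup>2 * ind x)"
          unfolding sq_eq using g_sq by (intro Bochner_Integration.integrable_sum) auto
        have "integrable X (\<lambda>x. z a x * z b x)" if "a < n" "b < n" for a b
          using that by (intro integrable_mult_of_squares sq meas)
        then show "integrable X (\<lambda>x. (\<Sum>a<n. c a * z a x)\<^sup>2)"
          unfolding power2_eq_square sum_product
          by (intro Bochner_Integration.integrable_sum) (auto simp: mult.assoc mult.left_commute[of "z _ _"])
      qed (auto simp: ind_def)
      also have "\<dots> \<le> V * (\<Sum>a<n. (c a)\<^sup>2)" by (rule var)
      also have "(\<Sum>p\<in>I. ?c p * dev (g p) xs) \<le> V * (\<Sum>a<n. (c a)\<^sup>2)"
      proof -
        have "(\<Sum>p\<in>I. (?c p)\<^sup>2) = (\<Sum>a<n. (c a)\<^sup>2) * (\<Sum>a<n. (c a)\<^sup>2)"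
          unfolding sum_product I_def sum.cartesian_product by (intro sum.cong) (auto simp: power_mult_distrib)
        then have "sqrt (\<Sum>p\<in>I. (?c p)\<^sup>2) = (\<Sum>a<n. (c a)\<^sup>2)"
          by (simp add: real_sqrt_mult sum_nonneg)
        moreover have "sqrt (\<Sum>p\<in>I. (dev (g p) xs)\<^sup>2) \<le> V"
          using F(2) par by (auto simp: F2_def intro: real_le_lsqrt)
        moreover have "\<bar>\<Sum>p\<in>I. ?c p * dev (g p) xs\<bar> \<le> sqrt (\<Sum>p\<in>I. (?c p)\<^sup>2) * sqrt (\<Sum>p\<in>I. (dev (g p) xs)\<^sup>2)"
          by (rule Cauchy_Schwarz_abs)
        moreover have "(\<Sum>a<n. (c a)\<^sup>2) * sqrt (\<Sum>p\<in>I. (dev (g p) xs)\<^sup>2) \<le> (\<Sum>a<n. (c a)\<^sup>2) * V"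
          using calculation(2) by (intro mult_left_mono) (auto intro: sum_nonneg)
        ultimately show ?thesis by (simp add: mult.commute)
      qed
      finally show ?thesis using Npos by (simp add: mult_left_mono algebra_simps)
    qed
    have c3: "\<bar>\<Sum>s\<in>G. \<Sum>a<n. c a * z a (xs s)\<bar> \<le> 2 * sqrt (V * \<epsilon>) * real N * sqrt (\<Sum>a<n. (c a)\<^sup>2)" for c
    proof -
      define C where "C = sqrt (\<Sum>a<n. (c a)\<^sup>2)"
      have lin_eq: "(\<Sum>a<n. c a * z a x) * ind x = (\<Sum>a<n. c a * h a x)" for x
        by (simp add: h_def sum_distrib_left mult_ac)
      have "(\<Sum>s\<in>G. \<Sum>a<n. c a * z a (xs s)) = (\<Sum>a<n. c a * (\<Sum>s<N. h a (xs s)))"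
        unfolding sumG lin_eq by (subst sum.swap) (simp add: sum_distrib_left)
      also have "\<dots> = N * ((\<Sum>a<n. c a * (\<integral>x. h a x \<partial>X)) + (\<Sum>a<n. c a * dev (h a) xs))"
        unfolding avg by (simp add: sum_distrib_left algebra_simps sum.distrib)
      finally have eq: "(\<Sum>s\<in>G. \<Sum>a<n. c a * z a (xs s)) =
         N * ((\<Sum>a<n. c a * (\<integral>x. h a x \<partial>X)) + (\<Sum>a<n. c a * dev (h a) xs))" .
      have b2: "\<bar>\<Sum>a<n. c a * dev (h a) xs\<bar> \<le> C * sqrt (V * \<epsilon>)"
      proof -
        have "\<bar>\<Sum>a<n. c a * dev (h a) xs\<bar> \<le> C * sqrt (\<Sum>a<n. (dev (h a) xs)\<^sup>2)"
          unfolding C_def by (rule Cauchy_Schwarz_abs)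
        also have "\<dots> \<le> C * sqrt (V * \<epsilon>)"
          using F(3) by (intro mult_left_mono) (auto simp: F3_def C_def intro: sum_nonneg)
        finally show ?thesis .
      qed
      \<comment> \<open>The truncation bias. \<open>T\<close> has mean zero, so its truncated mean
        is minus its integral over the discarded part, which has probability at most \<epsilon>;
        Cauchy-Schwarz gives the root.\<close>
      have b1: "\<bar>\<Sum>a<n. c a * (\<integral>x. h a x \<partial>X)\<bar> \<le> C * sqrt (V * \<epsilon>)"
      proof -
        define T where "T = (\<lambda>x. \<Sum>a<n. c a * z a x)"
        have intT: "integrable X T" unfolding T_def using int_z by (intro Bochner_Integration.integrable_sum) auto
        have [measurable]: "T \<in> borel_measurable X" using intT by auto
        have intT2: "integrable X (\<lambda>x. (T x)\<^sup>2)"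
        proof -
          have "(T x)\<^sup>2 \<le> (\<Sum>a<n. (c a)\<^sup>2) * q x" for x
            unfolding T_def q_def by (rule Cauchy_Schwarz_ineq_sum)
          then have bd: "norm ((T x)\<^sup>2) \<le> norm ((\<Sum>a<n. (c a)\<^sup>2) * q x)" for x
            by (metis abs_of_nonneg order_trans real_norm_def zero_le_power2)
          have "integrable X (\<lambda>x. (\<Sum>a<n. (c a)\<^sup>2) * q x)" using int_q by (rule integrable_mult_right)
          then show ?thesis
          proof (rule Bochner_Integration.integrable_bound)
            show "(\<lambda>x. (T x)\<^sup>2) \<in> borel_measurable X" by measurable
            show "AE x in X. norm ((T x)\<^sup>2) \<le> norm ((\<Sum>a<n. (c a)\<^sup>2) * q x)"
              using bd by (rule AE_I2)
          qed
        qed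
        have "(\<Sum>a<n. c a * (\<integral>x. h a x \<partial>X)) = (\<integral>x. (\<Sum>a<n. c a * h a x) \<partial>X)"
          by (subst Bochner_Integration.integral_sum) (use int_h in auto)
        also have "\<dots> = (\<integral>x. T x - T x * (1 - ind x) \<partial>X)"
          unfolding lin_eq[symmetric] T_def by (simp add: algebra_simps)
        finally have e: "(\<Sum>a<n. c a * (\<integral>x. h a x \<partial>X)) = (\<integral>x. T x - T x * (1 - ind x) \<partial>X)" .
        have intTt: "integrable X (\<lambda>x. T x * (1 - ind x))"
          by (rule Bochner_Integration.integrable_bound[OF intT]) (auto simp: ind_def)
        have "(\<integral>x. T x \<partial>X) = 0"
          unfolding T_def by (subst Bochner_Integration.integral_sum) (use int_z mean in auto)
        then have e2: "(\<Sum>a<n. c a * (\<integral>x. h a x \<partial>X)) = - (\<integral>x. T x * (1 - ind x) \<partial>X)"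
          unfolding e using intT intTt by simp
        have "(\<integral>x. T x * (1 - ind x) \<partial>X)\<^sup>2 \<le> (\<integral>x. (T x)\<^sup>2 \<partial>X) * (\<integral>x. (1 - ind x)\<^sup>2 \<partial>X)"
        proof (rule Cauchy_Schwarz_integral[OF _ _ intT2])
          show "integrable X (\<lambda>x. (1 - ind x)\<^sup>2)"
            by (rule X.integrable_const_bound[where B = 1]) (auto simp: ind_def)
        qed auto
        also have "\<dots> \<le> (V * (\<Sum>a<n. (c a)\<^sup>2)) * \<epsilon>"
        proof (intro mult_mono)
          show "(\<integral>x. (T x)\<^sup>2 \<partial>X) \<le> V * (\<Sum>a<n. (c a)\<^sup>2)" unfolding T_def by (rule var)
          have "(\<integral>x. (1 - ind x)\<^sup>2 \<partial>X) = (\<integral>x. 1 - ind x \<partial>X)"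
            by (intro Bochner_Integration.integral_cong) (auto simp: ind_def)
          also have "\<dots> \<le> \<epsilon> * \<delta> / 3" by (rule tail)
          also have "\<dots> \<le> \<epsilon>" using par by simp
          finally show "(\<integral>x. (1 - ind x)\<^sup>2 \<partial>X) \<le> \<epsilon>" .
        qed (use par in \<open>auto intro!: sum_nonneg mult_nonneg_nonneg\<close>)
        finally have "\<bar>\<integral>x. T x * (1 - ind x) \<partial>X\<bar> \<le> sqrt ((V * (\<Sum>a<n. (c a)\<^sup>2)) * \<epsilon>)"
          by (intro real_le_rsqrt) simp
        also have "\<dots> = C * sqrt (V * \<epsilon>)" by (simp add: C_def real_sqrt_mult)
        finally show ?thesis unfolding e2 by simp
      qed
      have "\<bar>\<Sum>s\<in>G. \<Sum>a<n. c a * z a (xs s)\<bar> \<le> N * (C * sqrt (V * \<epsilon>) + C * sqrt (V * \<epsilon>))"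
        unfolding eq abs_mult using b1 b2
        by (intro mult_mono) (auto intro: order_trans[OF abs_triangle_ineq])
      then show ?thesis by (simp add: C_def algebra_simps)
    qed
    have "G \<subseteq> {..<N}" by (auto simp: G_def)
    then show ?thesis using c1 c2 c3 by blast
  qed
  then show ?thesis using GoodS prob by blast
qed

section \<open>Square roots of positive semidefinite matrices\<close>

no_notation inner (infix "\<bullet>" 70) and vec_nth (infixl "$" 90)

lemma psd_matD:
  assumes "psd_mat d A"
  shows "A \<in> carrier_mat d d" "transpose_mat A = A" "v \<in> carrier_vec d \<Longrightarrow> 0 \<le> v \<bullet> (A *\<^sub>v v)"
  using assms by (auto simp: psd_mat_def symmetric_mat_def)

lemma smult_mat_mult_vec:
  assumes "(A :: real mat) \<in> carrier_mat nr nc" "v \<in> carrier_vec nc"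
  shows "(k \<cdot>\<^sub>m A) *\<^sub>v v = k \<cdot>\<^sub>v (A *\<^sub>v v)"
  using assms by (intro eq_vecI) (auto simp: scalar_prod_def sum_distrib_left mult_ac)

lemma symmetric_scalar_prod:
  assumes A: "(A :: real mat) \<in> carrier_mat d d" "transpose_mat A = A" and v: "v \<in> carrier_vec d" "w \<in> carrier_vec d"
  shows "v \<bullet> (A *\<^sub>v w) = (A *\<^sub>v v) \<bullet> w" "v \<bullet> (A *\<^sub>v w) = w \<bullet> (A *\<^sub>v v)"
proof -
  show 1: "v \<bullet> (A *\<^sub>v w) = (A *\<^sub>v v) \<bullet> w"
    using transpose_vec_mult_scalar[OF A(1) v(2,1)] A(2) by simp
  show "v \<bullet> (A *\<^sub>v w) = w \<bullet> (A *\<^sub>v v)"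
    unfolding 1 by (rule comm_scalar_prod[of _ d]) (use A v in auto)
qed

lemma psd_Cauchy_Schwarz:
  assumes A: "psd_mat d A" and v: "v \<in> carrier_vec d" and w: "w \<in> carrier_vec d"
  shows "(v \<bullet> (A *\<^sub>v w))\<^sup>2 \<le> (v \<bullet> (A *\<^sub>v v)) * (w \<bullet> (A *\<^sub>v w))"
proof (rule nonneg_quadratic_discriminant)
  note c = psd_matD(1,2)[OF A]
  show "0 \<le> w \<bullet> (A *\<^sub>v w)" by (rule psd_matD(3)[OF A w])
  fix t
  have tw: "t \<cdot>\<^sub>v w \<in> carrier_vec d" using w by simp
  have "0 \<le> (v - t \<cdot>\<^sub>v w) \<bullet> (A *\<^sub>v (v - t \<cdot>\<^sub>v w))"
    using v tw by (intro psd_matD(3)[OF A]) auto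
  also have "A *\<^sub>v (v - t \<cdot>\<^sub>v w) = A *\<^sub>v v - t \<cdot>\<^sub>v (A *\<^sub>v w)"
    using mult_minus_distrib_mat_vec[OF c(1) v tw] mult_mat_vec[OF c(1) w] by simp
  also have "(v - t \<cdot>\<^sub>v w) \<bullet> (A *\<^sub>v v - t \<cdot>\<^sub>v (A *\<^sub>v w)) =
      v \<bullet> (A *\<^sub>v v - t \<cdot>\<^sub>v (A *\<^sub>v w)) - t * (w \<bullet> (A *\<^sub>v v - t \<cdot>\<^sub>v (A *\<^sub>v w)))"
    using v w c by (subst minus_scalar_prod_distrib[of _ d]) auto
  also have "v \<bullet> (A *\<^sub>v v - t \<cdot>\<^sub>v (A *\<^sub>v w)) = v \<bullet> (A *\<^sub>v v) - t * (v \<bullet> (A *\<^sub>v w))"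
    using v w c by (subst scalar_prod_minus_distrib[of _ d]) auto
  also have "w \<bullet> (A *\<^sub>v v - t \<cdot>\<^sub>v (A *\<^sub>v w)) = v \<bullet> (A *\<^sub>v w) - t * (w \<bullet> (A *\<^sub>v w))"
    using v w c symmetric_scalar_prod(2)[OF c w v] by (subst scalar_prod_minus_distrib[of _ d]) auto
  finally show "0 \<le> v \<bullet> (A *\<^sub>v v) - 2 * t * (v \<bullet> (A *\<^sub>v w)) + t\<^sup>2 * (w \<bullet> (A *\<^sub>v w))"
    by (simp add: power2_eq_square algebra_simps)
qed

lemma scalar_prod_self_nonneg: "0 \<le> (v :: real vec) \<bullet> v"
  by (auto simp: scalar_prod_def intro: sum_nonneg)

lemma scalar_prod_self_eq_0:
  assumes "(v :: real vec) \<in> carrier_vec d" "v \<bullet> v = 0"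
  shows "v = 0\<^sub>v d"
proof -
  have "(\<Sum>i\<in>{0..<dim_vec v}. v $ i * v $ i) = 0" using assms(2) by (simp add: scalar_prod_def)
  then have "\<forall>i\<in>{0..<dim_vec v}. v $ i * v $ i = 0" by (subst (asm) sum_nonneg_eq_0_iff) auto
  then show ?thesis using assms(1) by (intro eq_vecI) auto
qed

text \<open>For \<open>u = A v\<close>, Cauchy-Schwarz in the form of \<open>A\<close> gives
  \<open>|u|^4 \<le> (v . A v) (u . A u)\<close>, and the last factor is at most
  \<open>r |u|^2\<close>.\<close>

lemma psd_contraction:
  assumes A: "psd_mat d A" and r: "\<And>v. v \<in> carrier_vec d \<Longrightarrow> v \<bullet> (A *\<^sub>v v) \<le> r * (v \<bullet> v)" and v: "v \<in> carrier_vec d"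
  shows "(A *\<^sub>v v) \<bullet> (A *\<^sub>v v) \<le> r * (v \<bullet> (A *\<^sub>v v))"
proof -
  note c = psd_matD(1,2)[OF A]
  let ?u = "A *\<^sub>v v"
  have u: "?u \<in> carrier_vec d" using c v by auto
  have "(?u \<bullet> ?u)\<^sup>2 = (v \<bullet> (A *\<^sub>v ?u))\<^sup>2" using symmetric_scalar_prod(1)[OF c v u] by simp
  also have "\<dots> \<le> (v \<bullet> ?u) * (?u \<bullet> (A *\<^sub>v ?u))" by (rule psd_Cauchy_Schwarz[OF A v u])
  also have "\<dots> \<le> (v \<bullet> ?u) * (r * (?u \<bullet> ?u))"
    using r[OF u] psd_matD(3)[OF A v] by (rule mult_left_mono)
  finally have "(?u \<bullet> ?u) * (?u \<bullet> ?u) \<le> (r * (v \<bullet> ?u)) * (?u \<bullet> ?u)"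
    by (simp add: power2_eq_square mult_ac)
  moreover have "0 \<le> r * (v \<bullet> ?u)" if "?u \<bullet> ?u = 0"
  proof -
    have "?u = 0\<^sub>v d" by (rule scalar_prod_self_eq_0[OF u that])
    then show ?thesis using v by simp
  qed
  ultimately show ?thesis using scalar_prod_self_nonneg[of ?u]
    by (cases "?u \<bullet> ?u = 0") (auto simp: mult_le_cancel_right)
qed

lemma quad_form_bounded:
  assumes A: "(A :: real mat) \<in> carrier_mat d d"
  shows "\<exists>K>0. \<forall>v\<in>carrier_vec d. v \<bullet> (A *\<^sub>v v) \<le> K * (v \<bullet> v)"
proof (intro exI conjI ballI)
  define K where "K = (\<Sum>i<d. \<Sum>j<d. \<bar>A $$ (i, j)\<bar>) + 1"
  show "0 < K" unfolding K_def by (intro add_nonneg_pos sum_nonneg) auto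
  fix v :: "real vec" assume v: "v \<in> carrier_vec d"
  have vi: "\<bar>v $ i\<bar> \<le> sqrt (v \<bullet> v)" if "i < d" for i
  proof -
    have "v $ i * v $ i \<le> v \<bullet> v"
      unfolding scalar_prod_def by (rule member_le_sum) (use that v in auto)
    then show ?thesis by (intro real_le_rsqrt) (simp add: power2_eq_square)
  qed
  have "v \<bullet> (A *\<^sub>v v) = (\<Sum>i<d. \<Sum>j<d. v $ i * (A $$ (i, j) * v $ j))"
    using A v by (auto simp: scalar_prod_def mult_mat_vec_def sum_distrib_left atLeast0LessThan intro!: sum.cong)
  also have "\<dots> \<le> (\<Sum>i<d. \<Sum>j<d. \<bar>A $$ (i, j)\<bar> * (v \<bullet> v))"
  proof (intro sum_mono)
    fix i j assume ij: "i \<in> {..<d}" "j \<in> {..<d}"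
    have "v $ i * (A $$ (i, j) * v $ j) \<le> \<bar>A $$ (i, j)\<bar> * (\<bar>v $ i\<bar> * \<bar>v $ j\<bar>)"
      by (metis abs_ge_self abs_mult mult.left_commute)
    also have "\<bar>v $ i\<bar> * \<bar>v $ j\<bar> \<le> sqrt (v \<bullet> v) * sqrt (v \<bullet> v)"
      using vi ij by (intro mult_mono) (auto simp: scalar_prod_self_nonneg)
    also have "sqrt (v \<bullet> v) * sqrt (v \<bullet> v) = v \<bullet> v" using scalar_prod_self_nonneg by simp
    finally show "v $ i * (A $$ (i, j) * v $ j) \<le> \<bar>A $$ (i, j)\<bar> * (v \<bullet> v)"
      by (simp add: mult_left_mono)
  qed
  also have "\<dots> = (K - 1) * (v \<bullet> v)" by (simp add: K_def sum_distrib_right)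
  also have "\<dots> \<le> K * (v \<bullet> v)" using scalar_prod_self_nonneg[of v] by (simp add: algebra_simps)
  finally show "v \<bullet> (A *\<^sub>v v) \<le> K * (v \<bullet> v)" .
qed

text \<open>Comparing the dimensions of the two products with those of the identities forces the
  inverse to be square of size \<open>d\<close>.\<close>

lemma invertible_mat_inverse:
  assumes S: "S \<in> carrier_mat d d" and inv: "invertible_mat S"
  shows "\<exists>B\<in>carrier_mat d d. S * B = 1\<^sub>m d \<and> B * S = 1\<^sub>m d"
proof -
  from inv obtain B where B: "S * B = 1\<^sub>m (dim_row S)" "B * S = 1\<^sub>m (dim_row B)"
    by (auto simp: invertible_mat_def inverts_mat_def)
  have "dim_col (S * B) = d" using B(1) S by simp
  moreover have "dim_col (B * S) = dim_row B" using B(2) by simp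
  ultimately have "B \<in> carrier_mat d d" using S by auto
  then show ?thesis using B S by auto
qed

text \<open>Writing \<open>v = B (S v)\<close> with \<open>B\<close> the inverse bounds
  \<open>|v|^2\<close> by a multiple of \<open>|S v|^2\<close>, which \<open>psd_contraction\<close>
  bounds by a multiple of the form. No eigenvalue is involved.\<close>

lemma psd_invertible_coercive:
  assumes S: "psd_mat d S" and inv: "invertible_mat S"
  shows "\<exists>\<kappa>>0. \<forall>v\<in>carrier_vec d. \<kappa> * (v \<bullet> v) \<le> v \<bullet> (S *\<^sub>v v)"
proof -
  note c = psd_matD(1,2)[OF S]
  obtain B where Bd: "B \<in> carrier_mat d d" and BS: "B * S = 1\<^sub>m d"
    using invertible_mat_inverse[OF c(1) inv] by blast
  obtain \<tau> where \<tau>: "0 < \<tau>" "\<And>v. v \<in> carrier_vec d \<Longrightarrow> v \<bullet> (S *\<^sub>v v) \<le> \<tau> * (v \<bullet> v)"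
    using quad_form_bounded[OF c(1)] by blast
  have BB: "transpose_mat B * B \<in> carrier_mat d d" using Bd by auto
  obtain K where K: "0 < K" "\<And>v. v \<in> carrier_vec d \<Longrightarrow> v \<bullet> ((transpose_mat B * B) *\<^sub>v v) \<le> K * (v \<bullet> v)"
    using quad_form_bounded[OF BB] by blast
  have "1 / (K * \<tau>) * (v \<bullet> v) \<le> v \<bullet> (S *\<^sub>v v)" if v: "v \<in> carrier_vec d" for v
  proof -
    let ?u = "S *\<^sub>v v"
    have u: "?u \<in> carrier_vec d" using c v by auto
    have v_eq: "B *\<^sub>v ?u = v" using assoc_mult_mat_vec[OF Bd c(1) v] BS v by simp
    have "v \<bullet> v = (B *\<^sub>v ?u) \<bullet> (B *\<^sub>v ?u)" by (simp add: v_eq)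
    also have "\<dots> = ?u \<bullet> (transpose_mat B *\<^sub>v (B *\<^sub>v ?u))"
      using transpose_vec_mult_scalar[of "transpose_mat B" d d "B *\<^sub>v ?u" ?u] Bd u by simp
    also have "\<dots> = ?u \<bullet> ((transpose_mat B * B) *\<^sub>v ?u)"
      using assoc_mult_mat_vec[of "transpose_mat B" d d B d ?u] Bd u by simp
    also have "\<dots> \<le> K * (?u \<bullet> ?u)" by (rule K(2)[OF u])
    also have "\<dots> \<le> K * (\<tau> * (v \<bullet> ?u))"
      using psd_contraction[OF S \<tau>(2) v] K(1) by (intro mult_left_mono) auto
    finally show ?thesis using K \<tau> by (simp add: pos_divide_le_eq mult_ac)
  qed
  then show ?thesis using K \<tau> by (intro exI[of _ "1 / (K * \<tau>)"]) auto
qed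

text \<open>Each factor \<open>(a - k) / (k + 1)\<close> has modulus at most 1. The binomial series
  is thereby dominated by a geometric one.\<close>

lemma abs_gbinomial_le_1:
  fixes a :: real
  assumes "0 \<le> a" "a \<le> 1"
  shows "\<bar>a gchoose k\<bar> \<le> 1"
proof (induction k)
  case (Suc k)
  have "a gchoose Suc k = (a gchoose k) * ((a - real k) / real (Suc k))"
    by (simp add: gbinomial_prod_rev field_simps)
  moreover have "\<bar>(a - real k) / real (Suc k)\<bar> \<le> 1" using assms by (simp add: abs_le_iff)
  moreover have "\<bar>a gchoose k\<bar> * \<bar>(a - real k) / real (Suc k)\<bar> \<le> 1 * 1"
    using Suc calculation(2) by (intro mult_mono) auto
  ultimately show ?case by (simp only: abs_mult)
qed simp

text \<open>The series of \<open>(1 - B)\<^sup>a\<close>.\<close>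
definition binomial_series :: "nat \<Rightarrow> real mat \<Rightarrow> real \<Rightarrow> real mat" where
  "binomial_series d B a = mat d d (\<lambda>(i, j). \<Sum>k. (a gchoose k) * (- 1) ^ k * (B ^\<^sub>m k) $$ (i, j))"

context
  fixes d B r
  assumes B: "psd_mat d B" and r: "0 \<le> r" "r < 1"
    and Br: "\<And>v. v \<in> carrier_vec d \<Longrightarrow> v \<bullet> (B *\<^sub>v v) \<le> r * (v \<bullet> v)"
begin

private lemma Bc: "B \<in> carrier_mat d d" "transpose_mat B = B" by (rule psd_matD[OF B])+

private lemma powc[simp]: "B ^\<^sub>m k \<in> carrier_mat d d" using Bc by auto

private lemma pow_add: "B ^\<^sub>m k * B ^\<^sub>m l = B ^\<^sub>m (k + l)"
proof (induction l)
  case 0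
  have "B ^\<^sub>m k * 1\<^sub>m d = B ^\<^sub>m k" by (rule right_mult_one_mat[OF powc])
  then show ?case using Bc by simp
next
  case (Suc l)
  then show ?case using assoc_mult_mat[of "B ^\<^sub>m k" d d "B ^\<^sub>m l" d B d] Bc powc by simp
qed

private lemma pow_symmetric: "transpose_mat (B ^\<^sub>m k) = B ^\<^sub>m k"
proof (induction k)
  case 0
  then show ?case using Bc by simp
next
  case (Suc k)
  have "transpose_mat (B ^\<^sub>m Suc k) = B * B ^\<^sub>m k"
    using Suc Bc transpose_mult[of "B ^\<^sub>m k" d d B d] by simp
  also have "\<dots> = B ^\<^sub>m 1 * B ^\<^sub>m k" using Bc by simp
  also have "\<dots> = B ^\<^sub>m Suc k" unfolding pow_add by simp
  finally show ?case .
qed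

text \<open>\<open>B\<close> shrinks norms by the factor \<open>r\<close>, because
  \<open>|B v|^2 \<le> r (v . B v) \<le> r^2 |v|^2\<close>. This carries over to the entries of
  powers and gives summability.\<close>

private lemma pow_norm:
  assumes "v \<in> carrier_vec d"
  shows "(B ^\<^sub>m k *\<^sub>v v) \<bullet> (B ^\<^sub>m k *\<^sub>v v) \<le> (r ^ k)\<^sup>2 * (v \<bullet> v)"
  using assms
proof (induction k arbitrary: v)
  case 0
  then show ?case using Bc by simp
next
  case (Suc k)
  have Bv: "B *\<^sub>v v \<in> carrier_vec d" using Bc Suc by auto
  have "B ^\<^sub>m Suc k *\<^sub>v v = B ^\<^sub>m k *\<^sub>v (B *\<^sub>v v)"
    using assoc_mult_mat_vec[of "B ^\<^sub>m k" d d B d v] Bc Suc by simp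
  then have "(B ^\<^sub>m Suc k *\<^sub>v v) \<bullet> (B ^\<^sub>m Suc k *\<^sub>v v) \<le> (r ^ k)\<^sup>2 * ((B *\<^sub>v v) \<bullet> (B *\<^sub>v v))"
    using Suc.IH[OF Bv] by simp
  also have "\<dots> \<le> (r ^ k)\<^sup>2 * (r * (r * (v \<bullet> v)))"
  proof (rule mult_left_mono)
    have "(B *\<^sub>v v) \<bullet> (B *\<^sub>v v) \<le> r * (v \<bullet> (B *\<^sub>v v))" by (rule psd_contraction[OF B Br Suc.prems])
    also have "\<dots> \<le> r * (r * (v \<bullet> v))" using Br[OF Suc.prems] r by (intro mult_left_mono) auto
    finally show "(B *\<^sub>v v) \<bullet> (B *\<^sub>v v) \<le> r * (r * (v \<bullet> v))" .
  qed simp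
  finally show ?case by (simp add: power2_eq_square mult_ac)
qed

private lemma pow_entry:
  assumes "i < d" "j < d"
  shows "\<bar>(B ^\<^sub>m k) $$ (i, j)\<bar> \<le> r ^ k"
proof -
  let ?u = "B ^\<^sub>m k *\<^sub>v unit_vec d j"
  have u: "?u \<in> carrier_vec d" using mult_mat_vec_carrier[OF powc unit_vec_carrier] .
  have e: "(B ^\<^sub>m k) $$ (i, j) = ?u $ i"
    using assms Bc by (simp add: mult_mat_vec_def)
  have "(?u $ i)\<^sup>2 \<le> ?u \<bullet> ?u"
    unfolding scalar_prod_def power2_eq_square by (rule member_le_sum) (use u assms Bc in auto)
  also have "\<dots> \<le> (r ^ k)\<^sup>2"
    using pow_norm[of "unit_vec d j" k] assms by simp
  finally show ?thesis unfolding e using r by (simp add: abs_le_square_iff[symmetric])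
qed

private lemma series_summable:
  assumes "i < d" "j < d" "0 \<le> a" "a \<le> 1"
  shows "summable (\<lambda>k. norm ((a gchoose k) * (- 1) ^ k * (B ^\<^sub>m k) $$ (i, j)))"
proof (rule summable_comparison_test'[where g = "\<lambda>k. r ^ k" and N = 0])
  show "summable (\<lambda>k. r ^ k)" using r by (intro summable_geometric) auto
  fix k :: nat
  have "\<bar>a gchoose k\<bar> * \<bar>(B ^\<^sub>m k) $$ (i, j)\<bar> \<le> 1 * r ^ k"
    using abs_gbinomial_le_1[OF assms(3,4)] pow_entry[OF assms(1,2)] by (intro mult_mono) auto
  then show "norm (norm ((a gchoose k) * (- 1) ^ k * (B ^\<^sub>m k) $$ (i, j))) \<le> r ^ k"
    by (simp add: abs_mult power_abs)
qed

lemma binomial_series_symmetric: "transpose_mat (binomial_series d B a) = binomial_series d B a"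
proof -
  have "(B ^\<^sub>m k) $$ (j, i) = (B ^\<^sub>m k) $$ (i, j)" if "i < d" "j < d" for i j k
  proof -
    have "(B ^\<^sub>m k) $$ (j, i) = transpose_mat (B ^\<^sub>m k) $$ (i, j)" using that Bc by simp
    then show ?thesis by (simp add: pow_symmetric)
  qed
  then show ?thesis by (intro eq_matI) (auto simp: binomial_series_def)
qed

text \<open>The Cauchy product of the two series is summed by Vandermonde's identity for generalised
  binomial coefficients, which is the exponent law for powers of \<open>1 - B\<close>.\<close>

lemma binomial_series_add:
  assumes "0 \<le> a" "0 \<le> b" "a + b \<le> 1"
  shows "binomial_series d B a * binomial_series d B b = binomial_series d B (a + b)"
proof (rule eq_matI)
  show "dim_row (binomial_series d B a * binomial_series d B b) = dim_row (binomial_series d B (a + b))"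
    "dim_col (binomial_series d B a * binomial_series d B b) = dim_col (binomial_series d B (a + b))"
    by (simp_all add: binomial_series_def)
  fix i j assume "i < dim_row (binomial_series d B (a + b))" "j < dim_col (binomial_series d B (a + b))"
  then have ij: "i < d" "j < d" by (simp_all add: binomial_series_def)
  let ?t = "\<lambda>a i j k. (a gchoose k) * (- 1) ^ k * (B ^\<^sub>m k) $$ (i, j)"
  have pow_prod: "(\<Sum>l<d. (B ^\<^sub>m k) $$ (i, l) * (B ^\<^sub>m m) $$ (l, j)) = (B ^\<^sub>m (k + m)) $$ (i, j)" for k m
  proof -
    have "(B ^\<^sub>m (k + m)) $$ (i, j) = (B ^\<^sub>m k * B ^\<^sub>m m) $$ (i, j)" by (simp add: pow_add)
    also have "\<dots> = row (B ^\<^sub>m k) i \<bullet> col (B ^\<^sub>m m) j"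
      using ij Bc by (subst index_mult_mat) auto
    also have "\<dots> = (\<Sum>l<d. (B ^\<^sub>m k) $$ (i, l) * (B ^\<^sub>m m) $$ (l, j))"
      using ij Bc by (simp add: scalar_prod_def atLeast0LessThan)
    finally show ?thesis by simp
  qed
  have "(binomial_series d B a * binomial_series d B b) $$ (i, j) = (\<Sum>l<d. (\<Sum>k. ?t a i l k) * (\<Sum>k. ?t b l j k))"
    using ij by (simp add: binomial_series_def scalar_prod_def atLeast0LessThan)
  also have "\<dots> = (\<Sum>l<d. \<Sum>n. \<Sum>k\<le>n. ?t a i l k * ?t b l j (n - k))"
    by (intro sum.cong refl Cauchy_product series_summable) (use ij assms in auto)
  also have "\<dots> = (\<Sum>n. \<Sum>l<d. \<Sum>k\<le>n. ?t a i l k * ?t b l j (n - k))"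
    by (intro suminf_sum[symmetric] summable_Cauchy_product series_summable) (use ij assms in auto)
  also have "\<dots> = (\<Sum>n. ?t (a + b) i j n)"
  proof (rule suminf_cong)
    fix n
    have "(\<Sum>l<d. \<Sum>k\<le>n. ?t a i l k * ?t b l j (n - k)) =
        (\<Sum>k\<le>n. (a gchoose k) * (b gchoose (n - k)) * (- 1) ^ n * (\<Sum>l<d. (B ^\<^sub>m k) $$ (i, l) * (B ^\<^sub>m (n - k)) $$ (l, j)))"
      unfolding sum_distrib_left
      by (subst sum.swap) (auto intro!: sum.cong simp: power_add[symmetric] mult_ac)
    also have "\<dots> = (\<Sum>k\<le>n. (a gchoose k) * (b gchoose (n - k)) * ((- 1) ^ n * (B ^\<^sub>m n) $$ (i, j)))"
      unfolding pow_prod by (intro sum.cong) auto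
    also have "\<dots> = (\<Sum>k\<le>n. (a gchoose k) * (b gchoose (n - k))) * ((- 1) ^ n * (B ^\<^sub>m n) $$ (i, j))"
      by (rule sum_distrib_right[symmetric])
    also have "(\<Sum>k\<le>n. (a gchoose k) * (b gchoose (n - k))) = (a + b) gchoose n"
      using gbinomial_Vandermonde[of a b n] by (simp add: atMost_atLeast0)
    finally show "(\<Sum>l<d. \<Sum>k\<le>n. ?t a i l k * ?t b l j (n - k)) = ?t (a + b) i j n"
      by (simp add: mult_ac)
  qed
  also have "\<dots> = binomial_series d B (a + b) $$ (i, j)" using ij by (simp add: binomial_series_def)
  finally show "(binomial_series d B a * binomial_series d B b) $$ (i, j) = binomial_series d B (a + b) $$ (i, j)" .
qed

lemma binomial_series_1: "binomial_series d B 1 = 1\<^sub>m d - B"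
proof (rule eq_matI)
  show "dim_row (binomial_series d B 1) = dim_row (1\<^sub>m d - B)" "dim_col (binomial_series d B 1) = dim_col (1\<^sub>m d - B)"
    using Bc by (auto simp: binomial_series_def)
  fix i j assume "i < dim_row (1\<^sub>m d - B)" "j < dim_col (1\<^sub>m d - B)"
  then have ij: "i < d" "j < d" using Bc by auto
  have "((1::real) gchoose k) = 0" if "2 \<le> k" for k
  proof -
    have "(\<Prod>i=0..<k. (1::real) - of_nat i) = 0"
      using that by (intro prod_zero) (auto intro!: bexI[of _ 1])
    then show ?thesis by (simp add: gbinomial_prod_rev)
  qed
  then have "(\<lambda>k. ((1::real) gchoose k) * (- 1) ^ k * (B ^\<^sub>m k) $$ (i, j)) sums
      (\<Sum>k\<in>{0, 1}. ((1::real) gchoose k) * (- 1) ^ k * (B ^\<^sub>m k) $$ (i, j))"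
    by (intro sums_finite) (auto simp: not_le less_2_cases_iff)
  then have "binomial_series d B 1 $$ (i, j) = (\<Sum>k\<in>{0, 1}. ((1::real) gchoose k) * (- 1) ^ k * (B ^\<^sub>m k) $$ (i, j))"
    using ij by (simp add: binomial_series_def sums_iff)
  also have "\<dots> = (1\<^sub>m d - B) $$ (i, j)" using ij Bc by simp
  finally show "binomial_series d B 1 $$ (i, j) = (1\<^sub>m d - B) $$ (i, j)" .
qed

end

lemma symmetric_square_psd:
  assumes "(T :: real mat) \<in> carrier_mat d d" "transpose_mat T = T"
  shows "psd_mat d (T * T)"
  unfolding psd_mat_def symmetric_mat_def
proof (intro conjI ballI)
  show "T * T \<in> carrier_mat d d" using assms by auto
  show "transpose_mat (T * T) = T * T" using assms transpose_mult[of T d d T d] by simp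
  fix v :: "real vec" assume v: "v \<in> carrier_vec d"
  have "v \<bullet> (T * T *\<^sub>v v) = (T *\<^sub>v v) \<bullet> (T *\<^sub>v v)"
    using symmetric_scalar_prod(1)[OF assms v, of "T *\<^sub>v v"] assms v by simp
  then show "0 \<le> v \<bullet> (T * T *\<^sub>v v)" by (simp add: scalar_prod_self_nonneg)
qed

text \<open>Scaling by an upper bound \<open>\<tau>\<close> of the form turns \<open>S\<close> into
  \<open>1 - B\<close> with \<open>0 \<le> B \<le> r\<close> and
  \<open>r = 1 - \<kappa> / \<tau>\<close>; coercivity gives \<open>r < 1\<close>, the convergence
  of the series.\<close>

lemma psd_sqrt_exists:
  assumes S: "psd_mat d S"
    and \<kappa>: "0 < \<kappa>" "\<And>v. v \<in> carrier_vec d \<Longrightarrow> \<kappa> * (v \<bullet> v) \<le> v \<bullet> (S *\<^sub>v v)"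
  shows "\<exists>R. psd_mat d R \<and> R * R = S"
proof -
  note c = psd_matD(1,2)[OF S]
  obtain \<tau>' where \<tau>': "0 < \<tau>'" "\<And>v. v \<in> carrier_vec d \<Longrightarrow> v \<bullet> (S *\<^sub>v v) \<le> \<tau>' * (v \<bullet> v)"
    using quad_form_bounded[OF c(1)] by blast
  \<comment> \<open>Adding \<open>\<kappa>\<close> ensures \<open>\<kappa> \<le> \<tau>\<close>,
    hence \<open>0 \<le> r\<close>.\<close>
  define \<tau> where "\<tau> = \<tau>' + \<kappa>"
  have \<tau>: "0 < \<tau>" "\<kappa> \<le> \<tau>" "\<And>v. v \<in> carrier_vec d \<Longrightarrow> v \<bullet> (S *\<^sub>v v) \<le> \<tau> * (v \<bullet> v)"
  proof -
    show "0 < \<tau>" "\<kappa> \<le> \<tau>" using \<tau>' \<kappa> by (simp_all add: \<tau>_def)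
    fix v :: "real vec" assume v: "v \<in> carrier_vec d"
    have "0 \<le> \<kappa> * (v \<bullet> v)" using \<kappa>(1) scalar_prod_self_nonneg[of v] by simp
    then show "v \<bullet> (S *\<^sub>v v) \<le> \<tau> * (v \<bullet> v)" using \<tau>'(2)[OF v] by (simp add: \<tau>_def distrib_right)
  qed
  define B where "B = 1\<^sub>m d - (1 / \<tau>) \<cdot>\<^sub>m S"
  define r where "r = 1 - \<kappa> / \<tau>"
  have Bc: "B \<in> carrier_mat d d" using c by (auto simp: B_def)
  have quad: "v \<bullet> (B *\<^sub>v v) = v \<bullet> v - (v \<bullet> (S *\<^sub>v v)) / \<tau>" if v: "v \<in> carrier_vec d" for v
  proof -
    have "B *\<^sub>v v = v - (1 / \<tau>) \<cdot>\<^sub>v (S *\<^sub>v v)"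
      unfolding B_def using c v by (subst minus_mult_distrib_mat_vec[of _ d d]) (auto simp: smult_mat_mult_vec)
    then show ?thesis using c v by (simp add: scalar_prod_minus_distrib[of _ d])
  qed
  have psdB: "psd_mat d B"
    unfolding psd_mat_def symmetric_mat_def
  proof (intro conjI ballI Bc)
    have "S $$ (i, j) = S $$ (j, i)" if "i < d" "j < d" for i j
      using c that index_transpose_mat(1)[of i S j] by simp
    then show "transpose_mat B = B" using c by (intro eq_matI) (auto simp: B_def)
    fix v :: "real vec" assume v: "v \<in> carrier_vec d"
    show "0 \<le> v \<bullet> (B *\<^sub>v v)" unfolding quad[OF v] using \<tau>(1) \<tau>(3)[OF v] by (simp add: pos_divide_le_eq mult.commute)
  qed
  have r: "0 \<le> r" "r < 1" using \<tau> \<kappa> by (simp_all add: r_def)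
  have Br: "v \<bullet> (B *\<^sub>v v) \<le> r * (v \<bullet> v)" if v: "v \<in> carrier_vec d" for v
    unfolding quad[OF v] r_def using \<tau>(1) \<kappa>(2)[OF v] by (simp add: field_simps)
  \<comment> \<open>A fourth root, because the square of a symmetric matrix is automatically positive semidefinite.\<close>
  define T where "T = binomial_series d B (1 / 4)"
  note bs = binomial_series_symmetric[OF psdB r Br] binomial_series_add[OF psdB r Br] binomial_series_1[OF psdB r Br]
  have T: "T \<in> carrier_mat d d" "transpose_mat T = T" by (simp add: T_def binomial_series_def) (simp add: T_def bs(1))
  define Q where "Q = T * T"
  have Q: "psd_mat d Q" unfolding Q_def by (rule symmetric_square_psd[OF T])
  have "Q = binomial_series d B (1 / 2)" unfolding Q_def T_def by (subst bs) auto
  then have QQ: "Q * Q = 1\<^sub>m d - B" by (simp add: bs)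
  have "1\<^sub>m d - B = (1 / \<tau>) \<cdot>\<^sub>m S" unfolding B_def using c by (intro eq_matI) auto
  then have S_eq: "\<tau> \<cdot>\<^sub>m (Q * Q) = S" unfolding QQ using \<tau>(1) by (intro eq_matI) auto
  define R where "R = sqrt \<tau> \<cdot>\<^sub>m Q"
  note Qc = psd_matD(1,2)[OF Q]
  have "R * R = (sqrt \<tau> * sqrt \<tau>) \<cdot>\<^sub>m (Q * Q)"
    unfolding R_def using Qc mult_smult_distrib[of "sqrt \<tau> \<cdot>\<^sub>m Q" d d Q d "sqrt \<tau>"] mult_smult_assoc_mat[of Q d d Q d "sqrt \<tau>"]
    by (auto intro!: eq_matI)
  then have RR: "R * R = S" using S_eq \<tau>(1) by simp
  have "psd_mat d R"
    unfolding psd_mat_def symmetric_mat_def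
  proof (intro conjI ballI)
    show "R \<in> carrier_mat d d" using Qc by (auto simp: R_def)
    have "Q $$ (i, j) = Q $$ (j, i)" if "i < d" "j < d" for i j
      using Qc that index_transpose_mat(1)[of i Q j] by simp
    then show "transpose_mat R = R" using Qc by (intro eq_matI) (auto simp: R_def)
    fix v :: "real vec" assume v: "v \<in> carrier_vec d"
    have "R *\<^sub>v v = sqrt \<tau> \<cdot>\<^sub>v (Q *\<^sub>v v)"
      unfolding R_def using Qc v by (simp add: smult_mat_mult_vec)
    then show "0 \<le> v \<bullet> (R *\<^sub>v v)" using psd_matD(3)[OF Q v] Qc v \<tau>(1) by simp
  qed
  then show ?thesis using RR by blast
qed

section \<open>The Frobenius inner product\<close>

text \<open>Traces of products are treated as Frobenius inner products, for which multiplication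
  from either side has multiplication by the transpose as its adjoint.\<close>

definition ip :: "nat \<Rightarrow> real mat \<Rightarrow> real mat \<Rightarrow> real" where
  "ip d A B = (\<Sum>i<d. \<Sum>j<d. A $$ (i, j) * B $$ (i, j))"

lemma index_mult_sum:
  assumes "(A :: real mat) \<in> carrier_mat d d" "B \<in> carrier_mat d d" "i < d" "j < d"
  shows "(A * B) $$ (i, j) = (\<Sum>l<d. A $$ (i, l) * B $$ (l, j))"
  using assms by (simp add: scalar_prod_def atLeast0LessThan)

lemma ip_commute: "ip d A B = ip d B A"
  by (simp add: ip_def mult.commute)

lemma ip_add_right:
  assumes "A \<in> carrier_mat d d" "B \<in> carrier_mat d d" "C \<in> carrier_mat d d"
  shows "ip d A (B + C) = ip d A B + ip d A C"
  unfolding ip_def sum.distrib[symmetric] using assms by (auto intro!: sum.cong simp: algebra_simps)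

lemma ip_minus_right:
  assumes "A \<in> carrier_mat d d" "B \<in> carrier_mat d d" "C \<in> carrier_mat d d"
  shows "ip d A (B - C) = ip d A B - ip d A C"
  unfolding ip_def sum_subtractf[symmetric] using assms by (auto intro!: sum.cong simp: algebra_simps)

lemma ip_smult_right:
  assumes "A \<in> carrier_mat d d" "B \<in> carrier_mat d d"
  shows "ip d A (k \<cdot>\<^sub>m B) = k * ip d A B"
  unfolding ip_def sum_distrib_left using assms by (auto intro!: sum.cong)

lemma ip_self_nonneg: "0 \<le> ip d A A"
  by (auto simp: ip_def intro!: sum_nonneg)

lemma ip_self_eq_0:
  assumes "A \<in> carrier_mat d d" "ip d A A = 0"
  shows "A = 0\<^sub>m d d"
proof -
  have "\<forall>i\<in>{..<d}. (\<Sum>j<d. A $$ (i, j) * A $$ (i, j)) = 0"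
    using assms(2) unfolding ip_def by (subst (asm) sum_nonneg_eq_0_iff) (auto intro: sum_nonneg)
  then have "\<forall>i\<in>{..<d}. \<forall>j\<in>{..<d}. A $$ (i, j) * A $$ (i, j) = 0"
    by (subst (asm) sum_nonneg_eq_0_iff) auto
  then show ?thesis using assms(1) by (intro eq_matI) auto
qed

lemma ip_mult_left:
  assumes "A \<in> carrier_mat d d" "B \<in> carrier_mat d d" "C \<in> carrier_mat d d"
  shows "ip d (B * A) C = ip d A (transpose_mat B * C)"
proof -
  have "ip d (B * A) C = (\<Sum>i<d. \<Sum>j<d. \<Sum>l<d. B $$ (i, l) * A $$ (l, j) * C $$ (i, j))"
    unfolding ip_def using assms by (auto intro!: sum.cong simp: index_mult_sum sum_distrib_right simp del: index_mult_mat(1))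
  also have "\<dots> = (\<Sum>i<d. \<Sum>l<d. \<Sum>j<d. B $$ (i, l) * A $$ (l, j) * C $$ (i, j))"
    by (intro sum.cong refl sum.swap)
  also have "\<dots> = (\<Sum>l<d. \<Sum>i<d. \<Sum>j<d. B $$ (i, l) * A $$ (l, j) * C $$ (i, j))"
    by (rule sum.swap)
  also have "\<dots> = (\<Sum>l<d. \<Sum>j<d. \<Sum>i<d. B $$ (i, l) * A $$ (l, j) * C $$ (i, j))"
    by (intro sum.cong refl sum.swap)
  also have "\<dots> = ip d A (transpose_mat B * C)"
    unfolding ip_def using assms
    by (auto intro!: sum.cong simp: index_mult_sum[of "transpose_mat B"] sum_distrib_left mult_ac simp del: index_mult_mat(1))
  finally show ?thesis .
qed

lemma ip_transpose:
  assumes "A \<in> carrier_mat d d" "B \<in> carrier_mat d d"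
  shows "ip d (transpose_mat A) (transpose_mat B) = ip d A B"
  unfolding ip_def by (subst sum.swap) (use assms in \<open>auto intro!: sum.cong\<close>)

lemma ip_mult_right:
  assumes "A \<in> carrier_mat d d" "B \<in> carrier_mat d d" "C \<in> carrier_mat d d"
  shows "ip d (A * B) C = ip d A (C * transpose_mat B)"
proof -
  have "ip d (A * B) C = ip d (transpose_mat B * transpose_mat A) (transpose_mat C)"
    using assms by (subst ip_transpose[symmetric]) (auto simp: transpose_mult)
  also have "\<dots> = ip d (transpose_mat A) (B * transpose_mat C)"
    using assms by (subst ip_mult_left) auto
  also have "\<dots> = ip d A (C * transpose_mat B)"
    using assms by (subst ip_transpose[symmetric]) (auto simp: transpose_mult)
  finally show ?thesis .
qed

lemma frob_norm_ip: "A \<in> carrier_mat d d \<Longrightarrow> frob_norm A = sqrt (ip d A A)"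
  by (simp add: frob_norm_def ip_def power2_eq_square)

lemma mat_trace_mult:
  assumes "A \<in> carrier_mat d d" "M \<in> carrier_mat d d"
  shows "mat_trace (A * M) = ip d (transpose_mat A) M"
proof -
  have "mat_trace (A * M) = (\<Sum>i<d. \<Sum>l<d. A $$ (i, l) * M $$ (l, i))"
    unfolding mat_trace_def using assms by (auto intro!: sum.cong simp: index_mult_sum simp del: index_mult_mat(1))
  also have "\<dots> = ip d (transpose_mat A) M"
    unfolding ip_def by (subst sum.swap) (use assms in \<open>auto intro!: sum.cong\<close>)
  finally show ?thesis .
qed

lemma ip_Cauchy_Schwarz:
  shows "(ip d A B)\<^sup>2 \<le> ip d A A * ip d B B"
  unfolding ip_def sum.cartesian_product
  using Cauchy_Schwarz_ineq_sum[of "\<lambda>(i, j). A $$ (i, j)" "\<lambda>(i, j). B $$ (i, j)" "{..<d} \<times> {..<d}"]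
  by (simp add: case_prod_unfold power2_eq_square)

text \<open>Cauchy-Schwarz applied to each entry of the product: the Frobenius norm is
  submultiplicative.\<close>

lemma ip_mult_le:
  assumes "A \<in> carrier_mat d d" "B \<in> carrier_mat d d"
  shows "ip d (A * B) (A * B) \<le> ip d A A * ip d B B"
proof -
  have "ip d (A * B) (A * B) = (\<Sum>i<d. \<Sum>j<d. (\<Sum>l<d. A $$ (i, l) * B $$ (l, j))\<^sup>2)"
    unfolding ip_def using assms by (auto intro!: sum.cong simp: index_mult_sum power2_eq_square simp del: index_mult_mat(1))
  also have "\<dots> \<le> (\<Sum>i<d. \<Sum>j<d. (\<Sum>l<d. (A $$ (i, l))\<^sup>2) * (\<Sum>l<d. (B $$ (l, j))\<^sup>2))"
    by (intro sum_mono Cauchy_Schwarz_ineq_sum)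
  also have "\<dots> = (\<Sum>i<d. \<Sum>l<d. (A $$ (i, l))\<^sup>2) * (\<Sum>j<d. \<Sum>l<d. (B $$ (l, j))\<^sup>2)"
    by (rule sum_product[symmetric])
  also have "(\<Sum>j<d. \<Sum>l<d. (B $$ (l, j))\<^sup>2) = ip d B B"
    unfolding ip_def by (subst sum.swap) (simp add: power2_eq_square)
  finally show ?thesis by (simp add: ip_def power2_eq_square)
qed

lemma ip_psd_columns:
  assumes "P \<in> carrier_mat d d" "X \<in> carrier_mat d d"
  shows "ip d X (P * X) = (\<Sum>j<d. col X j \<bullet> (P *\<^sub>v col X j))"
  unfolding ip_def
proof (subst sum.swap, intro sum.cong refl)
  fix j assume "j \<in> {..<d}"
  then show "(\<Sum>i<d. X $$ (i, j) * (P * X) $$ (i, j)) = col X j \<bullet> (P *\<^sub>v col X j)"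
    using assms by (simp add: scalar_prod_def[of "col X j"] atLeast0LessThan)
qed

lemma ip_psd_left_nonneg:
  assumes P: "psd_mat d P" and X: "X \<in> carrier_mat d d"
  shows "0 \<le> ip d X (P * X)"
  unfolding ip_psd_columns[OF psd_matD(1)[OF P] X]
  using X by (intro sum_nonneg psd_matD(3)[OF P]) auto

lemma ip_psd_right_nonneg:
  assumes P: "psd_mat d P" and X: "X \<in> carrier_mat d d"
  shows "0 \<le> ip d X (X * P)"
proof -
  note c = psd_matD(1,2)[OF P]
  have "ip d X (X * P) = ip d (transpose_mat X) (transpose_mat (X * P))"
    using X c by (intro ip_transpose[symmetric]) auto
  also have "transpose_mat (X * P) = P * transpose_mat X" using X c transpose_mult[of X d d P d] by simp
  finally show ?thesis using ip_psd_left_nonneg[OF P, of "transpose_mat X"] X by simp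
qed

text \<open>The inner product is the sum of the form over the columns, so each column is a null
  vector of \<open>P\<close>; Cauchy-Schwarz in the form of \<open>P\<close> places it in the
  kernel.\<close>

lemma ip_psd_left_eq_0:
  assumes P: "psd_mat d P" and X: "X \<in> carrier_mat d d" and 0: "ip d X (P * X) = 0"
  shows "P * X = 0\<^sub>m d d"
proof -
  note c = psd_matD(1)[OF P]
  have z: "P *\<^sub>v col X j = 0\<^sub>v d" if j: "j < d" for j
  proof -
    let ?c = "col X j"
    have cc: "?c \<in> carrier_vec d" "P *\<^sub>v ?c \<in> carrier_vec d" using X c by auto
    have "\<forall>j\<in>{..<d}. col X j \<bullet> (P *\<^sub>v col X j) = 0"
      using 0 X unfolding ip_psd_columns[OF c X]
      by (subst (asm) sum_nonneg_eq_0_iff) (auto intro!: psd_matD(3)[OF P])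
    then have "?c \<bullet> (P *\<^sub>v ?c) = 0" using j by auto
    then have "((P *\<^sub>v ?c) \<bullet> (P *\<^sub>v ?c))\<^sup>2 \<le> 0"
      using psd_Cauchy_Schwarz[OF P cc(2) cc(1)] by simp
    then show ?thesis by (intro scalar_prod_self_eq_0[OF cc(2)]) simp
  qed
  show ?thesis
  proof (rule eq_matI)
    fix i j assume ij: "i < dim_row (0\<^sub>m d d :: real mat)" "j < dim_col (0\<^sub>m d d :: real mat)"
    then have "(P * X) $$ (i, j) = (P *\<^sub>v col X j) $ i" using X c by simp
    then show "(P * X) $$ (i, j) = 0\<^sub>m d d $$ (i, j)" using z[of j] ij by simp
  qed (use X c in auto)
qed

text \<open>With \<open>D = P - Q\<close>, the sum of \<open>(P + Q) D\<close> and
  \<open>D (P + Q)\<close> is \<open>2 (P^2 - Q^2) = 0\<close>. Pairing with \<open>D\<close> gives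
  two halves that transposition shows to be equal, each a sum of nonnegative terms. Hence
  \<open>P D = Q D = 0\<close>, and \<open>D^2 = 0\<close>.\<close>

lemma psd_sqrt_unique:
  assumes P: "psd_mat d P" and Q: "psd_mat d Q" and eq: "P * P = Q * Q"
  shows "P = Q"
proof -
  note p = psd_matD(1,2)[OF P] and q = psd_matD(1,2)[OF Q]
  note [simp] = mult_carrier_mat[of _ d d _ d] minus_carrier_mat[of _ d d] add_carrier_mat[of _ d d]
  define D where "D = P - Q"
  have D: "D \<in> carrier_mat d d" using p q by (auto simp: D_def)
  have DT: "transpose_mat D = D" using p q by (simp add: D_def transpose_minus[of _ d d])
  have s: "P * D + Q * D = P * P - P * Q + (Q * P - Q * Q)"
    unfolding D_def using p q by (simp add: mult_minus_distrib_mat[of _ d d])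
  have s': "D * P + D * Q = P * P - Q * P + (P * Q - Q * Q)"
    unfolding D_def using p q by (simp add: minus_mult_distrib_mat[of _ d d])
  have "ip d D (P * D + Q * D) + ip d D (D * P + D * Q) = 0"
  proof -
    have "ip d D (P * D + Q * D) + ip d D (D * P + D * Q) =
        2 * ip d D (P * P) - 2 * ip d D (Q * Q)"
      unfolding s s' using D p q by (simp add: ip_add_right ip_minus_right)
    then show ?thesis by (simp add: eq)
  qed
  moreover have "ip d D (D * P + D * Q) = ip d D (P * D + Q * D)"
  proof -
    have "transpose_mat (D * P + D * Q) = P * D + Q * D"
      using D p q DT by (subst transpose_add[of _ d d]) (auto simp: transpose_mult[of _ d d _ d])
    then show ?thesis using ip_transpose[of D d "D * P + D * Q"] D p q DT by simp
  qed
  ultimately have "ip d D (P * D) + ip d D (Q * D) = 0"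
    using D p q by (simp add: ip_add_right)
  then have "ip d D (P * D) = 0" "ip d D (Q * D) = 0"
    using ip_psd_left_nonneg[OF P D] ip_psd_left_nonneg[OF Q D] by linarith+
  then have z: "P * D = 0\<^sub>m d d" "Q * D = 0\<^sub>m d d"
    using ip_psd_left_eq_0[OF P D] ip_psd_left_eq_0[OF Q D] by auto
  have "D * D = P * D - Q * D" using p q D minus_mult_distrib_mat[of P d d Q D d] by (simp add: D_def)
  then have "D * D = 0\<^sub>m d d" using z by (auto intro!: eq_matI)
  moreover have "ip d D D = ip d (1\<^sub>m d) (D * D)"
    using ip_mult_left[of "1\<^sub>m d" d D D] D DT by simp
  ultimately have "ip d D D = 0" by (simp add: ip_def)
  then have "D = 0\<^sub>m d d" by (rule ip_self_eq_0[OF D])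
  then have "\<And>i j. i < d \<Longrightarrow> j < d \<Longrightarrow> P $$ (i, j) - Q $$ (i, j) = 0"
    using p q by (metis D_def carrier_matD index_minus_mat(1) index_zero_mat(1))
  then show ?thesis using p q by (intro eq_matI) auto
qed

section \<open>The root of an invertible matrix and its inverse\<close>

lemma psd_sqrt_properties:
  assumes S: "psd_mat d S" and inv: "invertible_mat S"
  shows "psd_mat d (psd_sqrt S)" "psd_sqrt S * psd_sqrt S = S"
proof -
  obtain \<kappa> where \<kappa>: "0 < \<kappa>" "\<And>v. v \<in> carrier_vec d \<Longrightarrow> \<kappa> * (v \<bullet> v) \<le> v \<bullet> (S *\<^sub>v v)"
    using psd_invertible_coercive[OF assms] by blast
  obtain R where R: "psd_mat d R" "R * R = S" using psd_sqrt_exists[OF S \<kappa>] by blast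
  have d: "dim_row S = d" using psd_matD(1)[OF S] by simp
  have "\<exists>!R. psd_mat (dim_row S) R \<and> R * R = S"
    unfolding d
  proof (rule ex1I[of _ R])
    show "psd_mat d R \<and> R * R = S" using R by simp
    show "Q = R" if "psd_mat d Q \<and> Q * Q = S" for Q
      by (rule psd_sqrt_unique[of d]) (use that R in simp_all)
  qed
  from theI'[OF this] show "psd_mat d (psd_sqrt S)" "psd_sqrt S * psd_sqrt S = S"
    unfolding psd_sqrt_def d by auto
qed

text \<open>\<open>mat_inverse\<close> succeeds on units of the matrix ring. The root
  \<open>R\<close> is one: with \<open>B\<close> the inverse of \<open>S\<close>, associativity
  makes the right inverse \<open>R * B\<close> and the left inverse \<open>B * R\<close>
  coincide.\<close>

lemma psd_inv_sqrt_properties: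
  assumes S: "psd_mat d S" and inv: "invertible_mat S"
  shows "psd_inv_sqrt S \<in> carrier_mat d d" "transpose_mat (psd_inv_sqrt S) = psd_inv_sqrt S"
    "psd_sqrt S * psd_inv_sqrt S = 1\<^sub>m d" "psd_inv_sqrt S * psd_sqrt S = 1\<^sub>m d"
proof -
  note c = psd_matD(1)[OF S]
  define R where "R = psd_sqrt S"
  have R: "R \<in> carrier_mat d d" "transpose_mat R = R" "R * R = S"
    using psd_sqrt_properties[OF assms] psd_matD[of d R] by (auto simp: R_def)
  obtain B where Bd: "B \<in> carrier_mat d d" and B: "S * B = 1\<^sub>m d" "B * S = 1\<^sub>m d"
    using invertible_mat_inverse[OF c inv] by blast
  have 1: "R * (R * B) = 1\<^sub>m d" using B(1) R c Bd assoc_mult_mat[of R d d R d B d] by simp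
  have 2: "(B * R) * R = 1\<^sub>m d" using B(2) R c Bd assoc_mult_mat[of B d d R d R d] by simp
  have "B * R = (B * R) * (R * (R * B))" using 1 R Bd by simp
  also have "\<dots> = ((B * R) * R) * (R * B)" using R Bd by (intro assoc_mult_mat[symmetric]) auto
  also have "\<dots> = R * B" using 2 R Bd by simp
  finally have "R \<in> Units (ring_mat TYPE(real) d b)" for b :: unit
    using 1 2 R Bd unfolding Units_def by (auto simp: ring_mat_def intro!: bexI[of _ "R * B"])
  then obtain W where W: "mat_inverse R = Some W"
    using mat_inverse(1)[OF R(1), of "()"] by (cases "mat_inverse R") auto
  have Wp: "R * W = 1\<^sub>m d" "W * R = 1\<^sub>m d" "W \<in> carrier_mat d d"
    using mat_inverse(2)[OF R(1) W] by auto
  have W_eq: "psd_inv_sqrt S = W" unfolding psd_inv_sqrt_def R_def[symmetric] W by simp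
  show "psd_inv_sqrt S \<in> carrier_mat d d" "psd_sqrt S * psd_inv_sqrt S = 1\<^sub>m d" "psd_inv_sqrt S * psd_sqrt S = 1\<^sub>m d"
    using Wp by (simp_all add: W_eq R_def[symmetric])
  have "transpose_mat W * R = 1\<^sub>m d"
    using transpose_mult[OF R(1) Wp(3)] R(2) Wp(1) by simp
  then have "W = (transpose_mat W * R) * W" using Wp by simp
  also have "\<dots> = transpose_mat W * (R * W)" using Wp R by (intro assoc_mult_mat) auto
  also have "\<dots> = transpose_mat W" using Wp by simp
  finally show "transpose_mat (psd_inv_sqrt S) = psd_inv_sqrt S" by (simp add: W_eq)
qed

section \<open>Order relations under conjugation\<close>

lemma ip_congruence:
  assumes "A \<in> carrier_mat d d" "B \<in> carrier_mat d d" "P \<in> carrier_mat d d" "Q \<in> carrier_mat d d"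
  shows "ip d (P * A * Q) B = ip d A (transpose_mat P * B * transpose_mat Q)"
proof -
  have "ip d (P * A * Q) B = ip d (P * A) (B * transpose_mat Q)" using assms by (intro ip_mult_right) auto
  also have "\<dots> = ip d A (transpose_mat P * (B * transpose_mat Q))" using assms by (intro ip_mult_left) auto
  finally show ?thesis using assms by (subst assoc_mult_mat[of _ d d _ d _ d]) auto
qed

text \<open>For \<open>E = K * K\<close> the inner product is the squared norm of
  \<open>K * A * K\<close>; the general case is a limit of this one.\<close>

lemma ip_psd_both_nonneg:
  assumes E: "psd_mat d E" and A: "A \<in> carrier_mat d d"
  shows "0 \<le> ip d A (E * A * E)"
proof -
  note c = psd_matD(1,2)[OF E]
  define b where "b = ip d A (E * A) + ip d A (A * E)"
  \<comment> \<open>\<open>psd_sqrt_exists\<close> needs a coercive matrix, hence the perturbation \<open>E + t I\<close>.\<close>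
  have "0 \<le> ip d A (E * A * E) + b * t + ip d A A * t\<^sup>2" if t: "0 < t" for t
  proof -
    define F where "F = E + t \<cdot>\<^sub>m 1\<^sub>m d"
    have F: "F \<in> carrier_mat d d" using c by (auto simp: F_def)
    have quad: "v \<bullet> (F *\<^sub>v v) = v \<bullet> (E *\<^sub>v v) + t * (v \<bullet> v)" if v: "v \<in> carrier_vec d" for v
      unfolding F_def using c v
      by (simp add: add_mult_distrib_mat_vec[of _ d d] smult_mat_mult_vec[of _ d d] scalar_prod_add_distrib[of _ d])
    have "psd_mat d F"
      unfolding psd_mat_def symmetric_mat_def
    proof (intro conjI ballI F)
      have "transpose_mat (t \<cdot>\<^sub>m 1\<^sub>m d) = t \<cdot>\<^sub>m 1\<^sub>m d" by (intro eq_matI) auto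
      then show "transpose_mat F = F" unfolding F_def using c by (simp add: transpose_add[of _ d d])
      fix v :: "real vec" assume v: "v \<in> carrier_vec d"
      show "0 \<le> v \<bullet> (F *\<^sub>v v)"
        unfolding quad[OF v] using psd_matD(3)[OF E v] scalar_prod_self_nonneg[of v] t by simp
    qed
    moreover have "t * (v \<bullet> v) \<le> v \<bullet> (F *\<^sub>v v)" if "v \<in> carrier_vec d" for v
      unfolding quad[OF that] using psd_matD(3)[OF E that] by simp
    ultimately obtain K where K: "psd_mat d K" "K * K = F" using psd_sqrt_exists[OF _ t] by blast
    note k = psd_matD(1,2)[OF K(1)]
    have "ip d A (F * A * F) = ip d A (K * (K * A * K) * K)"
      unfolding K(2)[symmetric] using k A by (simp add: assoc_mult_mat[of _ d d _ d _ d])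
    also have "\<dots> = ip d (K * A * K) (K * A * K)" using ip_congruence[of A d "K * A * K" K K] k A by simp
    finally have "0 \<le> ip d A (F * A * F)" by (simp add: ip_self_nonneg)
    also have "F * A = E * A + t \<cdot>\<^sub>m A"
      unfolding F_def using c A by (simp add: add_mult_distrib_mat[of _ d d] mult_smult_assoc_mat[of _ d d])
    also have "(E * A + t \<cdot>\<^sub>m A) * F = E * A * E + t \<cdot>\<^sub>m (A * E) + t \<cdot>\<^sub>m (E * A + t \<cdot>\<^sub>m A)"
      unfolding F_def using c A
      by (simp add: add_mult_distrib_mat[of _ d d] mult_add_distrib_mat[of _ d d] mult_smult_assoc_mat[of _ d d _ d]
          mult_smult_distrib[of _ d d _ d])
    also have "ip d A \<dots> = ip d A (E * A * E) + b * t + ip d A A * t\<^sup>2"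
      using c A by (simp add: ip_add_right ip_smult_right b_def power2_eq_square algebra_simps)
    finally show ?thesis .
  qed
  then have ev: "\<forall>\<^sub>F t in at_right 0. 0 \<le> ip d A (E * A * E) + b * t + ip d A A * t\<^sup>2"
    by (auto simp: eventually_at_right_field intro!: exI[of _ 1])
  have "((\<lambda>t. ip d A (E * A * E) + b * t + ip d A A * t\<^sup>2) \<longlongrightarrow> ip d A (E * A * E) + b * 0 + ip d A A * 0\<^sup>2) (at_right 0)"
    by (intro tendsto_intros)
  from tendsto_lowerbound[OF this ev] show ?thesis by simp
qed

text \<open>Kronecker squares are monotone. In the expansion of the right-hand side the mixed terms
  become forms of \<open>E\<close> at \<open>A * R\<close> and \<open>R * A\<close> after moving one
  factor \<open>R\<close> across, and the term with two \<open>E\<close> is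
  \<open>ip_psd_both_nonneg\<close>. This transfers a matrix inequality to the yardsticks.\<close>

lemma ip_conjugation_mono:
  assumes S: "psd_mat d S" and E: "psd_mat d E" and A: "A \<in> carrier_mat d d"
    and R: "R \<in> carrier_mat d d" "transpose_mat R = R" "R * R = S"
  shows "ip d A (S * A * S) \<le> ip d A ((S + E) * A * (S + E))"
proof -
  note s = psd_matD(1,2)[OF S] and e = psd_matD(1,2)[OF E]
  have "(S + E) * A * (S + E) = (S * A * S + E * A * S) + (S * A * E + E * A * E)"
    using s e A by (simp add: add_mult_distrib_mat[of _ d d] mult_add_distrib_mat[of _ d d])
  then have "ip d A ((S + E) * A * (S + E)) =
      ip d A (S * A * S) + ip d A (E * A * S) + (ip d A (S * A * E) + ip d A (E * A * E))"
    using s e A by (simp add: ip_add_right)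
  moreover have "0 \<le> ip d A (E * A * S)"
  proof -
    have "E * A * S = (E * (A * R)) * R" using R e A by (simp add: R(3)[symmetric] assoc_mult_mat[of _ d d _ d _ d])
    then have "ip d A (E * A * S) = ip d (A * R) (E * (A * R))"
      using ip_mult_right[of A d R "E * (A * R)"] R e A by simp
    then show ?thesis using ip_psd_left_nonneg[OF E, of "A * R"] A R by simp
  qed
  moreover have "0 \<le> ip d A (S * A * E)"
  proof -
    have "S * A * E = R * ((R * A) * E)" using R e A by (simp add: R(3)[symmetric] assoc_mult_mat[of _ d d _ d _ d])
    then have "ip d A (S * A * E) = ip d (R * A) ((R * A) * E)"
      using ip_mult_left[of A d R "(R * A) * E"] R e A by simp
    then show ?thesis using ip_psd_right_nonneg[OF E, of "R * A"] A R by simp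
  qed
  moreover have "0 \<le> ip d A (E * A * E)" by (rule ip_psd_both_nonneg[OF E A])
  ultimately show ?thesis by simp
qed

text \<open>Rank-one directions turn Frobenius inner products into values of quadratic
  forms.\<close>

definition outer_mat :: "nat \<Rightarrow> real vec \<Rightarrow> real mat" where
  "outer_mat d v = mat d d (\<lambda>(i, j). v $ i * v $ j)"

lemma ip_outer_mat:
  assumes "v \<in> carrier_vec d" "Y \<in> carrier_mat d d"
  shows "ip d (outer_mat d v) Y = v \<bullet> (Y *\<^sub>v v)"
  unfolding ip_def outer_mat_def using assms
  by (auto simp: scalar_prod_def mult_mat_vec_def sum_distrib_left atLeast0LessThan mult_ac intro!: sum.cong)

lemma conjugate_outer_mat:
  assumes "v \<in> carrier_vec d" "R \<in> carrier_mat d d" "transpose_mat R = R"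
  shows "R * outer_mat d v * R = outer_mat d (R *\<^sub>v v)"
proof (rule eq_matI)
  fix i j assume "i < dim_row (outer_mat d (R *\<^sub>v v))" "j < dim_col (outer_mat d (R *\<^sub>v v))"
  then have ij: "i < d" "j < d" by (simp_all add: outer_mat_def)
  have o: "outer_mat d v \<in> carrier_mat d d" by (simp add: outer_mat_def)
  have sym: "R $$ (l, j) = R $$ (j, l)" if "l < d" for l
    using assms(2,3) index_transpose_mat(1)[of l R j] that ij by simp
  have Rv: "(R *\<^sub>v v) $ i = (\<Sum>l<d. R $$ (i, l) * v $ l)" if "i < d" for i
    using assms that by (simp add: scalar_prod_def atLeast0LessThan)
  have Ro: "(R * outer_mat d v) $$ (i, l) = (R *\<^sub>v v) $ i * v $ l" if "l < d" for l
  proof -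
    have "(R * outer_mat d v) $$ (i, l) = (\<Sum>k<d. R $$ (i, k) * outer_mat d v $$ (k, l))"
      by (rule index_mult_sum) (use ij that assms(2) o in auto)
    also have "\<dots> = (R *\<^sub>v v) $ i * v $ l"
      unfolding Rv[OF ij(1)] sum_distrib_right using that by (intro sum.cong) (auto simp: outer_mat_def)
    finally show ?thesis .
  qed
  have "(R * outer_mat d v * R) $$ (i, j) = (\<Sum>l<d. (R *\<^sub>v v) $ i * v $ l * R $$ (j, l))"
  proof -
    have "(R * outer_mat d v * R) $$ (i, j) = (\<Sum>l<d. (R * outer_mat d v) $$ (i, l) * R $$ (l, j))"
      using ij assms(2) o by (intro index_mult_sum) auto
    then show ?thesis using Ro sym by simp
  qed
  also have "\<dots> = (R *\<^sub>v v) $ i * (R *\<^sub>v v) $ j"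
    unfolding Rv[OF ij(2)] sum_distrib_left by (intro sum.cong) auto
  finally show "(R * outer_mat d v * R) $$ (i, j) = outer_mat d (R *\<^sub>v v) $$ (i, j)"
    using ij by (simp add: outer_mat_def)
qed (use assms(2) in \<open>simp_all add: outer_mat_def\<close>)

section \<open>Weights that lose more outliers than inliers\<close>

lemma Cauchy_Schwarz_weighted:
  fixes w u :: "'i \<Rightarrow> real"
  assumes "\<And>i. i \<in> I \<Longrightarrow> 0 \<le> w i"
  shows "\<bar>\<Sum>i\<in>I. w i * u i\<bar> \<le> sqrt (\<Sum>i\<in>I. w i) * sqrt (\<Sum>i\<in>I. w i * (u i)\<^sup>2)"
proof -
  have "(\<Sum>i\<in>I. w i * u i) = (\<Sum>i\<in>I. sqrt (w i) * (sqrt (w i) * u i))"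
    using assms by (intro sum.cong) (auto simp: mult.assoc[symmetric])
  then have "(\<Sum>i\<in>I. w i * u i)\<^sup>2 \<le> (\<Sum>i\<in>I. (sqrt (w i))\<^sup>2) * (\<Sum>i\<in>I. (sqrt (w i) * u i)\<^sup>2)"
    using Cauchy_Schwarz_ineq_sum[of "\<lambda>i. sqrt (w i)" "\<lambda>i. sqrt (w i) * u i" I] by simp
  also have "\<dots> = (\<Sum>i\<in>I. w i) * (\<Sum>i\<in>I. w i * (u i)\<^sup>2)"
    using assms by (intro arg_cong2[where f = "(*)"] sum.cong) (auto simp: power_mult_distrib)
  finally have "sqrt ((\<Sum>i\<in>I. w i * u i)\<^sup>2) \<le> sqrt ((\<Sum>i\<in>I. w i) * (\<Sum>i\<in>I. w i * (u i)\<^sup>2))"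
    by (rule real_sqrt_le_mono)
  then show ?thesis by (simp add: real_sqrt_mult)
qed

text \<open>\<open>G1\<close> indexes the samples that behaved well before the corruption, \<open>G\<close> those among them that the adversary left
  unchanged. The moment bounds are only available on \<open>G1\<close>.\<close>
locale weighting =
  fixes N :: nat and G1 G :: "nat set" and w :: "nat \<Rightarrow> real" and \<epsilon> :: real
  assumes G1: "G1 \<subseteq> {..<N}" and G: "G \<subseteq> G1" and N: "0 < N"
    and bad: "real (card ({..<N} - G)) \<le> 2 * \<epsilon> * N"
    and eps: "0 < \<epsilon>" "\<epsilon> \<le> 1 / 1600"
    and w: "s < N \<Longrightarrow> 0 \<le> w s" "s < N \<Longrightarrow> w s \<le> 1"
    and loss: "(\<Sum>s\<in>G. 1 - w s) \<le> (\<Sum>s\<in>{..<N} - G. 1 - w s)"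
begin

lemma GN: "G \<subseteq> {..<N}" and finG: "finite G" "finite G1"
  using G1 G by (auto intro: finite_subset)

lemma sum_split: "(\<Sum>s<N. f s) = (\<Sum>s\<in>G. f s) + (\<Sum>s\<in>{..<N} - G. f s)" for f :: "nat \<Rightarrow> real"
  using GN by (simp add: sum.subset_diff[of G "{..<N}"] add.commute)

lemma good_loss: "(\<Sum>s\<in>G. 1 - w s) \<le> 2 * \<epsilon> * N"
proof -
  have "(\<Sum>s\<in>{..<N} - G. 1 - w s) \<le> (\<Sum>s\<in>{..<N} - G. 1)"
    using w by (intro sum_mono) auto
  then show ?thesis using loss bad by simp
qed

lemma bad_weight: "(\<Sum>s\<in>{..<N} - G. w s) \<le> 2 * \<epsilon> * N"
proof -
  have "(\<Sum>s\<in>{..<N} - G. w s) \<le> (\<Sum>s\<in>{..<N} - G. 1)"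
    using w by (intro sum_mono) auto
  then show ?thesis using bad by simp
qed

text \<open>\<open>G\<close> misses at most \<open>2 \<epsilon> N\<close> samples, and its members
  have lost at most \<open>2 \<epsilon> N\<close> of weight.\<close>

lemma good_weight: "(1 - 4 * \<epsilon>) * N \<le> (\<Sum>s\<in>G. w s)"
proof -
  have "real N = card G + card ({..<N} - G)"
    using card_Diff_subset[OF finG(1) GN] card_mono[OF _ GN] by simp
  then have "real (card G) \<ge> N - 2 * \<epsilon> * N" using bad by linarith
  moreover have "(\<Sum>s\<in>G. w s) = card G - (\<Sum>s\<in>G. 1 - w s)" by (simp add: sum_subtractf)
  ultimately show ?thesis using good_loss by (simp add: algebra_simps)
qed

lemma total_weight: "real N / 2 \<le> (\<Sum>s\<in>G. w s)" "(\<Sum>s\<in>G. w s) \<le> wsum N w" "wsum N w \<le> N"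
proof -
  have "\<epsilon> * N \<le> 1 / 1600 * N" using eps by (intro mult_right_mono) auto
  then show "real N / 2 \<le> (\<Sum>s\<in>G. w s)" using good_weight by (simp add: algebra_simps)
  have "0 \<le> (\<Sum>s\<in>{..<N} - G. w s)" using w by (intro sum_nonneg) auto
  then show "(\<Sum>s\<in>G. w s) \<le> wsum N w" by (simp add: wsum_def sum_split[of w])
  have "wsum N w \<le> (\<Sum>s<N. 1)" unfolding wsum_def using w by (intro sum_mono) auto
  then show "wsum N w \<le> N" by simp
qed

lemma total_weight_pos: "0 < wsum N w"
  using total_weight(1,2) N by simp

text \<open>The weighted sum over \<open>G\<close> is the full sum over \<open>G1\<close>, where the
  moment bounds apply, minus \<open>l * u\<close>, with \<open>l\<close> the corrupted or removed
  share of each sample. The shares add up to at most \<open>4 \<epsilon> N\<close>, so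
  Cauchy-Schwarz gives the factor \<open>sqrt 8 \<le> 3\<close>; the 2 of \<open>lin\<close>
  completes 5.\<close>

lemma good_sum:
  fixes u :: "nat \<Rightarrow> real" and \<kappa> :: real
  assumes \<kappa>: "0 \<le> \<kappa>" and sq: "(\<Sum>s\<in>G1. (u s)\<^sup>2) \<le> 2 * real N * \<kappa>\<^sup>2"
    and lin: "\<bar>\<Sum>s\<in>G1. u s\<bar> \<le> 2 * sqrt \<epsilon> * N * \<kappa>"
  shows "\<bar>\<Sum>s\<in>G. w s * u s\<bar> \<le> 5 * sqrt \<epsilon> * N * \<kappa>"
proof -
  define l where "l = (\<lambda>s. if s \<in> G then 1 - w s else 1)"
  have l: "0 \<le> l s" "l s \<le> 1" if "s \<in> G1" for s
    using that w G1 by (auto simp: l_def)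
  have split1: "(\<Sum>s\<in>G1. f s) = (\<Sum>s\<in>G. f s) + (\<Sum>s\<in>G1 - G. f s)" for f :: "nat \<Rightarrow> real"
    using G finG by (simp add: sum.subset_diff[of G G1] add.commute)
  have eq: "(\<Sum>s\<in>G. w s * u s) = (\<Sum>s\<in>G1. u s) - (\<Sum>s\<in>G1. l s * u s)"
    unfolding split1 by (simp add: l_def algebra_simps sum_subtractf)
  have "(\<Sum>s\<in>G1. l s) = (\<Sum>s\<in>G. 1 - w s) + card (G1 - G)"
    unfolding split1 by (simp add: l_def)
  also have "real (card (G1 - G)) \<le> card ({..<N} - G)"
    using G1 by (intro of_nat_mono card_mono) auto
  finally have L: "(\<Sum>s\<in>G1. l s) \<le> 4 * \<epsilon> * N" using bad good_loss by simp
  have "\<bar>\<Sum>s\<in>G1. l s * u s\<bar> \<le> sqrt (\<Sum>s\<in>G1. l s) * sqrt (\<Sum>s\<in>G1. l s * (u s)\<^sup>2)"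
    using l by (intro Cauchy_Schwarz_weighted) auto
  also have "\<dots> \<le> sqrt (4 * \<epsilon> * N) * sqrt (2 * real N * \<kappa>\<^sup>2)"
  proof (intro mult_mono real_sqrt_le_mono L)
    have "(\<Sum>s\<in>G1. l s * (u s)\<^sup>2) \<le> (\<Sum>s\<in>G1. 1 * (u s)\<^sup>2)"
      using l by (intro sum_mono mult_right_mono) auto
    then show "(\<Sum>s\<in>G1. l s * (u s)\<^sup>2) \<le> 2 * real N * \<kappa>\<^sup>2" using sq by simp
  qed (use l eps in \<open>auto intro!: sum_nonneg\<close>)
  also have "\<dots> = sqrt ((sqrt 8 * sqrt \<epsilon> * N * \<kappa>)\<^sup>2)"
    using eps by (simp add: real_sqrt_mult[symmetric] power_mult_distrib power2_eq_square mult_ac)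
  also have "\<dots> = sqrt 8 * sqrt \<epsilon> * N * \<kappa>" using eps \<kappa> by simp
  also have "\<dots> \<le> 3 * sqrt \<epsilon> * N * \<kappa>"
    using \<kappa> eps by (intro mult_right_mono real_le_lsqrt) auto
  finally show ?thesis unfolding eq using lin by linarith
qed

text \<open>A direction is fixed. \<open>u\<close> are the deviations of the clean samples from the
  true mean, \<open>t\<close> those of the received samples, \<open>m\<close> is the error of the
  weighted mean and \<open>P\<close> the weighted variance; \<open>\<kappa>\<close> is the scale of
  the clean deviations.\<close>

context
  fixes u t :: "nat \<Rightarrow> real" and \<kappa> m P :: real
  assumes \<kappa>: "0 \<le> \<kappa>" and sq: "(\<Sum>s\<in>G1. (u s)\<^sup>2) \<le> 2 * real N * \<kappa>\<^sup>2"
    and lin: "\<bar>\<Sum>s\<in>G1. u s\<bar> \<le> 2 * sqrt \<epsilon> * N * \<kappa>"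
    and t: "\<And>s. s \<in> G \<Longrightarrow> t s = u s"
    and m: "m * wsum N w = (\<Sum>s<N. w s * t s)"
    and P: "P * wsum N w = (\<Sum>s<N. w s * (t s - m)\<^sup>2)"
begin

lemma variance_nonneg: "0 \<le> P"
proof -
  have "0 \<le> P * wsum N w" unfolding P using w by (intro sum_nonneg) auto
  then show ?thesis using total_weight_pos by (simp add: zero_le_mult_iff)
qed

text \<open>Weighted deviations from the weighted mean sum to zero, so \<open>m\<close> times the
  weight of \<open>G\<close> is a good sum plus an outlier sum. The outliers weigh at most
  \<open>2 \<epsilon> N\<close>, and Cauchy-Schwarz bounds their sum through \<open>P\<close>.
  Dividing by the good weight, which is at least \<open>N / 2\<close>, doubles the factors 5 and
  3/2.\<close>

lemma weighted_mean_bound: "\<bar>m\<bar> \<le> 10 * sqrt \<epsilon> * \<kappa> + 3 * sqrt \<epsilon> * sqrt P"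
proof -
  have "(\<Sum>s<N. w s * (t s - m)) = 0"
    using m by (simp add: algebra_simps sum_subtractf sum_distrib_left[symmetric] sum_distrib_right[symmetric] wsum_def)
  then have "(\<Sum>s\<in>G. w s * (t s - m)) + (\<Sum>s\<in>{..<N} - G. w s * (t s - m)) = 0"
    unfolding sum_split .
  moreover have "(\<Sum>s\<in>G. w s * (t s - m)) = (\<Sum>s\<in>G. w s * u s) - m * (\<Sum>s\<in>G. w s)"
    unfolding sum_distrib_left sum_subtractf[symmetric] by (intro sum.cong) (auto simp: t algebra_simps)
  ultimately have "m * (\<Sum>s\<in>G. w s) = (\<Sum>s\<in>G. w s * u s) + (\<Sum>s\<in>{..<N} - G. w s * (t s - m))"
    by simp
  moreover have "\<bar>\<Sum>s\<in>G. w s * u s\<bar> \<le> 5 * sqrt \<epsilon> * N * \<kappa>"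
    by (rule good_sum[OF \<kappa> sq lin])
  moreover have "\<bar>\<Sum>s\<in>{..<N} - G. w s * (t s - m)\<bar> \<le> 3 / 2 * sqrt \<epsilon> * N * sqrt P"
  proof -
    have "\<bar>\<Sum>s\<in>{..<N} - G. w s * (t s - m)\<bar> \<le>
        sqrt (\<Sum>s\<in>{..<N} - G. w s) * sqrt (\<Sum>s\<in>{..<N} - G. w s * (t s - m)\<^sup>2)"
      using w by (intro Cauchy_Schwarz_weighted) auto
    also have "\<dots> \<le> sqrt (2 * \<epsilon> * N) * sqrt (N * P)"
    proof (intro mult_mono real_sqrt_le_mono bad_weight)
      have "(\<Sum>s\<in>{..<N} - G. w s * (t s - m)\<^sup>2) \<le> P * wsum N w"
        unfolding P sum_split using w GN by (auto intro!: sum_nonneg)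
      also have "\<dots> \<le> P * N" using total_weight(3) variance_nonneg by (intro mult_left_mono) auto
      finally show "(\<Sum>s\<in>{..<N} - G. w s * (t s - m)\<^sup>2) \<le> N * P" by (simp add: mult.commute)
    qed (use w eps in \<open>auto intro!: sum_nonneg\<close>)
    also have "\<dots> = sqrt 2 * (sqrt \<epsilon> * N * sqrt P)"
      by (simp add: real_sqrt_mult)
    also have "\<dots> \<le> 3 / 2 * (sqrt \<epsilon> * N * sqrt P)"
      using eps variance_nonneg by (intro mult_right_mono real_le_lsqrt) (auto simp: power2_eq_square)
    finally show ?thesis by simp
  qed
  ultimately have "\<bar>m * (\<Sum>s\<in>G. w s)\<bar> \<le> 5 * sqrt \<epsilon> * N * \<kappa> + 3 / 2 * sqrt \<epsilon> * N * sqrt P"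
    by linarith
  moreover have "\<bar>m\<bar> * (N / 2) \<le> \<bar>m * (\<Sum>s\<in>G. w s)\<bar>"
    unfolding abs_mult using total_weight(1) N by (intro mult_left_mono) auto
  ultimately have "\<bar>m\<bar> * (N / 2) \<le> (10 * sqrt \<epsilon> * \<kappa> + 3 * sqrt \<epsilon> * sqrt P) * (N / 2)"
    by (simp add: algebra_simps)
  then show ?thesis using N by (subst (asm) mult_le_cancel_right) auto
qed

text \<open>Relative to the total weight, the good samples contribute at most
  \<open>33/4 * \<kappa>^2 + 9/400 * P\<close> when \<epsilon> \<le> 1/1600. The threshold 33 turns
  the first term into at most \<open>P / 4\<close>, so the sum stays below half of the
  variance.\<close>

lemma good_variance_small:
  assumes "33 * \<kappa>\<^sup>2 \<le> P"
  shows "(\<Sum>s\<in>G. w s * (t s - m)\<^sup>2) \<le> (\<Sum>s\<in>{..<N} - G. w s * (t s - m)\<^sup>2)"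
proof -
  have m2: "m\<^sup>2 \<le> 200 * \<epsilon> * \<kappa>\<^sup>2 + 18 * \<epsilon> * P"
  proof -
    have "m\<^sup>2 \<le> (10 * sqrt \<epsilon> * \<kappa> + 3 * sqrt \<epsilon> * sqrt P)\<^sup>2"
      using weighted_mean_bound by (simp add: abs_le_square_iff[symmetric])
    also have "\<dots> \<le> 2 * ((10 * sqrt \<epsilon> * \<kappa>)\<^sup>2 + (3 * sqrt \<epsilon> * sqrt P)\<^sup>2)"
      by (smt (verit, best) power2_diff power2_sum zero_le_power2)
    also have "\<dots> = 200 * \<epsilon> * \<kappa>\<^sup>2 + 18 * \<epsilon> * P"
      using eps variance_nonneg by (simp add: power_mult_distrib)
    finally show ?thesis .
  qed
  have W: "0 < wsum N w" by (rule total_weight_pos)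
  have "(\<Sum>s\<in>G. w s * (t s - m)\<^sup>2) \<le> (\<Sum>s\<in>G. 2 * (u s)\<^sup>2 + 2 * m\<^sup>2 * w s)"
  proof (intro sum_mono)
    fix s assume s: "s \<in> G"
    then have ws: "0 \<le> w s" "w s \<le> 1" using w GN by auto
    have "(t s - m)\<^sup>2 \<le> 2 * (u s)\<^sup>2 + 2 * m\<^sup>2"
      using zero_le_power2[of "u s + m"] by (simp add: t[OF s] power2_eq_square algebra_simps)
    then have "w s * (t s - m)\<^sup>2 \<le> w s * (2 * (u s)\<^sup>2 + 2 * m\<^sup>2)" using ws by (intro mult_left_mono) auto
    also have "\<dots> \<le> 1 * (2 * (u s)\<^sup>2) + 2 * m\<^sup>2 * w s"
      unfolding distrib_left using ws by (intro add_mono mult_right_mono) auto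
    finally show "w s * (t s - m)\<^sup>2 \<le> 2 * (u s)\<^sup>2 + 2 * m\<^sup>2 * w s" by simp
  qed
  also have "\<dots> = 2 * (\<Sum>s\<in>G. (u s)\<^sup>2) + 2 * m\<^sup>2 * (\<Sum>s\<in>G. w s)"
    by (simp add: sum.distrib sum_distrib_left)
  also have "\<dots> \<le> 2 * (2 * real N * \<kappa>\<^sup>2) + 2 * m\<^sup>2 * wsum N w"
  proof (intro add_mono mult_left_mono)
    show "(\<Sum>s\<in>G. (u s)\<^sup>2) \<le> 2 * real N * \<kappa>\<^sup>2"
      using sq sum_mono2[OF finG(2) G, of "\<lambda>s. (u s)\<^sup>2"] by simp
  qed (use total_weight in auto)
  also have "\<dots> \<le> 8 * \<kappa>\<^sup>2 * wsum N w + 2 * (200 * \<epsilon> * \<kappa>\<^sup>2 + 18 * \<epsilon> * P) * wsum N w"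
  proof (intro add_mono)
    have "real N \<le> 2 * wsum N w" using total_weight by linarith
    then have "4 * \<kappa>\<^sup>2 * N \<le> 4 * \<kappa>\<^sup>2 * (2 * wsum N w)" by (intro mult_left_mono) auto
    then show "2 * (2 * real N * \<kappa>\<^sup>2) \<le> 8 * \<kappa>\<^sup>2 * wsum N w" by (simp add: mult_ac)
    show "2 * m\<^sup>2 * wsum N w \<le> 2 * (200 * \<epsilon> * \<kappa>\<^sup>2 + 18 * \<epsilon> * P) * wsum N w"
      using m2 W by (intro mult_right_mono) auto
  qed
  also have "\<dots> = (8 * \<kappa>\<^sup>2 + \<epsilon> * (400 * \<kappa>\<^sup>2 + 36 * P)) * wsum N w" by (simp add: algebra_simps)
  also have "\<dots> \<le> (P / 2) * wsum N w"
  proof (rule mult_right_mono)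
    have "\<epsilon> * (400 * \<kappa>\<^sup>2 + 36 * P) \<le> 1 / 1600 * (400 * \<kappa>\<^sup>2 + 36 * P)"
      using eps variance_nonneg by (intro mult_right_mono) auto
    then show "8 * \<kappa>\<^sup>2 + \<epsilon> * (400 * \<kappa>\<^sup>2 + 36 * P) \<le> P / 2"
      using assms variance_nonneg by simp
  qed (use W in simp)
  also have "\<dots> = (\<Sum>s<N. w s * (t s - m)\<^sup>2) / 2" using P by simp
  finally show ?thesis unfolding sum_split by simp
qed

end

end

text \<open>The weight removed from a sample is \<open>w s * \<tau> s / t\<close>, so comparing sums
  of \<open>w * \<tau>\<close> compares removed weights. A sample attaining the maximum
  \<open>t\<close> loses everything, which shrinks the support.\<close>

lemma reweights_properties:
  assumes r: "reweights N \<tau> w w'" and w: "\<And>s. s < N \<Longrightarrow> 0 \<le> w s \<and> w s \<le> 1" and \<tau>: "\<And>s. 0 \<le> \<tau> s"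
  shows "\<And>s. s < N \<Longrightarrow> 0 \<le> w' s \<and> w' s \<le> w s"
    and "\<And>G. G \<subseteq> {..<N} \<Longrightarrow> (\<Sum>s\<in>G. w s * \<tau> s) \<le> (\<Sum>s\<in>{..<N} - G. w s * \<tau> s) \<Longrightarrow>
      (\<Sum>s\<in>G. 1 - w s) \<le> (\<Sum>s\<in>{..<N} - G. 1 - w s) \<Longrightarrow>
      (\<Sum>s\<in>G. 1 - w' s) \<le> (\<Sum>s\<in>{..<N} - G. 1 - w' s)"
    and "\<And>s. s < N \<Longrightarrow> 0 < w s \<Longrightarrow> 0 < \<tau> s \<Longrightarrow> card {s\<in>{..<N}. 0 < w' s} < card {s\<in>{..<N}. 0 < w s}"
    and "(\<And>s. s < N \<Longrightarrow> \<tau> s = 0) \<Longrightarrow> s < N \<Longrightarrow> w' s = w s"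
proof -
  from r obtain T where T: "0 \<le> T" "\<forall>s<N. 0 < w s \<longrightarrow> \<tau> s \<le> T"
    "T = 0 \<or> (\<exists>s<N. 0 < w s \<and> \<tau> s = T)" "\<forall>s<N. w' s = w s * (1 - \<tau> s / T)"
    unfolding reweights_def by blast
  show w': "0 \<le> w' s \<and> w' s \<le> w s" if s: "s < N" for s
  proof (cases "0 < w s")
    case True
    have "0 \<le> \<tau> s / T" using \<tau> T by simp
    moreover have "\<tau> s / T \<le> 1" using T(1,2) True s \<tau>[of s] by (cases "T = 0") auto
    ultimately show ?thesis using T(4) s True by (simp add: mult_le_cancel_left1)
  next
    case False
    then show ?thesis using w[OF s] T(4) s by auto
  qed
  show "(\<Sum>s\<in>G. 1 - w' s) \<le> (\<Sum>s\<in>{..<N} - G. 1 - w' s)"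
    if G: "G \<subseteq> {..<N}" and 1: "(\<Sum>s\<in>G. w s * \<tau> s) \<le> (\<Sum>s\<in>{..<N} - G. w s * \<tau> s)"
      and 2: "(\<Sum>s\<in>G. 1 - w s) \<le> (\<Sum>s\<in>{..<N} - G. 1 - w s)" for G
  proof -
    have e: "(\<Sum>s\<in>H. 1 - w' s) = (\<Sum>s\<in>H. 1 - w s) + (\<Sum>s\<in>H. w s * \<tau> s) / T" if "H \<subseteq> {..<N}" for H
      unfolding sum_divide_distrib sum.distrib[symmetric]
      using that T(4) by (intro sum.cong) (auto simp: algebra_simps)
    show ?thesis unfolding e[OF G] e[OF Diff_subset] using 1 2 T(1) by (intro add_mono divide_right_mono)
  qed
  show "card {s\<in>{..<N}. 0 < w' s} < card {s\<in>{..<N}. 0 < w s}" if s: "s < N" "0 < w s" "0 < \<tau> s" for s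
  proof -
    have "T \<noteq> 0" using T(2) s by fastforce
    then obtain s' where s': "s' < N" "0 < w s'" "\<tau> s' = T" using T(3) by blast
    then have "w' s' = 0" using T(4) \<open>T \<noteq> 0\<close> by simp
    then have "s' \<in> {s\<in>{..<N}. 0 < w s} - {s\<in>{..<N}. 0 < w' s}" using s' by simp
    moreover have "{s\<in>{..<N}. 0 < w' s} \<subseteq> {s\<in>{..<N}. 0 < w s}" using w' by force
    ultimately show ?thesis by (intro psubset_card_mono) auto
  qed
  show "w' s = w s" if "\<And>s. s < N \<Longrightarrow> \<tau> s = 0" "s < N" for s using T(4) that by simp
qed

section \<open>Convergence and accuracy of the filter\<close>

lemma sum_flatten: "(\<Sum>a<d * d. f a) = (\<Sum>i<d. \<Sum>j<d. f (i * d + j))" for f :: "nat \<Rightarrow> real"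
proof -
  have "(\<Sum>a<d * d. f a) = (\<Sum>i<d. sum f {i * d..<i * d + d})" by (rule sum.nat_group[symmetric])
  also have "\<dots> = (\<Sum>i<d. \<Sum>j<d. f (i * d + j))"
  proof (rule sum.cong[OF refl])
    fix i
    show "sum f {i * d..<i * d + d} = (\<Sum>j<d. f (i * d + j))"
      using sum.shift_bounds_nat_ivl[of f 0 "i * d" d] by (simp add: atLeast0LessThan add.commute)
  qed
  finally show ?thesis .
qed

definition unflatten :: "nat \<Rightarrow> (nat \<Rightarrow> real) \<Rightarrow> real mat" where
  "unflatten d v = mat d d (\<lambda>(i, j). v (i * d + j))"

definition fun_mat :: "nat \<Rightarrow> (nat \<Rightarrow> nat \<Rightarrow> real) \<Rightarrow> real mat" where
  "fun_mat d Y = mat d d (\<lambda>(i, j). Y i j)"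

lemma carrier_unflatten[simp]: "unflatten d v \<in> carrier_mat d d"
  and carrier_fun_mat[simp]: "fun_mat d Y \<in> carrier_mat d d"
  by (simp_all add: unflatten_def fun_mat_def)

lemma dim_fun_mat[simp]: "dim_row (fun_mat d Y) = d" "dim_col (fun_mat d Y) = d"
  by (simp_all add: fun_mat_def)

lemma index_unflatten[simp]: "i < d \<Longrightarrow> j < d \<Longrightarrow> unflatten d v $$ (i, j) = v (i * d + j)"
  by (simp add: unflatten_def)

lemma sum_flatten_ip:
  "(\<Sum>a<d * d. v a * Y (a div d) (a mod d)) = ip d (unflatten d v) (fun_mat d Y)"
  unfolding sum_flatten ip_def by (intro sum.cong) (auto simp: unflatten_def fun_mat_def)

lemma unflatten_surj:
  assumes "A \<in> carrier_mat d d"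
  shows "unflatten d (\<lambda>a. A $$ (a div d, a mod d)) = A"
  using assms by (intro eq_matI) (auto simp: unflatten_def)

lemma bil_mean_part:
  fixes M :: "nat \<Rightarrow> nat \<Rightarrow> real"
  assumes "\<And>i j. i < d \<Longrightarrow> j < d \<Longrightarrow> M i j = M j i"
  shows "(\<Sum>a<d * d. \<Sum>b<d * d. v a * (M (a div d) (b div d) * M (a mod d) (b mod d)) * v b) =
    ip d (unflatten d v) (fun_mat d M * unflatten d v * fun_mat d M)"
proof -
  let ?A = "unflatten d v" and ?M = "fun_mat d M"
  note [simp] = mult_carrier_mat[of _ d d _ d]
  have entry: "(?M * ?A * ?M) $$ (i, j) = (\<Sum>k<d. \<Sum>l<d. M i k * v (k * d + l) * M j l)" if "i < d" "j < d" for i j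
  proof -
    have "(?M * ?A * ?M) $$ (i, j) = (\<Sum>l<d. (?M * ?A) $$ (i, l) * ?M $$ (l, j))"
      by (rule index_mult_sum) (use that in auto)
    also have "\<dots> = (\<Sum>l<d. (\<Sum>k<d. M i k * v (k * d + l)) * M j l)"
    proof (intro sum.cong refl)
      fix l assume l: "l \<in> {..<d}"
      have "(?M * ?A) $$ (i, l) = (\<Sum>k<d. ?M $$ (i, k) * ?A $$ (k, l))"
        by (rule index_mult_sum) (use that l in auto)
      then show "(?M * ?A) $$ (i, l) * ?M $$ (l, j) = (\<Sum>k<d. M i k * v (k * d + l)) * M j l"
        using that l assms[of l j] by (simp add: fun_mat_def unflatten_def)
    qed
    also have "\<dots> = (\<Sum>k<d. \<Sum>l<d. M i k * v (k * d + l) * M j l)"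
      unfolding sum_distrib_right by (rule sum.swap)
    finally show ?thesis .
  qed
  have "(\<Sum>a<d * d. \<Sum>b<d * d. v a * (M (a div d) (b div d) * M (a mod d) (b mod d)) * v b) =
      (\<Sum>i<d. \<Sum>j<d. \<Sum>k<d. \<Sum>l<d. v (i * d + j) * (M i k * M j l) * v (k * d + l))"
    unfolding sum_flatten by (intro sum.cong refl) auto
  also have "\<dots> = ip d ?A (?M * ?A * ?M)"
    unfolding ip_def
    by (intro sum.cong refl) (simp add: entry sum_distrib_left mult_ac del: index_mult_mat(1))
  finally show ?thesis .
qed

lemma wmean_symmetric: "(\<And>s. s < N \<Longrightarrow> Y s i j = Y s j i) \<Longrightarrow> wmean N Y w i j = wmean N Y w j i"
  unfolding wmean_def by (intro sum.cong) auto

lemma fun_mat_wmean: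
  "ip d A (fun_mat d (wmean N Y w)) * wsum N w = (\<Sum>s<N. w s * ip d A (fun_mat d (Y s)))" if "wsum N w \<noteq> 0"
proof -
  have e: "wmean N Y w i j * wsum N w = (\<Sum>s<N. w s * Y s i j)" for i j
    using that by (simp add: wmean_def sum_distrib_right)
  have "ip d A (fun_mat d (wmean N Y w)) * wsum N w = (\<Sum>i<d. \<Sum>j<d. A $$ (i, j) * (wmean N Y w i j * wsum N w))"
    unfolding ip_def sum_distrib_right by (intro sum.cong) (auto simp: fun_mat_def)
  also have "\<dots> = (\<Sum>i<d. \<Sum>j<d. \<Sum>s<N. w s * (A $$ (i, j) * Y s i j))"
    unfolding e sum_distrib_left by (intro sum.cong) auto
  also have "\<dots> = (\<Sum>i<d. \<Sum>s<N. \<Sum>j<d. w s * (A $$ (i, j) * Y s i j))"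
    by (intro sum.cong refl sum.swap)
  also have "\<dots> = (\<Sum>s<N. \<Sum>i<d. \<Sum>j<d. w s * (A $$ (i, j) * Y s i j))" by (rule sum.swap)
  also have "\<dots> = (\<Sum>s<N. w s * ip d A (fun_mat d (Y s)))"
    unfolding ip_def sum_distrib_left by (intro sum.cong) (auto simp: fun_mat_def)
  finally show ?thesis .
qed

text \<open>The dictionary between the flattened coefficients in the program and the matrix
  quantities of the analysis: yardstick, weighted variance and single deviations.\<close>

lemma bil_wform:
  fixes d N Y w v lam
  assumes Y: "\<And>s i j. s < N \<Longrightarrow> i < d \<Longrightarrow> j < d \<Longrightarrow> Y s i j = Y s j i"
  defines "M \<equiv> fun_mat d (wmean N Y w)" and "A \<equiv> unflatten d v"
  shows "bil (wform lam d N Y w) (d * d) v v = lam * ip d A (M * A * M) -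
    (\<Sum>s<N. w s * (ip d A (fun_mat d (Y s)) - ip d A M)\<^sup>2) / wsum N w"
    and "(\<Sum>a<d * d. v a * wdev d N Y w s a) = ip d A (fun_mat d (Y s)) - ip d A M"
proof -
  have sym: "wmean N Y w i j = wmean N Y w j i" if "i < d" "j < d" for i j
    by (rule wmean_symmetric) (use Y that in auto)
  show dev: "(\<Sum>a<d * d. v a * wdev d N Y w s a) = ip d A (fun_mat d (Y s)) - ip d A M" for s
    unfolding wdev_def right_diff_distrib sum_subtractf sum_flatten_ip A_def M_def ..
  let ?Z = "\<lambda>s a. wdev d N Y w s a"
  have "bil (wform lam d N Y w) (d * d) v v =
     lam * (\<Sum>a<d * d. \<Sum>b<d * d. v a * (wmean N Y w (a div d) (b div d) * wmean N Y w (a mod d) (b mod d)) * v b) -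
     (\<Sum>a<d * d. \<Sum>b<d * d. \<Sum>s<N. (w s / wsum N w) * ((v a * ?Z s a) * (v b * ?Z s b)))"
    unfolding bil_def wform_def sum_distrib_left sum_subtractf[symmetric]
    by (intro sum.cong refl) (simp add: algebra_simps sum_distrib_left)
  also have "(\<Sum>a<d * d. \<Sum>b<d * d. \<Sum>s<N. (w s / wsum N w) * ((v a * ?Z s a) * (v b * ?Z s b))) =
      (\<Sum>a<d * d. \<Sum>s<N. \<Sum>b<d * d. (w s / wsum N w) * ((v a * ?Z s a) * (v b * ?Z s b)))"
    by (intro sum.cong refl sum.swap)
  also have "\<dots> = (\<Sum>s<N. \<Sum>a<d * d. \<Sum>b<d * d. (w s / wsum N w) * ((v a * ?Z s a) * (v b * ?Z s b)))"
    by (rule sum.swap)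
  also have "\<dots> = (\<Sum>s<N. (w s / wsum N w) * (\<Sum>a<d * d. v a * ?Z s a)\<^sup>2)"
    by (simp only: power2_eq_square sum_product) (simp only: sum_distrib_left)
  also have "\<dots> = (\<Sum>s<N. w s * (ip d A (fun_mat d (Y s)) - ip d A M)\<^sup>2) / wsum N w"
    unfolding dev sum_divide_distrib by (intro sum.cong) auto
  also have "(\<Sum>a<d * d. \<Sum>b<d * d. v a * (wmean N Y w (a div d) (b div d) * wmean N Y w (a mod d) (b mod d)) * v b) =
      ip d A (M * A * M)"
    unfolding A_def M_def by (rule bil_mean_part) (rule sym)
  finally show "bil (wform lam d N Y w) (d * d) v v = lam * ip d A (M * A * M) -
    (\<Sum>s<N. w s * (ip d A (fun_mat d (Y s)) - ip d A M)\<^sup>2) / wsum N w" .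
qed

lemma wform_symmetric:
  assumes Y: "\<And>s i j. s < N \<Longrightarrow> i < d \<Longrightarrow> j < d \<Longrightarrow> Y s i j = Y s j i" and "a < d * d" "b < d * d"
  shows "wform lam d N Y w a b = wform lam d N Y w b a"
proof -
  have sym: "wmean N Y w i j = wmean N Y w j i" if "i < d" "j < d" for i j
    by (rule wmean_symmetric) (use Y that in auto)
  have "a div d < d" "a mod d < d" "b div d < d" "b mod d < d"
    using assms(2,3) by (auto simp: less_mult_imp_div_less intro!: mod_less_divisor gr0I)
  then show ?thesis unfolding wform_def
    using sym[of "a div d" "b div d"] sym[of "a mod d" "b mod d"] by (simp add: mult_ac)
qed

lemma ip_outer_self:
  assumes u: "u \<in> carrier_vec d"
  shows "ip d (outer_mat d u) (outer_mat d u) = (u \<bullet> u)\<^sup>2"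
proof -
  have "u \<bullet> u = (\<Sum>i<d. u $ i * u $ i)" using u by (simp add: scalar_prod_def atLeast0LessThan)
  note e = this
  have "ip d (outer_mat d u) (outer_mat d u) = (\<Sum>i<d. \<Sum>j<d. (u $ i * u $ i) * (u $ j * u $ j))"
    unfolding ip_def outer_mat_def by (intro sum.cong) (auto simp: mult_ac)
  also have "\<dots> = (u \<bullet> u)\<^sup>2" by (simp only: e power2_eq_square sum_product)
  finally show ?thesis .
qed

text \<open>All randomness is spent. \<open>x\<close> are the clean samples, \<open>Y\<close> the
  received symmetrised ones; \<open>second\<close> and \<open>first\<close> are moment bounds for a
  direction \<open>A\<close>, measured by the norm of \<open>R * A * R\<close>. The factor 2 in
  \<open>bad\<close> adds truncation and corruption.\<close>

locale contaminated_sample =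
  fixes d N :: nat and S R Wi :: "real mat" and V \<epsilon> :: real and Y :: "nat \<Rightarrow> nat \<Rightarrow> nat \<Rightarrow> real"
    and G1 G :: "nat set" and x :: "nat \<Rightarrow> real mat"
  assumes S: "psd_mat d S" and R: "R \<in> carrier_mat d d" "transpose_mat R = R" "R * R = S"
    and Wi: "Wi \<in> carrier_mat d d" "transpose_mat Wi = Wi" "R * Wi = 1\<^sub>m d" "Wi * R = 1\<^sub>m d"
    and V: "0 < V" and eps: "0 < \<epsilon>" "\<epsilon> \<le> 1 / 1600" and Veps: "V * \<epsilon> \<le> 1 / 400"
    and N: "0 < N" and G1: "G1 \<subseteq> {..<N}" and G: "G \<subseteq> G1" and bad: "real (card ({..<N} - G)) \<le> 2 * \<epsilon> * real N"
    and x: "\<And>s. s \<in> G1 \<Longrightarrow> x s \<in> carrier_mat d d"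
    and xY: "\<And>s i j. s \<in> G \<Longrightarrow> i < d \<Longrightarrow> j < d \<Longrightarrow> Y s i j = x s $$ (i, j)"
    and Y: "\<And>s i j. s < N \<Longrightarrow> i < d \<Longrightarrow> j < d \<Longrightarrow> Y s i j = Y s j i"
    and second: "\<And>A. A \<in> carrier_mat d d \<Longrightarrow>
      (\<Sum>s\<in>G1. (ip d A (x s - S))\<^sup>2) \<le> 2 * real N * (V * ip d (R * A * R) (R * A * R))"
    and first: "\<And>A. A \<in> carrier_mat d d \<Longrightarrow>
      \<bar>\<Sum>s\<in>G1. ip d A (x s - S)\<bar> \<le> 2 * sqrt \<epsilon> * real N * sqrt (V * ip d (R * A * R) (R * A * R))"
begin

text \<open>The invariant of the filter. Tying positive weight to semidefiniteness is what bounds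
  the weighted mean from below.\<close>

definition admissible :: "(nat \<Rightarrow> real) \<Rightarrow> bool" where
  "admissible w \<longleftrightarrow> (\<forall>s<N. 0 \<le> w s \<and> w s \<le> 1 \<and> (0 < w s \<longrightarrow> (\<forall>v. 0 \<le> bil (Y s) d v v))) \<and>
    (\<Sum>s\<in>G. 1 - w s) \<le> (\<Sum>s\<in>{..<N} - G. 1 - w s)"

abbreviation "mean_mat w \<equiv> fun_mat d (wmean N Y w)"

definition spread :: "(nat \<Rightarrow> real) \<Rightarrow> real mat \<Rightarrow> real" where
  "spread w A = (\<Sum>s<N. w s * (ip d A (fun_mat d (Y s)) - ip d A (mean_mat w))\<^sup>2) / wsum N w"

definition scale :: "(nat \<Rightarrow> real) \<Rightarrow> real mat \<Rightarrow> real" where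
  "scale w A = ip d A (mean_mat w * A * mean_mat w)"

definition stable :: "real \<Rightarrow> (nat \<Rightarrow> real) \<Rightarrow> bool" where
  "stable lam w \<longleftrightarrow> (\<forall>A\<in>carrier_mat d d. spread w A \<le> lam * scale w A)"

text \<open>What the program tests. It implies \<open>stable\<close> and also decides whether a
  round changes the weights.\<close>

definition settled :: "real \<Rightarrow> (nat \<Rightarrow> real) \<Rightarrow> bool" where
  "settled lam w \<longleftrightarrow> (\<forall>k<d * d. 0 < gs_pivot (wform lam d N Y w) (d * d) k)"

section \<open>Mean and variance under admissible weights\<close>

lemma weighting: "admissible w \<Longrightarrow> weighting N G1 G w \<epsilon>"
  by unfold_locales (use G1 G N bad eps in \<open>auto simp: admissible_def\<close>)

lemma Sc: "S \<in> carrier_mat d d" by (rule psd_matD(1)[OF S])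

lemma norm_nonneg: "0 \<le> V * ip d A A"
  using V ip_self_nonneg[of d A] by simp

lemma second': "A \<in> carrier_mat d d \<Longrightarrow>
    (\<Sum>s\<in>G1. (ip d A (x s - S))\<^sup>2) \<le> 2 * real N * (sqrt (V * ip d (R * A * R) (R * A * R)))\<^sup>2"
  using second[of A] norm_nonneg[of "R * A * R"] by simp

lemma good_deviation:
  assumes "s \<in> G" "A \<in> carrier_mat d d"
  shows "ip d A (fun_mat d (Y s)) - ip d A S = ip d A (x s - S)"
proof -
  have xs: "x s \<in> carrier_mat d d" using x G assms by auto
  then have "fun_mat d (Y s) = x s"
    using xY[OF assms(1)] by (intro eq_matI) (auto simp: fun_mat_def)
  then show ?thesis using Sc xs assms by (simp add: ip_minus_right)
qed

lemma bil_outer: "bil (Y s) d (\<lambda>i. v $ i) (\<lambda>i. v $ i) = ip d (outer_mat d v) (fun_mat d (Y s))"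
  unfolding bil_def ip_def by (intro sum.cong) (auto simp: outer_mat_def fun_mat_def)

text \<open>Dropping the outliers only lowers \<open>v . M v\<close>, as they are semidefinite
  wherever their weight is positive. With \<open>q = v . S v\<close>, the remaining weighted sum is
  at least \<open>(3/4 - 1/4) N q\<close>; the total weight is at most \<open>N\<close>, so
  \<open>v . M v\<close> is at least \<open>q / 2\<close>.\<close>

lemma mean_lower_bound:
  assumes adm: "admissible w"
  shows "psd_mat d (2 \<cdot>\<^sub>m mean_mat w - S)"
  unfolding psd_mat_def symmetric_mat_def
proof (intro conjI ballI)
  interpret weighting N G1 G w \<epsilon> by (rule weighting[OF adm])
  show c: "2 \<cdot>\<^sub>m mean_mat w - S \<in> carrier_mat d d" using Sc by auto
  have "S $$ (j, i) = S $$ (i, j)" if "i < d" "j < d" for i j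
    using index_transpose_mat(1)[of i S j] psd_matD(2)[OF S] Sc that by simp
  moreover have "wmean N Y w i j = wmean N Y w j i" if "i < d" "j < d" for i j
    by (rule wmean_symmetric) (use Y that in auto)
  ultimately show "transpose_mat (2 \<cdot>\<^sub>m mean_mat w - S) = 2 \<cdot>\<^sub>m mean_mat w - S"
    using Sc by (intro eq_matI) (auto simp: fun_mat_def)
  fix v :: "real vec" assume v: "v \<in> carrier_vec d"
  define A where "A = outer_mat d v"
  have A: "A \<in> carrier_mat d d" by (simp add: A_def outer_mat_def)
  define q where "q = v \<bullet> (S *\<^sub>v v)"
  have q: "0 \<le> q" "q = ip d A S"
    using psd_matD(3)[OF S v] by (simp_all add: q_def A_def ip_outer_mat[OF v Sc])
  \<comment> \<open>For \<open>A = v v^T\<close> the norm of \<open>R * A * R\<close> is exactly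
    \<open>q\<close>, so the sampling error is relative to the quantity that has to be
    bounded.\<close>
  have RA: "ip d (R * A * R) (R * A * R) = q\<^sup>2"
  proof -
    have Rv: "R *\<^sub>v v \<in> carrier_vec d" using R v by auto
    have o: "outer_mat d (R *\<^sub>v v) \<in> carrier_mat d d" by (simp add: outer_mat_def)
    have "R * A * R = outer_mat d (R *\<^sub>v v)" unfolding A_def by (rule conjugate_outer_mat[OF v R(1,2)])
    moreover have "ip d (outer_mat d (R *\<^sub>v v)) (outer_mat d (R *\<^sub>v v)) = ((R *\<^sub>v v) \<bullet> (R *\<^sub>v v))\<^sup>2"
      by (rule ip_outer_self[OF Rv])
    moreover have "(R *\<^sub>v v) \<bullet> (R *\<^sub>v v) = q"
      using symmetric_scalar_prod(1)[OF R(1,2) v Rv] assoc_mult_mat_vec[OF R(1) R(1) v] by (simp add: q_def R(3))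
    ultimately show ?thesis by simp
  qed
  have "\<bar>\<Sum>s\<in>G. w s * ip d A (x s - S)\<bar> \<le> 5 * sqrt \<epsilon> * real N * sqrt (V * q\<^sup>2)"
    using second'[OF A] first[OF A] norm_nonneg[of "R * A * R"] unfolding RA by (intro good_sum) auto
  also have "\<dots> = 5 * sqrt (V * \<epsilon>) * real N * q" using q by (simp add: real_sqrt_mult)
  also have "\<dots> \<le> 5 * (1 / 20) * real N * q"
  proof -
    \<comment> \<open>Origin of \<open>V * \<epsilon> \<le> 1 / 400\<close>: it reduces the error to
      a quarter of \<open>N * q\<close>.\<close>
    have "sqrt (V * \<epsilon>) \<le> 1 / 20" using Veps by (intro real_le_lsqrt) (auto simp: power2_eq_square)
    then show ?thesis using q by (intro mult_right_mono) auto
  qed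
  finally have dev: "- (1 / 4 * real N * q) \<le> (\<Sum>s\<in>G. w s * ip d A (x s - S))" by linarith
  have "ip d A (mean_mat w) * wsum N w = (\<Sum>s<N. w s * ip d A (fun_mat d (Y s)))"
    using total_weight_pos by (intro fun_mat_wmean) simp
  also have "\<dots> \<ge> (\<Sum>s\<in>G. w s * ip d A (fun_mat d (Y s)))"
  proof -
    have "0 \<le> w s * ip d A (fun_mat d (Y s))" if "s < N" for s
      using adm that unfolding admissible_def A_def bil_outer[symmetric]
      by (metis less_eq_real_def mult_nonneg_nonneg mult_zero_left)
    then have "0 \<le> (\<Sum>s\<in>{..<N} - G. w s * ip d A (fun_mat d (Y s)))" by (intro sum_nonneg) auto
    then show ?thesis unfolding sum_split by simp
  qed
  also have "(\<Sum>s\<in>G. w s * ip d A (fun_mat d (Y s))) = (\<Sum>s\<in>G. w s) * q + (\<Sum>s\<in>G. w s * ip d A (x s - S))"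
    unfolding sum_distrib_right sum.distrib[symmetric]
    by (intro sum.cong refl) (simp add: good_deviation[OF _ A, symmetric] q(2) algebra_simps)
  finally have "(\<Sum>s\<in>G. w s) * q - 1 / 4 * real N * q \<le> ip d A (mean_mat w) * wsum N w"
    using dev by linarith
  moreover have "3 / 4 * real N * q \<le> (\<Sum>s\<in>G. w s) * q"
  proof (rule mult_right_mono[OF _ q(1)])
    have "\<epsilon> * real N \<le> 1 / 1600 * real N" using eps by (intro mult_right_mono) auto
    then show "3 / 4 * real N \<le> (\<Sum>s\<in>G. w s)" using good_weight by (simp add: algebra_simps)
  qed
  moreover have "wsum N w * q \<le> real N * q" using total_weight(3) q by (intro mult_right_mono) auto
  ultimately have "wsum N w * q \<le> wsum N w * (2 * ip d A (mean_mat w))" by (simp add: algebra_simps)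
  then have "q \<le> 2 * ip d A (mean_mat w)" using total_weight_pos by (subst (asm) mult_le_cancel_left) auto
  then have "0 \<le> ip d A (2 \<cdot>\<^sub>m mean_mat w - S)"
    using A Sc by (simp add: ip_minus_right ip_smult_right q(2))
  then show "0 \<le> v \<bullet> ((2 \<cdot>\<^sub>m mean_mat w - S) *\<^sub>v v)"
    unfolding A_def ip_outer_mat[OF v c] .
qed

text \<open>The left-hand side is \<open>ip d A (S * A * S)\<close>, and \<open>S\<close> plus a
  semidefinite matrix is twice the weighted mean. Both outer factors are doubled, hence 4.\<close>

lemma scale_lower_bound:
  assumes adm: "admissible w" and A: "A \<in> carrier_mat d d"
  shows "ip d (R * A * R) (R * A * R) \<le> 4 * scale w A"
proof -
  let ?M = "mean_mat w"
  define E where "E = 2 \<cdot>\<^sub>m ?M - S"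
  have E: "psd_mat d E" unfolding E_def by (rule mean_lower_bound[OF adm])
  have SE: "S + E = 2 \<cdot>\<^sub>m ?M" unfolding E_def using Sc by (intro eq_matI) auto
  have "ip d (R * A * R) (R * A * R) = ip d A (R * (R * A * R) * R)"
    using ip_congruence[of A d "R * A * R" R R] R A by simp
  also have "R * (R * A * R) * R = S * A * S"
    unfolding R(3)[symmetric] using R(1) A by (simp add: assoc_mult_mat[of _ d d _ d _ d])
  also have "ip d A (S * A * S) \<le> ip d A ((S + E) * A * (S + E))"
    by (rule ip_conjugation_mono[OF S E A R])
  also have "(S + E) * A * (S + E) = 4 \<cdot>\<^sub>m (?M * A * ?M)"
  proof -
    have c: "?M * A \<in> carrier_mat d d" "?M * A * ?M \<in> carrier_mat d d" using A by auto
    have "(2 \<cdot>\<^sub>m ?M) * A * (2 \<cdot>\<^sub>m ?M) = 2 \<cdot>\<^sub>m (2 \<cdot>\<^sub>m (?M * A * ?M))"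
      using A c by (simp add: mult_smult_assoc_mat[of _ d d _ d] mult_smult_distrib[of _ d d _ d])
    also have "\<dots> = 4 \<cdot>\<^sub>m (?M * A * ?M)" by (intro eq_matI) auto
    finally show ?thesis by (simp only: SE)
  qed
  also have "ip d A \<dots> = 4 * scale w A" unfolding scale_def using A by (intro ip_smult_right) auto
  finally show ?thesis .
qed

lemma mean_deviation:
  assumes adm: "admissible w" and A: "A \<in> carrier_mat d d"
  defines "m \<equiv> ip d A (mean_mat w) - ip d A S" and "t \<equiv> (\<lambda>s. ip d A (fun_mat d (Y s)) - ip d A S)"
  shows "m * wsum N w = (\<Sum>s<N. w s * t s)" and "spread w A * wsum N w = (\<Sum>s<N. w s * (t s - m)\<^sup>2)"
proof -
  interpret weighting N G1 G w \<epsilon> by (rule weighting[OF adm])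
  have W: "wsum N w \<noteq> 0" using total_weight_pos by simp
  show "m * wsum N w = (\<Sum>s<N. w s * t s)"
    unfolding m_def t_def left_diff_distrib fun_mat_wmean[OF W]
    by (simp add: algebra_simps sum_subtractf sum_distrib_right wsum_def sum_distrib_left)
  show "spread w A * wsum N w = (\<Sum>s<N. w s * (t s - m)\<^sup>2)"
    unfolding spread_def using W by (simp add: m_def t_def)
qed

lemma deviation_bound:
  assumes adm: "admissible w" and A: "A \<in> carrier_mat d d"
  shows "\<bar>ip d A (mean_mat w) - ip d A S\<bar> \<le>
    10 * sqrt \<epsilon> * sqrt (V * ip d (R * A * R) (R * A * R)) + 3 * sqrt \<epsilon> * sqrt (spread w A)"
proof -
  interpret weighting N G1 G w \<epsilon> by (rule weighting[OF adm])
  show ?thesis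
    by (rule weighted_mean_bound[OF _ second'[OF A] first[OF A] good_deviation[OF _ A] mean_deviation[OF adm A]])
      (use norm_nonneg in auto)
qed

text \<open>The constant 132 is 33 * 4: the 33 of \<open>good_variance_small\<close> times the 4 of
  \<open>scale_lower_bound\<close>. The variance in a violated direction exceeds what the good
  samples can cause, so the outliers dominate it.\<close>

lemma violated_direction:
  assumes adm: "admissible w" and A: "A \<in> carrier_mat d d" and lam: "132 * V \<le> lam"
    and viol: "lam * scale w A \<le> spread w A"
  shows "(\<Sum>s\<in>G. w s * (ip d A (fun_mat d (Y s)) - ip d A (mean_mat w))\<^sup>2) \<le>
    (\<Sum>s\<in>{..<N} - G. w s * (ip d A (fun_mat d (Y s)) - ip d A (mean_mat w))\<^sup>2)"
proof -
  interpret weighting N G1 G w \<epsilon> by (rule weighting[OF adm])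
  define q where "q = ip d (R * A * R) (R * A * R)"
  have q: "0 \<le> q" "q \<le> 4 * scale w A"
    using ip_self_nonneg scale_lower_bound[OF adm A] by (simp_all add: q_def)
  have "33 * (sqrt (V * q))\<^sup>2 = 33 * V * q" using V q by simp
  also have "\<dots> \<le> 33 * V * (4 * scale w A)" using V q by (intro mult_left_mono) auto
  also have "\<dots> = 132 * V * scale w A" by simp
  also have "\<dots> \<le> lam * scale w A" using lam q by (intro mult_right_mono) auto
  finally have "33 * (sqrt (V * q))\<^sup>2 \<le> spread w A" using viol by simp
  from good_variance_small[OF _ second'[OF A] first[OF A] good_deviation[OF _ A] mean_deviation[OF adm A] this[unfolded q_def]]
  show ?thesis using norm_nonneg[of "R * A * R"] by simp
qed

text \<open>Progress is measured by the number of samples of positive weight. It drops in each round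
  until all pivots are positive, and from then on the weights are a fixed point.\<close>

lemma filter_step_progress:
  assumes adm: "admissible w" and lam: "132 * V \<le> lam" and step: "filter_step lam d N Y w w'"
  shows "admissible w'"
    and "if settled lam w then \<forall>s<N. w' s = w s else card {s\<in>{..<N}. 0 < w' s} < card {s\<in>{..<N}. 0 < w s}"
proof -
  interpret weighting N G1 G w \<epsilon> by (rule weighting[OF adm])
  let ?B = "wform lam d N Y w"
  from step obtain v where sel: "selects ?B (d * d) v"
    and rw: "reweights N (\<lambda>s. (\<Sum>a<d * d. v a * wdev d N Y w s a)\<^sup>2) w w'"
    unfolding filter_step_def by blast
  define A where "A = unflatten d v"
  have A: "A \<in> carrier_mat d d" by (simp add: A_def)
  define \<tau> where "\<tau> = (\<lambda>s. (ip d A (fun_mat d (Y s)) - ip d A (mean_mat w))\<^sup>2)"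
  have rw': "reweights N \<tau> w w'"
  proof -
    have "(\<lambda>s. (\<Sum>a<d * d. v a * wdev d N Y w s a)\<^sup>2) = \<tau>"
      unfolding \<tau>_def A_def by (rule ext) (subst bil_wform(2)[where Y = Y and d = d and N = N, OF Y], auto)
    then show ?thesis using rw by simp
  qed
  have w01: "0 \<le> w s \<and> w s \<le> 1" if "s < N" for s using w that by auto
  have \<tau>0: "0 \<le> \<tau> s" for s by (simp add: \<tau>_def)
  have w'1: "0 \<le> w' s \<and> w' s \<le> w s" if "s < N" for s
    by (rule reweights_properties(1)[OF rw' _ _ that]) (use w01 \<tau>0 in auto)
  have bil_eq: "bil ?B (d * d) u u = lam * scale w (unflatten d u) - spread w (unflatten d u)" for u
    unfolding scale_def spread_def by (rule bil_wform(1)[where Y = Y and d = d and N = N, OF Y])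
  have adm': "admissible w'" if "(\<Sum>s\<in>G. w s * \<tau> s) \<le> (\<Sum>s\<in>{..<N} - G. w s * \<tau> s)"
  proof -
    have "(\<Sum>s\<in>G. 1 - w' s) \<le> (\<Sum>s\<in>{..<N} - G. 1 - w' s)"
      by (rule reweights_properties(2)[OF rw' _ _ GN that]) (use w01 \<tau>0 loss in auto)
    moreover have "0 \<le> w' s \<and> w' s \<le> 1 \<and> (0 < w' s \<longrightarrow> (\<forall>v. 0 \<le> bil (Y s) d v v))" if "s < N" for s
      using w'1[OF that] adm that unfolding admissible_def by force
    ultimately show ?thesis unfolding admissible_def by blast
  qed
  from sel consider (viol) k where "k < d * d" "gs_pivot ?B (d * d) k \<le> 0" "\<forall>a<d * d. v a = gs ?B (d * d) k a"
    | (ok) "\<forall>k<d * d. 0 < gs_pivot ?B (d * d) k" "\<forall>a<d * d. v a = 0"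
    unfolding selects_def by blast
  then have "admissible w' \<and> (if settled lam w then \<forall>s<N. w' s = w s
      else card {s\<in>{..<N}. 0 < w' s} < card {s\<in>{..<N}. 0 < w s})"
  proof cases
    case viol
    have "bil ?B (d * d) v v = bil ?B (d * d) (gs ?B (d * d) k) (gs ?B (d * d) k)"
      by (rule bil_cong) (use viol in auto)
    then have "bil ?B (d * d) v v \<le> 0" using viol(2) by (simp add: bil_gs_self)
    then have le: "lam * scale w A \<le> spread w A" unfolding bil_eq A_def by simp
    have "admissible w'" using violated_direction[OF adm A lam le] by (intro adm') (simp add: \<tau>_def)
    \<comment> \<open>The k-th orthogonalised vector has entry 1 at position
      \<open>k\<close>.\<close>
    moreover have "A \<noteq> 0\<^sub>m d d"
    proof
      assume "A = 0\<^sub>m d d"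
      moreover have "A $$ (k div d, k mod d) = 1"
      proof -
        have "k div d < d" "k mod d < d"
          using viol(1) by (auto simp: less_mult_imp_div_less intro!: mod_less_divisor gr0I)
        then show ?thesis using viol(1,3) by (simp add: A_def unflatten_def gs_triangular)
      qed
      moreover have "k div d < d" "k mod d < d"
        using viol(1) by (auto simp: less_mult_imp_div_less intro!: mod_less_divisor gr0I)
      ultimately show False by simp
    qed
    \<comment> \<open>A nonpositive pivot need not be a strict violation. But \<open>R\<close> is
      invertible, so \<open>lam * scale w A\<close> is positive for nonzero \<open>A\<close>; even a
      zero pivot forces positive spread, and the round removes weight.\<close>
    moreover have "0 < spread w A" if "A \<noteq> 0\<^sub>m d d"
    proof -
      have "ip d (R * A * R) (R * A * R) \<noteq> 0"
      proof
        assume "ip d (R * A * R) (R * A * R) = 0"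
        then have z: "R * A * R = 0\<^sub>m d d" using R A by (intro ip_self_eq_0) auto
        have "Wi * (R * A * R) * Wi = (Wi * R) * A * (R * Wi)"
          using Wi(1) R A by (simp add: assoc_mult_mat[of _ d d _ d _ d])
        also have "\<dots> = A" unfolding Wi(3,4) using A by simp
        finally have "Wi * 0\<^sub>m d d * Wi = A" unfolding z .
        moreover have "Wi * 0\<^sub>m d d * Wi = 0\<^sub>m d d" using Wi(1) by simp
        ultimately show False using that by metis
      qed
      then have "0 < ip d (R * A * R) (R * A * R)" using ip_self_nonneg[of d "R * A * R"] by simp
      then have "0 < scale w A" using scale_lower_bound[OF adm A] by simp
      moreover have "0 < lam" using lam V by linarith
      ultimately have "0 < lam * scale w A" by simp
      then show ?thesis using le by simp
    qed
    ultimately have pos: "0 < spread w A" and admw: "admissible w'" by auto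
    have ex: "\<exists>s<N. 0 < w s \<and> 0 < \<tau> s"
    proof (rule ccontr)
      assume "\<not> (\<exists>s<N. 0 < w s \<and> 0 < \<tau> s)"
      then have "w s * \<tau> s = 0" if "s < N" for s
        using w01[OF that] \<tau>0[of s] that by (metis less_eq_real_def mult_eq_0_iff)
      then have "spread w A = 0" unfolding spread_def \<tau>_def by (auto intro!: sum.neutral)
      then show False using pos by simp
    qed
    have "card {s\<in>{..<N}. 0 < w' s} < card {s\<in>{..<N}. 0 < w s}"
    proof -
      from ex obtain s where s: "s < N" "0 < w s" "0 < \<tau> s" by blast
      show ?thesis by (rule reweights_properties(3)[OF rw' _ _ s]) (use w01 \<tau>0 in auto)
    qed
    moreover have "\<not> settled lam w" using viol(1,2) by (auto simp: settled_def not_less)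
    ultimately show ?thesis using admw by simp
  next
    case ok
    have "A = 0\<^sub>m d d"
    proof -
      have "i * d + j < d * d" if "i < d" "j < d" for i j
      proof -
        have "i * d + j < (i + 1) * d" using that by simp
        also have "\<dots> \<le> d * d" using that by (intro mult_right_mono) auto
        finally show ?thesis .
      qed
      then show ?thesis unfolding A_def unflatten_def using ok(2) by (intro eq_matI) auto
    qed
    then have "ip d A Z = 0" for Z by (simp add: ip_def)
    then have \<tau>z: "\<tau> s = 0" for s by (simp add: \<tau>_def)
    have "settled lam w" using ok(1) by (simp add: settled_def)
    moreover have "w' s = w s" if "s < N" for s
      by (rule reweights_properties(4)[OF rw' _ _ _ that]) (use w01 \<tau>0 \<tau>z in auto)
    moreover have "admissible w'" by (rule adm') (simp add: \<tau>z)
    ultimately show ?thesis by simp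
  qed
  then show "admissible w'"
    and "if settled lam w then \<forall>s<N. w' s = w s else card {s\<in>{..<N}. 0 < w' s} < card {s\<in>{..<N}. 0 < w s}"
    by blast+
qed

lemma settled_stable:
  assumes "settled lam w"
  shows "stable lam w"
  unfolding stable_def
proof
  let ?B = "wform lam d N Y w"
  fix C :: "real mat" assume C: "C \<in> carrier_mat d d"
  have "0 \<le> bil ?B (d * d) (\<lambda>a. C $$ (a div d, a mod d)) (\<lambda>a. C $$ (a div d, a mod d))"
    by (rule gs_pivots_positive) (use assms wform_symmetric[where Y = Y and d = d and N = N, OF Y] in \<open>auto simp: settled_def\<close>)
  moreover have "bil ?B (d * d) u u = lam * scale w (unflatten d u) - spread w (unflatten d u)" for u
    unfolding scale_def spread_def by (rule bil_wform(1)[where Y = Y and d = d and N = N, OF Y])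
  ultimately show "spread w C \<le> lam * scale w C" unfolding unflatten_surj[OF C] by (simp add: unflatten_surj[OF C])
qed

text \<open>A settled round reproduces the weights below \<open>N\<close> only, so being settled has
  to depend on these values alone in order to persist.\<close>

lemma settled_cong:
  assumes "\<And>s. s < N \<Longrightarrow> w' s = w s" "settled lam w"
  shows "settled lam w'"
proof -
  have s: "wsum N w' = wsum N w" unfolding wsum_def using assms(1) by (intro sum.cong) auto
  have m: "wmean N Y w' = wmean N Y w"
    unfolding wmean_def s using assms(1) by (intro ext sum.cong) auto
  have "wform lam d N Y w' = wform lam d N Y w"
    unfolding wform_def wdev_def m s using assms(1) by (intro ext arg_cong2[where f = "(-)"] sum.cong) auto
  then show ?thesis using assms(2) by (simp add: settled_def)
qed

text \<open>Before settling, each round takes a sample out of the support. If \<open>N\<close>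
  rounds did not suffice, the support would be empty, but admissible weights have positive
  total.\<close>

lemma filter_converges:
  assumes init: "admissible (ws 0)" and lam: "132 * V \<le> lam"
    and steps: "\<And>r. r < N \<Longrightarrow> filter_step lam d N Y (ws r) (ws (Suc r))"
  shows "admissible (ws N)" "settled lam (ws N)"
proof -
  have inv: "admissible (ws r) \<and> (settled lam (ws r) \<or> card {s\<in>{..<N}. 0 < ws r s} + r \<le> N)" if "r \<le> N" for r
    using that
  proof (induction r)
    case 0
    have "card {s\<in>{..<N}. 0 < ws 0 s} \<le> card {..<N}" by (intro card_mono) auto
    then show ?case using init by simp
  next
    case (Suc r)
    then have adm: "admissible (ws r)" and or: "settled lam (ws r) \<or> card {s\<in>{..<N}. 0 < ws r s} + r \<le> N"
      and r: "r < N" by auto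
    note p = filter_step_progress[OF adm lam steps[OF r]]
    show ?case
    proof (cases "settled lam (ws r)")
      case True
      then show ?thesis using p settled_cong[of "ws (Suc r)" "ws r" lam] by simp
    next
      case False
      then show ?thesis using p or by simp
    qed
  qed
  show adm: "admissible (ws N)" using inv[of N] by simp
  show "settled lam (ws N)"
  proof (rule ccontr)
    assume "\<not> settled lam (ws N)"
    then have "card {s\<in>{..<N}. 0 < ws N s} = 0" using inv[of N] by simp
    then have "\<not> 0 < ws N s" if "s < N" for s using that by auto
    then have "wsum N (ws N) \<le> 0" unfolding wsum_def by (intro sum_nonpos) force
    moreover interpret weighting N G1 G "ws N" \<epsilon> by (rule weighting[OF adm])
    have "0 < wsum N (ws N)" by (rule total_weight_pos)
    ultimately show False by simp
  qed
qed

text \<open>Let \<open>f\<close> be the norm of the normalised error \<open>m\<close>. As the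
  weighted mean is \<open>R (1 + m) R\<close>, stability in the test direction bounds the spread by
  \<open>lam * ((1 + f) * f)^2\<close>, and \<open>deviation_bound\<close> reads \<open>f^2 \<le> 10
  sqrt(V \<epsilon>) f + 3 sqrt(lam \<epsilon>) (1 + f) f\<close>. After cancelling
  \<open>f\<close>, the assumption \<open>lam * \<epsilon> \<le> 1 / 36\<close> makes the
  self-referential term at most \<open>f / 2\<close>; absorbing it costs the factor 2.\<close>

lemma stable_mean_close:
  assumes adm: "admissible w" and st: "stable lam w" and lam: "0 \<le> lam" "lam * \<epsilon> \<le> 1 / 36"
  shows "frob_norm (Wi * (S - mean_mat w) * Wi) \<le> 2 * (10 * sqrt (V * \<epsilon>) + 3 * sqrt (lam * \<epsilon>))"
proof -
  let ?M = "mean_mat w"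
  define m where "m = Wi * (?M - S) * Wi"
  note [simp] = mult_carrier_mat[of _ d d _ d] minus_carrier_mat[of _ d d] add_carrier_mat[of _ d d]
    left_mult_one_mat[of _ d d] right_mult_one_mat[of _ d d] Sc Wi(1) R(1)
  have mc[simp]: "m \<in> carrier_mat d d" by (simp add: m_def)
  have MS: "?M - S = R * m * R"
  proof -
    have "R * m * R = (R * Wi) * (?M - S) * (Wi * R)"
      unfolding m_def by (simp add: assoc_mult_mat[of _ d d _ d _ d])
    then show ?thesis by (simp add: Wi)
  qed
  have M: "?M = S + R * m * R" unfolding MS[symmetric] by (intro eq_matI) (use carrier_matD[OF Sc] in auto)
  have mT: "transpose_mat m = m"
  proof -
    have sym: "wmean N Y w i j = wmean N Y w j i" if "i < d" "j < d" for i j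
      by (rule wmean_symmetric) (use Y that in auto)
    have "transpose_mat ?M = ?M" using sym by (intro eq_matI) (auto simp: fun_mat_def)
    then have "transpose_mat (?M - S) = ?M - S"
      using psd_matD(2)[OF S] by (simp add: transpose_minus[of _ d d])
    then show ?thesis unfolding m_def
      by (simp add: transpose_mult[of _ d d _ d] Wi(2) assoc_mult_mat[of _ d d _ d _ d])
  qed
  \<comment> \<open>In this direction the deviation of the mean is the squared Frobenius norm of \<open>m\<close>.\<close>
  define A where "A = Wi * m * Wi"
  have A[simp]: "A \<in> carrier_mat d d" by (simp add: A_def)
  have RAR: "R * A * R = m"
  proof -
    have "R * A * R = (R * Wi) * m * (Wi * R)"
      unfolding A_def by (simp add: assoc_mult_mat[of _ d d _ d _ d])
    then show ?thesis by (simp add: Wi)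
  qed
  define f where "f = sqrt (ip d m m)"
  have f: "0 \<le> f" "f\<^sup>2 = ip d m m" by (simp_all add: f_def ip_self_nonneg)
  have dev: "ip d A ?M - ip d A S = f\<^sup>2"
  proof -
    have "ip d A ?M - ip d A S = ip d A (?M - S)" by (simp add: ip_minus_right)
    also have "\<dots> = ip d (R * A * R) m"
      unfolding MS using ip_congruence[of A d m R R] R(2) by simp
    finally show ?thesis using f RAR by simp
  qed
  define p where "p = m + m * m"
  have p[simp]: "p \<in> carrier_mat d d" by (simp add: p_def)
  have pT: "transpose_mat p = p"
    unfolding p_def by (simp add: transpose_add[of _ d d] transpose_mult[of _ d d _ d] mT)
  have cancel: "X * (R * (Wi * Z)) = X * Z" "X * (Wi * (R * Z)) = X * Z"
    if "X \<in> carrier_mat d d" "Z \<in> carrier_mat d d" for X Z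
  proof -
    have "R * (Wi * Z) = (R * Wi) * Z" "Wi * (R * Z) = (Wi * R) * Z"
      using that by (simp_all add: assoc_mult_mat[of _ d d _ d _ d])
    then show "X * (R * (Wi * Z)) = X * Z" "X * (Wi * (R * Z)) = X * Z" using that by (simp_all add: Wi)
  qed
  have RRm: "?M = R * (1\<^sub>m d + m) * R"
  proof -
    have "(1\<^sub>m d + m) * R = R + m * R" by (subst add_mult_distrib_mat[of _ d d _ _ d]) auto
    then have "R * (1\<^sub>m d + m) * R = R * (R + m * R)" by (simp add: assoc_mult_mat[of _ d d _ d _ d])
    also have "\<dots> = R * R + R * (m * R)" by (rule mult_add_distrib_mat[of _ d d _ d]) auto
    also have "\<dots> = ?M" unfolding M R(3) by (simp add: assoc_mult_mat[of _ d d _ d _ d])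
    finally show ?thesis by simp
  qed
  \<comment> \<open>The inverse roots around \<open>m\<close> in \<open>A\<close> cancel the inner
    roots of both means, which leaves \<open>(1 + m) m (1 + m)\<close> between two outer factors
    \<open>R\<close>.\<close>
  have MAM: "?M * A * ?M = R * ((1\<^sub>m d + m) * p) * R"
  proof -
    have "?M * A * ?M = (R * (1\<^sub>m d + m)) * (R * (Wi * (m * (Wi * (R * ((1\<^sub>m d + m) * R))))))"
      unfolding RRm A_def by (simp add: assoc_mult_mat[of _ d d _ d _ d])
    also have "\<dots> = (R * (1\<^sub>m d + m)) * (m * ((1\<^sub>m d + m) * R))"
      by (simp add: cancel)
    also have "\<dots> = R * ((1\<^sub>m d + m) * (m * (1\<^sub>m d + m))) * R"
      by (simp add: assoc_mult_mat[of _ d d _ d _ d])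
    also have "m * (1\<^sub>m d + m) = p" by (simp add: p_def mult_add_distrib_mat[of _ d d _ d])
    finally show ?thesis .
  qed
  have "scale w A = ip d (R * A * R) ((1\<^sub>m d + m) * p)"
    unfolding scale_def MAM using ip_congruence[of A d "(1\<^sub>m d + m) * p" R R] R(2) by simp
  also have "\<dots> = ip d ((1\<^sub>m d + m) * m) p"
    unfolding RAR using ip_mult_left[of m d "1\<^sub>m d + m" p] by (simp add: transpose_add[of _ d d] mT)
  also have "(1\<^sub>m d + m) * m = p" by (simp add: p_def add_mult_distrib_mat[of _ d d _ _ d])
  finally have sc: "scale w A = ip d p p" .
  \<comment> \<open>In effect the triangle inequality: the norm of \<open>m + m * m\<close> is at
    most \<open>f + f^2\<close>.\<close>
  have pp: "ip d p p \<le> ((1 + f) * f)\<^sup>2"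
  proof -
    have mm: "ip d (m * m) (m * m) \<le> (f\<^sup>2)\<^sup>2"
      using ip_mult_le[of m d m] f by (simp add: power2_eq_square)
    have "(ip d m (m * m))\<^sup>2 \<le> f\<^sup>2 * (f\<^sup>2)\<^sup>2"
      using ip_Cauchy_Schwarz[of d m "m * m"] mult_left_mono[OF mm zero_le_power2[of f]] unfolding f(2) by linarith
    also have "\<dots> = (f ^ 3)\<^sup>2" by (simp add: power2_eq_square power3_eq_cube)
    finally have "\<bar>ip d m (m * m)\<bar> \<le> \<bar>f ^ 3\<bar>" by (simp add: abs_le_square_iff)
    then have 1: "ip d m (m * m) \<le> f ^ 3" using f by simp
    have "ip d p p = ip d m m + 2 * ip d m (m * m) + ip d (m * m) (m * m)"
    proof -
      have e: "ip d X p = ip d X m + ip d X (m * m)" if "X \<in> carrier_mat d d" for X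
        unfolding p_def using that by (intro ip_add_right) auto
      have "ip d p m = ip d m p" "ip d p (m * m) = ip d (m * m) p" "ip d (m * m) m = ip d m (m * m)"
        by (rule ip_commute)+
      then show ?thesis using e[of p] e[of m] e[of "m * m"] by simp
    qed
    also have "\<dots> \<le> f\<^sup>2 + 2 * f ^ 3 + (f\<^sup>2)\<^sup>2" using mm 1 f by simp
    also have "\<dots> = ((1 + f) * f)\<^sup>2" by (simp add: power2_eq_square power3_eq_cube algebra_simps)
    finally show ?thesis .
  qed
  have "spread w A \<le> lam * ip d p p" using st A unfolding stable_def sc[symmetric] by blast
  also have "\<dots> \<le> lam * ((1 + f) * f)\<^sup>2" by (rule mult_left_mono[OF pp lam(1)])
  finally have "sqrt (spread w A) \<le> sqrt lam * ((1 + f) * f)"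
    using f real_sqrt_le_mono[of "spread w A" "lam * ((1 + f) * f)\<^sup>2"] by (simp add: real_sqrt_mult)
  then have "sqrt \<epsilon> * sqrt (spread w A) \<le> sqrt \<epsilon> * (sqrt lam * ((1 + f) * f))"
    using eps by (intro mult_left_mono) auto
  then have sp: "sqrt \<epsilon> * sqrt (spread w A) \<le> sqrt (lam * \<epsilon>) * ((1 + f) * f)"
    by (simp add: real_sqrt_mult mult_ac)
  have "f\<^sup>2 \<le> 10 * sqrt \<epsilon> * sqrt (V * f\<^sup>2) + 3 * sqrt \<epsilon> * sqrt (spread w A)"
    using deviation_bound[OF adm A] unfolding RAR dev f(2)[symmetric] by simp
  also have "\<dots> \<le> 10 * sqrt (V * \<epsilon>) * f + 3 * sqrt (lam * \<epsilon>) * ((1 + f) * f)"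
  proof -
    have "10 * sqrt \<epsilon> * sqrt (V * f\<^sup>2) = 10 * sqrt (V * \<epsilon>) * f"
      using f(1) by (simp add: real_sqrt_mult)
    then show ?thesis using sp by simp
  qed
  finally have main: "f * f \<le> (10 * sqrt (V * \<epsilon>) + 3 * sqrt (lam * \<epsilon>) * (1 + f)) * f"
    by (simp add: power2_eq_square algebra_simps)
  have "f \<le> 2 * (10 * sqrt (V * \<epsilon>) + 3 * sqrt (lam * \<epsilon>))"
  proof (cases "f = 0")
    case True
    then show ?thesis using V eps lam by simp
  next
    case False
    then have "f \<le> 10 * sqrt (V * \<epsilon>) + 3 * sqrt (lam * \<epsilon>) * (1 + f)"
      using main f by (subst (asm) mult_le_cancel_right) auto
    moreover have "3 * sqrt (lam * \<epsilon>) * f \<le> 1 / 2 * f"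
    proof -
      have "sqrt (lam * \<epsilon>) \<le> 1 / 6" using lam by (intro real_le_lsqrt) (auto simp: power2_eq_square)
      then show ?thesis using f by (intro mult_right_mono) auto
    qed
    ultimately show ?thesis by (simp add: algebra_simps)
  qed
  moreover have "frob_norm (Wi * (S - ?M) * Wi) = f"
  proof -
    have "Wi * (S - ?M) * Wi = - m"
    proof -
      have "S - ?M = - (?M - S)" by (intro eq_matI) (use carrier_matD[OF Sc] in auto)
      then show ?thesis unfolding m_def
        by (simp add: carrier_matD[OF Wi(1)] carrier_matD[OF Sc])
    qed
    moreover have "ip d (- m) (- m) = ip d m m"
      unfolding ip_def using carrier_matD[OF mc] by (intro sum.cong) auto
    moreover have "- m \<in> carrier_mat d d" using carrier_matD[OF mc] by auto
    ultimately show ?thesis using frob_norm_ip[of "- m" d] by (simp add: f_def)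
  qed
  ultimately show ?thesis by simp
qed

end

section \<open>Samples from the distribution\<close>

lemma measurable_entry:
  assumes "sets X = sets (mat_borel d)" "i < d" "j < d"
  shows "(\<lambda>M. M $$ (i, j)) \<in> borel_measurable X"
proof -
  let ?A = "{{A \<in> carrier_mat d d. A $$ (i, j) \<in> B} | i j B. i < d \<and> j < d \<and> B \<in> sets borel}"
  have P: "?A \<subseteq> Pow (carrier_mat d d)" by auto
  have sp: "space (mat_borel d) = carrier_mat d d" unfolding mat_borel_def by (rule space_measure_of[OF P])
  have "(\<lambda>M. M $$ (i, j)) \<in> borel_measurable (mat_borel d)"
  proof (rule measurableI)
    fix B :: "real set" assume "B \<in> sets borel"
    then have "{A \<in> carrier_mat d d. A $$ (i, j) \<in> B} \<in> ?A" using assms by blast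
    then have "{A \<in> carrier_mat d d. A $$ (i, j) \<in> B} \<in> sets (mat_borel d)"
      unfolding mat_borel_def sets_measure_of[OF P] by (rule sigma_sets.Basic)
    moreover have "(\<lambda>M. M $$ (i, j)) -` B \<inter> space (mat_borel d) = {A \<in> carrier_mat d d. A $$ (i, j) \<in> B}"
      unfolding sp by auto
    ultimately show "(\<lambda>M. M $$ (i, j)) -` B \<inter> space (mat_borel d) \<in> sets (mat_borel d)" by simp
  qed simp
  then show ?thesis using measurable_cong_sets[OF assms(1) refl] by blast
qed

lemma space_mat_distribution:
  assumes "sets X = sets (mat_borel d)"
  shows "space X = carrier_mat d d"
proof -
  have "{{A \<in> carrier_mat d d. A $$ (i, j) \<in> B} | i j B. i < d \<and> j < d \<and> B \<in> sets (borel :: real measure)} \<subseteq> Pow (carrier_mat d d)"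
    by auto
  from space_measure_of[OF this] show ?thesis
    using sets_eq_imp_space_eq[OF assms] unfolding mat_borel_def by simp
qed

text \<open>The variance assumption speaks of symmetric directions, while flattened directions are
  arbitrary matrices. The symmetric part has the same pairing with symmetric matrices, and
  Cauchy-Schwarz for \<open>A\<close> and its transpose shows that its norm is no larger.\<close>

lemma ip_symmetrize:
  assumes A: "A \<in> carrier_mat d d" and M: "M \<in> carrier_mat d d" "transpose_mat M = M"
  defines "B \<equiv> (1 / 2) \<cdot>\<^sub>m (A + transpose_mat A)"
  shows "B \<in> carrier_mat d d" "transpose_mat B = B" "ip d B M = ip d A M" "ip d B B \<le> ip d A A"
proof -
  have At: "transpose_mat A \<in> carrier_mat d d" using A by simp
  show B: "B \<in> carrier_mat d d" using A by (simp add: B_def)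
  show BT: "transpose_mat B = B" unfolding B_def using A by (intro eq_matI) auto
  have B_ip: "ip d B Z = (ip d A Z + ip d (transpose_mat A) Z) / 2" if Z: "Z \<in> carrier_mat d d" for Z
  proof -
    have "ip d B Z = ip d Z ((1 / 2) \<cdot>\<^sub>m (A + transpose_mat A))" unfolding B_def by (rule ip_commute)
    also have "\<dots> = (ip d Z A + ip d Z (transpose_mat A)) / 2"
      using Z A At by (simp add: ip_smult_right[of _ d] ip_add_right[of _ d])
    finally show ?thesis by (simp add: ip_commute)
  qed
  have "ip d (transpose_mat A) M = ip d A M" using ip_transpose[OF A M(1)] M(2) by simp
  then show "ip d B M = ip d A M" unfolding B_ip[OF M(1)] by simp
  have tt: "ip d (transpose_mat A) (transpose_mat A) = ip d A A" by (rule ip_transpose[OF A A])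
  have "ip d A (transpose_mat A) \<le> ip d A A"
  proof -
    have "(ip d A (transpose_mat A))\<^sup>2 \<le> (ip d A A)\<^sup>2"
      using ip_Cauchy_Schwarz[of d A "transpose_mat A"] unfolding tt by (simp add: power2_eq_square)
    then show ?thesis using ip_self_nonneg[of d A] by (rule power2_le_imp_le)
  qed
  moreover have "ip d B B = (ip d A A + ip d A (transpose_mat A)) / 2"
  proof -
    have "ip d B B = (ip d A B + ip d (transpose_mat A) B) / 2" by (rule B_ip[OF B])
    also have "ip d (transpose_mat A) B = ip d A B" using ip_transpose[OF A B] BT by simp
    also have "ip d A B = (ip d A A + ip d (transpose_mat A) A) / 2"
      using B_ip[OF A] by (simp add: ip_commute)
    finally show ?thesis by (simp add: ip_commute)
  qed
  ultimately show "ip d B B \<le> ip d A A" by simp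
qed

lemma fun_mat_entries:
  "Z \<in> carrier_mat d d \<Longrightarrow> fun_mat d (\<lambda>i j. Z $$ (i, j)) = Z"
  by (intro eq_matI) (auto simp: fun_mat_def)

lemma sum_flatten_square:
  "(\<Sum>a<d * d. (v a)\<^sup>2) = ip d (unflatten d v) (unflatten d v)"
  unfolding sum_flatten ip_def by (simp add: power2_eq_square)

text \<open>The assumptions on the distribution with \<open>C * \<sigma>\<^sup>2\<close> abbreviated
  to \<open>V\<close>.\<close>

locale bounded_covariance =
  fixes d :: nat and X :: "real mat measure" and S :: "real mat" and V :: real
  assumes X: "mat_distribution d X" and psd: "AE M in X. psd_mat d M" and mean: "has_mean d X S"
    and inv: "invertible_mat S" and d: "1 \<le> d" and V: "0 < V"
    and var: "\<And>A. symmetric_mat d A \<Longrightarrow> integrable X (\<lambda>M. (mat_trace (A * M))\<^sup>2) \<and>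
         prob_space.variance X (\<lambda>M. mat_trace (A * M)) \<le> V * (frob_norm (psd_sqrt S * A * psd_sqrt S))\<^sup>2"
begin

lemma prob_X: "prob_space X" and sets_X: "sets X = sets (mat_borel d)"
  using X by (auto simp: mat_distribution_def)

lemma space_X: "space X = carrier_mat d d" by (rule space_mat_distribution[OF sets_X])

lemma entry_measurable[measurable]: "i < d \<Longrightarrow> j < d \<Longrightarrow> (\<lambda>M. M $$ (i, j)) \<in> borel_measurable X"
  by (rule measurable_entry[OF sets_X])

lemma Sc: "S \<in> carrier_mat d d"
  and entry_integrable: "i < d \<Longrightarrow> j < d \<Longrightarrow> integrable X (\<lambda>M. M $$ (i, j))"
  and entry_mean: "i < d \<Longrightarrow> j < d \<Longrightarrow> (\<integral>M. M $$ (i, j) \<partial>X) = S $$ (i, j)"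
  using mean by (auto simp: has_mean_def)

section \<open>Moments of linear functionals of a sample\<close>

lemma ip_integrable: "integrable X (\<lambda>M. ip d A M)"
  unfolding ip_def by (intro Bochner_Integration.integrable_sum integrable_mult_right entry_integrable) auto

lemma ip_measurable: "(\<lambda>M. ip d A M) \<in> borel_measurable X"
  using ip_integrable by (rule borel_measurable_integrable)

lemma ip_mean: "(\<integral>M. ip d A M \<partial>X) = ip d A S"
proof -
  have "(\<integral>M. ip d A M \<partial>X) = (\<Sum>i<d. \<integral>M. (\<Sum>j<d. A $$ (i, j) * M $$ (i, j)) \<partial>X)"
    unfolding ip_def
    by (intro Bochner_Integration.integral_sum Bochner_Integration.integrable_sum integrable_mult_right entry_integrable) auto
  also have "\<dots> = (\<Sum>i<d. \<Sum>j<d. \<integral>M. A $$ (i, j) * M $$ (i, j) \<partial>X)"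
    by (intro sum.cong refl Bochner_Integration.integral_sum integrable_mult_right entry_integrable) auto
  also have "\<dots> = ip d A S"
    unfolding ip_def by (intro sum.cong refl) (auto simp: entry_mean)
  finally show ?thesis .
qed

text \<open>The quadratic form at a fixed vector is linear in the matrix, so semidefiniteness passes
  to the expectation.\<close>

lemma psd_S: "psd_mat d S"
proof -
  interpret prob_space X by (rule prob_X)
  have sym: "S $$ (i, j) = S $$ (j, i)" if ij: "i < d" "j < d" for i j
  proof -
    have "(\<integral>M. M $$ (i, j) \<partial>X) = (\<integral>M. M $$ (j, i) \<partial>X)"
    proof (rule integral_cong_AE)
      show "AE M in X. M $$ (i, j) = M $$ (j, i)"
        using psd
      proof eventually_elim
        case (elim M)
        then show ?case using psd_matD(1,2)[OF elim] index_transpose_mat(1)[of i M j] ij by simp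
      qed
    qed (use ij in auto)
    then show ?thesis using entry_mean ij by simp
  qed
  show ?thesis unfolding psd_mat_def symmetric_mat_def
  proof (intro conjI ballI Sc)
    show "transpose_mat S = S" using Sc sym by (intro eq_matI) auto
    fix v :: "real vec" assume v: "v \<in> carrier_vec d"
    have "AE M in X. 0 \<le> ip d (outer_mat d v) M"
      using psd
    proof eventually_elim
      case (elim M)
      then show ?case using psd_matD(3)[OF elim v] by (simp add: ip_outer_mat[OF v psd_matD(1)[OF elim]])
    qed
    then have "0 \<le> (\<integral>M. ip d (outer_mat d v) M \<partial>X)" by (rule integral_nonneg_AE)
    then show "0 \<le> v \<bullet> (S *\<^sub>v v)" unfolding ip_mean by (simp add: ip_outer_mat[OF v Sc])
  qed
qed

abbreviation "R \<equiv> psd_sqrt S"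
abbreviation "W \<equiv> psd_inv_sqrt S"

lemma R: "R \<in> carrier_mat d d" "transpose_mat R = R" "R * R = S"
  using psd_sqrt_properties[OF psd_S inv] psd_matD by auto

lemmas W = psd_inv_sqrt_properties[OF psd_S inv]

lemma RWZWR:
  assumes Z: "Z \<in> carrier_mat d d"
  shows "R * (W * Z * W) * R = Z" "W * (R * Z * R) * W = Z"
proof -
  have "R * (W * Z * W) * R = (R * W) * Z * (W * R)"
    using R(1) W(1) Z by (simp add: assoc_mult_mat[of _ d d _ d _ d])
  then show "R * (W * Z * W) * R = Z" using Z by (simp add: W)
  have "W * (R * Z * R) * W = (W * R) * Z * (R * W)"
    using R(1) W(1) Z by (simp add: assoc_mult_mat[of _ d d _ d _ d])
  then show "W * (R * Z * R) * W = Z" using Z by (simp add: W)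
qed

text \<open>Samples are almost surely symmetric, so \<open>A\<close> and its symmetric part define
  the same random variable. Conjugation by \<open>R\<close> commutes with taking the symmetric part,
  which does not increase the norm.\<close>

lemma linear_second_moment:
  assumes A: "A \<in> carrier_mat d d"
  shows "integrable X (\<lambda>M. (ip d A M - ip d A S)\<^sup>2)"
    and "(\<integral>M. (ip d A M - ip d A S)\<^sup>2 \<partial>X) \<le> V * ip d (R * A * R) (R * A * R)"
proof -
  interpret prob_space X by (rule prob_X)
  define B where "B = (1 / 2) \<cdot>\<^sub>m (A + transpose_mat A)"
  note s = ip_symmetrize[OF A Sc psd_matD(2)[OF psd_S], folded B_def]
  have sB: "symmetric_mat d B" using s by (simp add: symmetric_mat_def)
  have tr: "mat_trace (B * M) = ip d B M" if "M \<in> carrier_mat d d" for M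
    using mat_trace_mult[OF s(1) that] s(2) by simp
  have i2: "integrable X (\<lambda>M. (ip d B M)\<^sup>2)"
    using var[OF sB] tr by (subst Bochner_Integration.integrable_cong[OF refl, of X _ "\<lambda>M. (mat_trace (B * M))\<^sup>2"]) (auto simp: space_X)
  have e: "expectation (\<lambda>M. mat_trace (B * M)) = ip d B S"
    unfolding ip_mean[symmetric] using tr by (intro Bochner_Integration.integral_cong) (auto simp: space_X)
  have iB: "integrable X (\<lambda>M. (ip d B M - ip d B S)\<^sup>2)"
    unfolding power2_diff using i2 ip_integrable[of B] by auto
  have eqAE: "AE M in X. (ip d A M - ip d A S)\<^sup>2 = (ip d B M - ip d B S)\<^sup>2"
    using psd
  proof eventually_elim
    case (elim M)
    then show ?case using ip_symmetrize(3)[OF A psd_matD(1,2)[OF elim]] s(3) by (simp add: B_def)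
  qed
  note [measurable] = ip_measurable
  show "integrable X (\<lambda>M. (ip d A M - ip d A S)\<^sup>2)"
    using iB by (subst integrable_cong_AE[OF _ _ eqAE]) auto
  have "(\<integral>M. (ip d A M - ip d A S)\<^sup>2 \<partial>X) = (\<integral>M. (ip d B M - ip d B S)\<^sup>2 \<partial>X)"
    by (rule integral_cong_AE[OF _ _ eqAE]) auto
  also have "\<dots> = variance (\<lambda>M. mat_trace (B * M))"
    unfolding e using tr by (intro Bochner_Integration.integral_cong) (auto simp: space_X)
  also have "\<dots> \<le> V * (frob_norm (R * B * R))\<^sup>2" using var[OF sB] by simp
  also have "(frob_norm (R * B * R))\<^sup>2 = ip d (R * B * R) (R * B * R)"
    using R(1) s(1) by (subst frob_norm_ip[of _ d]) (auto simp: ip_self_nonneg)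
  also have "V * ip d (R * B * R) (R * B * R) \<le> V * ip d (R * A * R) (R * A * R)"
  proof (rule mult_left_mono)
    have RA: "R * A * R \<in> carrier_mat d d" using R(1) A by auto
    have "transpose_mat (R * A * R) = R * transpose_mat A * R"
      using R A by (simp add: transpose_mult[of _ d d _ d] assoc_mult_mat[of _ d d _ d _ d])
    moreover have "R * B * R = (1 / 2) \<cdot>\<^sub>m (R * A * R + R * transpose_mat A * R)"
      unfolding B_def using R(1) A
      by (simp add: mult_smult_assoc_mat[of _ d d _ d] mult_smult_distrib[of _ d d _ d]
          mult_add_distrib_mat[of _ d d _ d] add_mult_distrib_mat[of _ d d _ _ d])
    ultimately have "R * B * R = (1 / 2) \<cdot>\<^sub>m (R * A * R + transpose_mat (R * A * R))" by simp
    then show "ip d (R * B * R) (R * B * R) \<le> ip d (R * A * R) (R * A * R)"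
      using ip_symmetrize(4)[OF RA Sc psd_matD(2)[OF psd_S]] by simp
  qed (use V in simp)
  finally show "(\<integral>M. (ip d A M - ip d A S)\<^sup>2 \<partial>X) \<le> V * ip d (R * A * R) (R * A * R)" .
qed

text \<open>\<open>truncated_concentration\<close> is applied to the \<open>d * d\<close> entries
  \<open>z a\<close> of the whitened deviation \<open>W * (M - S) * W\<close>, whose covariance is
  at most \<open>V\<close> times the identity. A direction \<open>A\<close> has the coefficient
  vector \<open>R * A * R\<close>, because whitening turns the latter back into
  \<open>A\<close>.\<close>

lemma sample_concentration:
  assumes "0 < \<epsilon>" "0 < \<delta>" "\<delta> < 1" and N: "9 * real d ^ 4 / (\<epsilon> * \<delta>\<^sup>2) \<le> real N"
  shows "\<exists>Good\<in>sets (PiM {..<N} (\<lambda>_. X)). 1 - \<delta> \<le> measure (PiM {..<N} (\<lambda>_. X)) Good \<and>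
    (\<forall>xs\<in>Good. \<exists>G\<subseteq>{..<N}. real (card ({..<N} - G)) \<le> \<epsilon> * real N \<and>
      (\<forall>A\<in>carrier_mat d d. (\<Sum>s\<in>G. (ip d A (xs s - S))\<^sup>2) \<le> 2 * real N * (V * ip d (R * A * R) (R * A * R)) \<and>
        \<bar>\<Sum>s\<in>G. ip d A (xs s - S)\<bar> \<le> 2 * sqrt \<epsilon> * real N * sqrt (V * ip d (R * A * R) (R * A * R))))"
proof -
  define e where "e = (\<lambda>a :: nat. W * unflatten d (\<lambda>b. if b = a then 1 else 0) * W)"
  have ec: "e a \<in> carrier_mat d d" for a using W(1) by (auto simp: e_def)
  define z where "z = (\<lambda>a M. ip d (e a) M - ip d (e a) S)"
  have lin: "(\<Sum>a<d * d. c a * z a M) = ip d (W * unflatten d c * W) M - ip d (W * unflatten d c * W) S"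
    if M: "M \<in> carrier_mat d d" for c M
  proof -
    have u: "(\<Sum>a<d * d. c a * ip d (e a) Z) = ip d (W * unflatten d c * W) Z" if Z: "Z \<in> carrier_mat d d" for Z
    proof -
      have Z': "W * Z * W \<in> carrier_mat d d" using W(1) Z by auto
      have "ip d (e a) Z = (W * Z * W) $$ (a div d, a mod d)" if a: "a < d * d" for a
      proof -
        have "ip d (e a) Z = ip d (unflatten d (\<lambda>b. if b = a then 1 else 0)) (W * Z * W)"
          unfolding e_def using ip_congruence[of "unflatten d (\<lambda>b. if b = a then 1 else 0)" d Z W W] W(1,2) Z by simp
        also have "W * Z * W = fun_mat d (\<lambda>i j. (W * Z * W) $$ (i, j))"
          by (rule fun_mat_entries[OF Z', symmetric])
        also have "ip d (unflatten d (\<lambda>b. if b = a then 1 else 0)) \<dots> =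
            (\<Sum>b<d * d. (if b = a then 1 else 0) * (W * Z * W) $$ (b div d, b mod d))"
          by (rule sum_flatten_ip[symmetric])
        also have "\<dots> = (\<Sum>b<d * d. if b = a then (W * Z * W) $$ (a div d, a mod d) else 0)"
          by (intro sum.cong) auto
        finally show ?thesis using a by simp
      qed
      then have "(\<Sum>a<d * d. c a * ip d (e a) Z) = (\<Sum>a<d * d. c a * (W * Z * W) $$ (a div d, a mod d))"
        by simp
      also have "\<dots> = ip d (unflatten d c) (fun_mat d (\<lambda>i j. (W * Z * W) $$ (i, j)))" by (rule sum_flatten_ip)
      also have "fun_mat d (\<lambda>i j. (W * Z * W) $$ (i, j)) = W * Z * W"
        by (rule fun_mat_entries[OF Z'])
      also have "ip d (unflatten d c) (W * Z * W) = ip d (W * unflatten d c * W) Z"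
        using ip_congruence[of "unflatten d c" d Z W W] W(1,2) Z by simp
      finally show ?thesis .
    qed
    show ?thesis unfolding z_def right_diff_distrib sum_subtractf u[OF M] u[OF Sc] ..
  qed
  have "\<exists>Good\<in>sets (PiM {..<N} (\<lambda>_. X)). 1 - \<delta> \<le> measure (PiM {..<N} (\<lambda>_. X)) Good \<and>
    (\<forall>xs\<in>Good. \<exists>G\<subseteq>{..<N}. real (card ({..<N} - G)) \<le> \<epsilon> * real N \<and>
      (\<forall>c. (\<Sum>s\<in>G. (\<Sum>a<d * d. c a * z a (xs s))\<^sup>2) \<le> 2 * V * real N * (\<Sum>a<d * d. (c a)\<^sup>2)) \<and>
      (\<forall>c. \<bar>\<Sum>s\<in>G. \<Sum>a<d * d. c a * z a (xs s)\<bar> \<le> 2 * sqrt (V * \<epsilon>) * real N * sqrt (\<Sum>a<d * d. (c a)\<^sup>2)))"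
  proof (rule truncated_concentration[OF prob_X])
    note [measurable] = ip_measurable
    show "z a \<in> borel_measurable X" for a unfolding z_def by measurable
    show "integrable X (\<lambda>M. (z a M)\<^sup>2)" for a unfolding z_def by (rule linear_second_moment(1)[OF ec])
    show "(\<integral>M. z a M \<partial>X) = 0" for a
    proof -
      interpret prob_space X by (rule prob_X)
      show ?thesis unfolding z_def using ip_integrable[of "e a"] by (simp add: ip_mean prob_space)
    qed
    show "(\<integral>M. (\<Sum>a<d * d. c a * z a M)\<^sup>2 \<partial>X) \<le> V * (\<Sum>a<d * d. (c a)\<^sup>2)" for c
    proof -
      let ?A = "W * unflatten d c * W"
      have A: "?A \<in> carrier_mat d d" using W(1) by auto
      have "(\<integral>M. (\<Sum>a<d * d. c a * z a M)\<^sup>2 \<partial>X) = (\<integral>M. (ip d ?A M - ip d ?A S)\<^sup>2 \<partial>X)"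
        using lin by (intro Bochner_Integration.integral_cong) (auto simp: space_X)
      also have "\<dots> \<le> V * ip d (R * ?A * R) (R * ?A * R)" by (rule linear_second_moment(2)[OF A])
      also have "R * ?A * R = unflatten d c" by (rule RWZWR) simp
      finally show ?thesis by (simp add: sum_flatten_square)
    qed
    show "9 * (real (d * d))\<^sup>2 / (\<epsilon> * \<delta>\<^sup>2) \<le> real N"
      using N by (simp add: power2_eq_square power4_eq_xxxx mult.assoc)
    show "1 \<le> d * d" using d by simp
  qed (use assms V in auto)
  then obtain Good where Good: "Good \<in> sets (PiM {..<N} (\<lambda>_. X))" "1 - \<delta> \<le> measure (PiM {..<N} (\<lambda>_. X)) Good"
    and G: "\<And>xs. xs \<in> Good \<Longrightarrow> \<exists>G\<subseteq>{..<N}. real (card ({..<N} - G)) \<le> \<epsilon> * real N \<and>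
      (\<forall>c. (\<Sum>s\<in>G. (\<Sum>a<d * d. c a * z a (xs s))\<^sup>2) \<le> 2 * V * real N * (\<Sum>a<d * d. (c a)\<^sup>2)) \<and>
      (\<forall>c. \<bar>\<Sum>s\<in>G. \<Sum>a<d * d. c a * z a (xs s)\<bar> \<le> 2 * sqrt (V * \<epsilon>) * real N * sqrt (\<Sum>a<d * d. (c a)\<^sup>2))"
    by (elim bexE conjE) blast
  show ?thesis
  proof (intro bexI[OF _ Good(1)] conjI Good(2) ballI)
    fix xs assume xs: "xs \<in> Good"
    from G[OF xs] obtain G where G: "G \<subseteq> {..<N}" "real (card ({..<N} - G)) \<le> \<epsilon> * real N"
      and sec: "\<And>c. (\<Sum>s\<in>G. (\<Sum>a<d * d. c a * z a (xs s))\<^sup>2) \<le> 2 * V * real N * (\<Sum>a<d * d. (c a)\<^sup>2)"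
      and fir: "\<And>c. \<bar>\<Sum>s\<in>G. \<Sum>a<d * d. c a * z a (xs s)\<bar> \<le> 2 * sqrt (V * \<epsilon>) * real N * sqrt (\<Sum>a<d * d. (c a)\<^sup>2)"
      by blast
    have xc: "xs s \<in> carrier_mat d d" if "s \<in> G" for s
    proof -
      have "xs \<in> space (PiM {..<N} (\<lambda>_. X))" using Good(1) xs sets.sets_into_space by blast
      then show ?thesis using that G(1) space_X by (auto simp: space_PiM)
    qed
    have "(\<Sum>s\<in>G. (ip d A (xs s - S))\<^sup>2) \<le> 2 * real N * (V * ip d (R * A * R) (R * A * R)) \<and>
        \<bar>\<Sum>s\<in>G. ip d A (xs s - S)\<bar> \<le> 2 * sqrt \<epsilon> * real N * sqrt (V * ip d (R * A * R) (R * A * R))"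
      if A: "A \<in> carrier_mat d d" for A
    proof -
      let ?c = "\<lambda>a. (R * A * R) $$ (a div d, a mod d)"
      have RA: "R * A * R \<in> carrier_mat d d" using R(1) A by auto
      have e: "(\<Sum>a<d * d. ?c a * z a (xs s)) = ip d A (xs s - S)" if s: "s \<in> G" for s
        unfolding lin[OF xc[OF s]] unflatten_surj[OF RA] RWZWR(2)[OF A]
        using ip_minus_right[OF A xc[OF s] Sc] by simp
      have n: "(\<Sum>a<d * d. (?c a)\<^sup>2) = ip d (R * A * R) (R * A * R)"
        unfolding sum_flatten_square unflatten_surj[OF RA] ..
      have e2: "(\<Sum>s\<in>G. (\<Sum>a<d * d. ?c a * z a (xs s))\<^sup>2) = (\<Sum>s\<in>G. (ip d A (xs s - S))\<^sup>2)"
        by (intro sum.cong refl) (simp only: e)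
      have e1: "(\<Sum>s\<in>G. \<Sum>a<d * d. ?c a * z a (xs s)) = (\<Sum>s\<in>G. ip d A (xs s - S))"
        by (intro sum.cong refl) (simp only: e)
      show ?thesis
        using sec[of ?c] fir[of ?c] unfolding n e1 e2
        by (simp add: real_sqrt_mult mult.assoc mult.left_commute)
    qed
    then show "\<exists>G\<subseteq>{..<N}. real (card ({..<N} - G)) \<le> \<epsilon> * real N \<and>
      (\<forall>A\<in>carrier_mat d d. (\<Sum>s\<in>G. (ip d A (xs s - S))\<^sup>2) \<le> 2 * real N * (V * ip d (R * A * R) (R * A * R)) \<and>
        \<bar>\<Sum>s\<in>G. ip d A (xs s - S)\<bar> \<le> 2 * sqrt \<epsilon> * real N * sqrt (V * ip d (R * A * R) (R * A * R)))"
      using G by blast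
  qed
qed

lemma contaminated_accuracy:
  assumes eps: "0 < \<epsilon>" "\<epsilon> \<le> 1 / 1600" "V * \<epsilon> \<le> 1 / 400"
    and lam: "132 * V \<le> real K * \<sigma>\<^sup>2" "real K * \<sigma>\<^sup>2 * \<epsilon> \<le> 1 / 36" and N: "0 < N"
    and xs: "\<And>s. s < N \<Longrightarrow> psd_mat d (xs s)"
    and cont: "real (card {i\<in>{..<N}. xs i \<noteq> ys i}) \<le> \<epsilon> * real N"
    and G1: "G1 \<subseteq> {..<N}" "real (card ({..<N} - G1)) \<le> \<epsilon> * real N"
    and good: "\<And>A. A \<in> carrier_mat d d \<Longrightarrow>
      (\<Sum>s\<in>G1. (ip d A (xs s - S))\<^sup>2) \<le> 2 * real N * (V * ip d (R * A * R) (R * A * R)) \<and>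
      \<bar>\<Sum>s\<in>G1. ip d A (xs s - S)\<bar> \<le> 2 * sqrt \<epsilon> * real N * sqrt (V * ip d (R * A * R) (R * A * R))"
  shows "\<exists>T. estimates (compile (estimate_com K)) d \<epsilon> \<sigma> \<delta> N ys \<omega> T \<and>
    frob_norm (W * (S - T) * W) \<le> 2 * (10 * sqrt (V * \<epsilon>) + 3 * sqrt (real K * \<sigma>\<^sup>2 * \<epsilon>))"
proof -
  let ?X = "\<lambda>s. sym_part (\<lambda>i j. ys s $$ (i, j))"
  let ?lam = "real K * \<sigma>\<^sup>2"
  from estimates_estimate_com[of N d ys K \<sigma> \<epsilon> \<delta> \<omega>]
  obtain Y ws where Y_eq: "\<forall>s<N. \<forall>i<d. \<forall>j<d. Y s i j = ?X s i j"
    and w0: "\<forall>s<N. ws 0 s = of_bool (passes (?X s) d)"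
    and steps: "\<forall>r<N. filter_step ?lam d N Y (ws r) (ws (Suc r))"
    and out: "estimates (compile (estimate_com K)) d \<epsilon> \<sigma> \<delta> N ys \<omega> (mat d d (\<lambda>(i, j). wmean N Y (ws N) i j))"
    by (elim exE conjE) (rule that)
  define G where "G = {s\<in>G1. xs s = ys s}"
  have GN: "G \<subseteq> {..<N}" using G1 by (auto simp: G_def)
  have Ysym: "Y s i j = Y s j i" if "s < N" "i < d" "j < d" for s i j
    using Y_eq[rule_format, of s i j] Y_eq[rule_format, of s j i] that by (simp add: sym_part_def add.commute)
  have Yx: "Y s i j = xs s $$ (i, j)" if "s \<in> G" "i < d" "j < d" for s i j
  proof -
    have s: "s < N" "ys s = xs s" using that G1 by (auto simp: G_def)
    have "xs s $$ (j, i) = xs s $$ (i, j)"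
      using psd_matD(1,2)[OF xs[OF s(1)]] index_transpose_mat(1)[of i "xs s" j] that by simp
    then show ?thesis using Y_eq[rule_format, of s i j] s that by (simp add: sym_part_def)
  qed
  \<comment> \<open>At most \<open>\<epsilon> N\<close> samples are truncated, and at most
    \<open>\<epsilon> N\<close> are altered.\<close>
  have Gbad: "real (card ({..<N} - G)) \<le> 2 * \<epsilon> * real N"
  proof -
    have "{..<N} - G \<subseteq> ({..<N} - G1) \<union> {i\<in>{..<N}. xs i \<noteq> ys i}" by (auto simp: G_def)
    then have "card ({..<N} - G) \<le> card (({..<N} - G1) \<union> {i\<in>{..<N}. xs i \<noteq> ys i})"
      by (intro card_mono) auto
    also have "\<dots> \<le> card ({..<N} - G1) + card {i\<in>{..<N}. xs i \<noteq> ys i}" by (rule card_Un_le)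
    finally show ?thesis using G1(2) cont by simp
  qed
  interpret contaminated_sample d N S R W V \<epsilon> Y G1 G xs
  proof unfold_locales
    show "xs s \<in> carrier_mat d d" if "s \<in> G1" for s using psd_matD(1)[OF xs] that G1 by auto
  qed (use psd_S R W V eps N G1 Gbad Yx Ysym good in \<open>auto simp: G_def\<close>)
  have bilY: "bil (Y s) d v v = bil (?X s) d v v" if "s < N" for s v
    by (intro bil_cong refl) (rule Y_eq[rule_format, OF that])
  have passes_psd: "passes (?X s) d \<longleftrightarrow> (\<forall>v. 0 \<le> bil (?X s) d v v)" for s
    by (rule passes_iff_psd) (simp add: sym_part_def)
  have "passes (?X s) d" if s: "s \<in> G" for s
    unfolding passes_psd
  proof
    fix v
    have sN: "s < N" using s GN by auto
    have "bil (?X s) d v v = bil (Y s) d v v" using bilY[OF sN] by simp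
    also have "\<dots> = bil (Y s) d (\<lambda>i. vec d v $ i) (\<lambda>i. vec d v $ i)" by (intro bil_cong) auto
    also have "\<dots> = ip d (outer_mat d (vec d v)) (fun_mat d (Y s))" by (rule bil_outer)
    also have "fun_mat d (Y s) = xs s"
      using Yx[OF s] psd_matD(1)[OF xs[OF sN]] by (intro eq_matI) (auto simp: fun_mat_def)
    also have "ip d (outer_mat d (vec d v)) (xs s) = vec d v \<bullet> (xs s *\<^sub>v vec d v)"
      by (rule ip_outer_mat) (use psd_matD(1)[OF xs[OF sN]] in auto)
    also have "\<dots> \<ge> 0" by (rule psd_matD(3)[OF xs[OF sN]]) simp
    finally show "0 \<le> bil (?X s) d v v" .
  qed
  \<comment> \<open>Unaltered samples pass the test, so no good weight is lost at the start and the
    invariant holds initially.\<close>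
  then have w0G: "1 - ws 0 s = 0" if "s \<in> G" for s using w0 GN that by auto
  have "admissible (ws 0)"
    unfolding admissible_def
  proof (intro conjI allI impI)
    have "(\<Sum>s\<in>G. 1 - ws 0 s) = 0" using w0G by (intro sum.neutral) auto
    also have "0 \<le> (\<Sum>s\<in>{..<N} - G. 1 - ws 0 s)" using w0 by (intro sum_nonneg) auto
    finally show "(\<Sum>s\<in>G. 1 - ws 0 s) \<le> (\<Sum>s\<in>{..<N} - G. 1 - ws 0 s)" .
  next
    fix s assume s: "s < N"
    show "0 \<le> ws 0 s" "ws 0 s \<le> 1" using w0 s by auto
    fix v assume "0 < ws 0 s"
    then have "passes (?X s) d" using w0 s by (auto split: if_splits simp: of_bool_def)
    then show "0 \<le> bil (Y s) d v v" using passes_psd bilY[OF s] by simp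
  qed
  have fin: "admissible (ws N)" "settled ?lam (ws N)"
    using filter_converges[of ws ?lam] \<open>admissible (ws 0)\<close> lam(1) steps by auto
  have "frob_norm (W * (S - mean_mat (ws N)) * W) \<le> 2 * (10 * sqrt (V * \<epsilon>) + 3 * sqrt (?lam * \<epsilon>))"
    by (rule stable_mean_close[OF fin(1) settled_stable[OF fin(2)]]) (use lam in auto)
  moreover have "mat d d (\<lambda>(i, j). wmean N Y (ws N) i j) = mean_mat (ws N)" by (simp add: fun_mat_def)
  ultimately show ?thesis using out by metis
qed

end

text \<open>\<open>A\<close> holds almost everywhere, but its exceptional set need not be
  measurable. A measurable null set covering it is cut out, and the product with the space of
  \<open>Q\<close> preserves measurability and probability.\<close>

lemma measurable_high_probability_event:
  assumes J: "prob_space J" and f: "f \<in> measurable J P" and Q: "prob_space Q"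
    and Good: "Good \<in> sets P" "1 - \<delta> \<le> measure (distr J P f) Good" and ae: "AE p in J. A p"
  shows "\<exists>E\<in>sets (J \<Otimes>\<^sub>M Q). 1 - \<delta> \<le> measure (J \<Otimes>\<^sub>M Q) E \<and>
    (\<forall>(p, \<omega>)\<in>E. p \<in> space J \<and> f p \<in> Good \<and> A p)"
proof -
  interpret J: prob_space J by (rule J)
  interpret Q: prob_space Q by (rule Q)
  from ae obtain B where B: "{p \<in> space J. \<not> A p} \<subseteq> B" "B \<in> null_sets J"
    by (auto simp: eventually_ae_filter)
  define E where "E = (f -` Good \<inter> space J) - B"
  have E0: "f -` Good \<inter> space J \<in> sets J" using f Good(1) by (rule measurable_sets)
  have ES: "E \<in> sets J" unfolding E_def using E0 B(2) by auto
  have "measure J E = measure J (f -` Good \<inter> space J)"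
    unfolding E_def using E0 B(2) by (rule measure_Diff_null_set)
  also have "\<dots> = measure (distr J P f) Good" by (rule measure_distr[OF f Good(1), symmetric])
  finally have mE: "1 - \<delta> \<le> measure J E" using Good(2) by simp
  have "emeasure (J \<Otimes>\<^sub>M Q) (E \<times> space Q) = emeasure J E * emeasure Q (space Q)"
    by (rule Q.emeasure_pair_measure_Times[OF ES sets.top])
  then have "measure (J \<Otimes>\<^sub>M Q) (E \<times> space Q) = measure J E"
    by (simp add: measure_def Q.emeasure_space_1)
  then show ?thesis using mE ES B(1)
    by (intro bexI[of _ "E \<times> space Q"]) (auto simp: E_def)
qed

theorem theorem2p4:
  fixes C :: real
  assumes "C > 0"
  shows "\<exists>c C' :: real. \<exists>pick est N.
    c > 0 \<and> C' > 0 \<and> poly_time_estimator pick est N \<and>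
    (\<forall>d X S \<sigma> \<epsilon> \<delta> J.
      d \<ge> 1 \<and> mat_distribution d X \<and> (AE M in X. psd_mat d M) \<and>
      has_mean d X S \<and> invertible_mat S \<and>
      \<sigma> > 0 \<and>
      (\<forall>A. symmetric_mat d A \<longrightarrow>
         integrable X (\<lambda>M. (mat_trace (A * M))\<^sup>2) \<and>
         prob_space.variance X (\<lambda>M. mat_trace (A * M))
           \<le> C * (\<sigma>\<^sup>2 * (frob_norm (psd_sqrt S * A * psd_sqrt S))\<^sup>2)) \<and>
      0 < \<epsilon> \<and> \<epsilon> < c \<and> \<epsilon> < c * \<sigma> powi (-2) \<and> 0 < \<delta> \<and> \<delta> < 1 \<and>
      contamination \<epsilon> (N d \<epsilon> \<sigma> \<delta>) X J
      \<longrightarrow>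
      (\<exists>E \<in> sets (J \<Otimes>\<^sub>M coin_space).
         measure (J \<Otimes>\<^sub>M coin_space) E \<ge> 1 - \<delta> \<and>
         (\<forall>((xs, ys), \<omega>) \<in> E. \<exists>T.
            estimates est d \<epsilon> \<sigma> \<delta> (N d \<epsilon> \<sigma> \<delta>) ys \<omega> T \<and>
            frob_norm (psd_inv_sqrt S * (S - T) * psd_inv_sqrt S) \<le> C' * (\<sigma> * sqrt \<epsilon>))))"
proof -
  \<comment> \<open>Program constants are natural numbers, so the factor \<open>132 * C\<close> of
    the yardstick is rounded up.\<close>
  define K where "K = nat \<lceil>132 * C\<rceil>"
  have K: "132 * C \<le> real K" unfolding K_def by linarith
  \<comment> \<open>The entries provide, in this order, the 1/1600 of the weighting,
    \<open>V * \<epsilon> \<le> 1 / 400\<close> for the lower bound on the mean, and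
    \<open>K * \<sigma>^2 * \<epsilon> \<le> 1 / 36\<close> for the final absorption.\<close>
  define c where "c = min (1 / 1600) (min (1 / (400 * C)) (1 / (36 * real (K + 1))))"
  have c: "0 < c" "c \<le> 1 / 1600" "c \<le> 1 / (400 * C)" "c \<le> 1 / (36 * real (K + 1))"
    using assms by (auto simp: c_def)
  define C' where "C' = 2 * (10 * sqrt C + 3 * sqrt (real K))"
  have C': "0 < C'" unfolding C'_def using assms by (intro mult_pos_pos add_pos_nonneg) auto
  have main: "\<exists>E \<in> sets (J \<Otimes>\<^sub>M coin_space).
         measure (J \<Otimes>\<^sub>M coin_space) E \<ge> 1 - \<delta> \<and>
         (\<forall>((xs, ys), \<omega>) \<in> E. \<exists>T.
            estimates (compile (estimate_com K)) d \<epsilon> \<sigma> \<delta> (sample_size d \<epsilon> \<sigma> \<delta>) ys \<omega> T \<and>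
            frob_norm (psd_inv_sqrt S * (S - T) * psd_inv_sqrt S) \<le> C' * (\<sigma> * sqrt \<epsilon>))"
    if d: "1 \<le> d" and X: "mat_distribution d X" and psd: "AE M in X. psd_mat d M"
      and mean: "has_mean d X S" and inv: "invertible_mat S" and \<sigma>: "0 < \<sigma>"
      and var: "\<forall>A. symmetric_mat d A \<longrightarrow>
         integrable X (\<lambda>M. (mat_trace (A * M))\<^sup>2) \<and>
         prob_space.variance X (\<lambda>M. mat_trace (A * M))
           \<le> C * (\<sigma>\<^sup>2 * (frob_norm (psd_sqrt S * A * psd_sqrt S))\<^sup>2)"
      and eps: "0 < \<epsilon>" "\<epsilon> < c" "\<epsilon> < c * \<sigma> powi (-2)" and \<delta>: "0 < \<delta>" "\<delta> < 1"
      and cont: "contamination \<epsilon> (sample_size d \<epsilon> \<sigma> \<delta>) X J"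
    for d X S \<sigma> \<epsilon> \<delta> J
  proof -
    define N where "N = sample_size d \<epsilon> \<sigma> \<delta>"
    define V where "V = C * \<sigma>\<^sup>2"
    interpret bounded_covariance d X S V
      by unfold_locales (use d X psd mean inv var assms \<sigma> in \<open>auto simp: V_def mult.assoc\<close>)
    interpret X: prob_space X by (rule prob_X)
    have \<sigma>\<epsilon>: "\<sigma>\<^sup>2 * \<epsilon> < c"
      using eps(3) \<sigma> by (simp add: power_int_minus field_simps)
    have N: "9 * real d ^ 4 / (\<epsilon> * \<delta>\<^sup>2) \<le> real N"
      unfolding N_def sample_size_def by linarith
    have "0 < 9 * real d ^ 4 / (\<epsilon> * \<delta>\<^sup>2)" using d eps \<delta> by simp
    then have "0 < real N" using N by linarith
    then have Npos: "0 < N" by simp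
    let ?P = "PiM {..<N} (\<lambda>_. X)"
    have J: "prob_space J" "sets J = sets (?P \<Otimes>\<^sub>M ?P)" "distr J ?P fst = ?P"
      "AE (xs, ys) in J. real (card {i\<in>{..<N}. xs i \<noteq> ys i}) \<le> \<epsilon> * real N"
      using cont unfolding contamination_def N_def by auto
    have fst: "fst \<in> measurable J ?P"
      unfolding measurable_cong_sets[OF J(2) refl] by (rule measurable_fst)
    obtain Good where Good: "Good \<in> sets ?P" "1 - \<delta> \<le> measure ?P Good"
      and G: "\<And>xs. xs \<in> Good \<Longrightarrow> \<exists>G\<subseteq>{..<N}. real (card ({..<N} - G)) \<le> \<epsilon> * real N \<and>
      (\<forall>A\<in>carrier_mat d d. (\<Sum>s\<in>G. (ip d A (xs s - S))\<^sup>2) \<le> 2 * real N * (V * ip d (R * A * R) (R * A * R)) \<and>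
        \<bar>\<Sum>s\<in>G. ip d A (xs s - S)\<bar> \<le> 2 * sqrt \<epsilon> * real N * sqrt (V * ip d (R * A * R) (R * A * R)))"
      using sample_concentration[OF eps(1) \<delta> N] by (elim bexE conjE) blast
    \<comment> \<open>The clean marginal of \<open>J\<close> is the product law, so almost-sure
      properties of independent samples transfer to \<open>J\<close>.\<close>
    have "AE xs in ?P. \<forall>s\<in>{..<N}. psd_mat d (xs s)"
      by (intro AE_finite_allI AE_PiM_component prob_X psd) auto
    then have "AE xs in distr J ?P fst. \<forall>s\<in>{..<N}. psd_mat d (xs s)" unfolding J(3) .
    from AE_distrD[OF fst this] have "AE p in J. \<forall>s\<in>{..<N}. psd_mat d (fst p s)" .
    then have ae: "AE p in J. (\<forall>s\<in>{..<N}. psd_mat d (fst p s)) \<and>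
        real (card {i\<in>{..<N}. fst p i \<noteq> snd p i}) \<le> \<epsilon> * real N"
      using J(4) by eventually_elim (auto simp: case_prod_unfold)
    have coin: "prob_space coin_space"
      unfolding coin_space_def by (intro prob_space.prob_space_stream_space measure_pmf.prob_space_axioms)
    have "1 - \<delta> \<le> measure (distr J ?P fst) Good" using Good(2) by (simp add: J(3))
    from measurable_high_probability_event[OF J(1) fst coin Good(1) this ae]
    obtain E where E: "E \<in> sets (J \<Otimes>\<^sub>M coin_space)" "1 - \<delta> \<le> measure (J \<Otimes>\<^sub>M coin_space) E"
      and EG: "\<forall>(p, \<omega>)\<in>E. p \<in> space J \<and> fst p \<in> Good \<and> (\<forall>s\<in>{..<N}. psd_mat d (fst p s)) \<and>
        real (card {i\<in>{..<N}. fst p i \<noteq> snd p i}) \<le> \<epsilon> * real N" by blast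
    have acc: "\<exists>T. estimates (compile (estimate_com K)) d \<epsilon> \<sigma> \<delta> N ys \<omega> T \<and>
            frob_norm (W * (S - T) * W) \<le> C' * (\<sigma> * sqrt \<epsilon>)"
      if "((xs, ys), \<omega>) \<in> E" for xs ys \<omega>
    proof -
      have xs: "xs \<in> Good" "\<And>s. s < N \<Longrightarrow> psd_mat d (xs s)"
        "real (card {i\<in>{..<N}. xs i \<noteq> ys i}) \<le> \<epsilon> * real N"
        using EG that by fastforce+
      from G[OF xs(1)] obtain G1 where G1: "G1 \<subseteq> {..<N}" "real (card ({..<N} - G1)) \<le> \<epsilon> * real N"
        "\<And>A. A \<in> carrier_mat d d \<Longrightarrow> (\<Sum>s\<in>G1. (ip d A (xs s - S))\<^sup>2) \<le> 2 * real N * (V * ip d (R * A * R) (R * A * R)) \<and>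
        \<bar>\<Sum>s\<in>G1. ip d A (xs s - S)\<bar> \<le> 2 * sqrt \<epsilon> * real N * sqrt (V * ip d (R * A * R) (R * A * R))"
        by blast
      have e1: "V * \<epsilon> \<le> 1 / 400"
      proof -
        have "V * \<epsilon> = C * (\<sigma>\<^sup>2 * \<epsilon>)" by (simp add: V_def)
        also have "\<dots> \<le> C * (1 / (400 * C))" using \<sigma>\<epsilon> c(3) assms by (intro mult_left_mono) auto
        finally show ?thesis using assms by simp
      qed
      have e2: "132 * V \<le> real K * \<sigma>\<^sup>2"
        using mult_right_mono[OF K zero_le_power2[of \<sigma>]] by (simp add: V_def mult.assoc)
      have e3: "real K * \<sigma>\<^sup>2 * \<epsilon> \<le> 1 / 36"
      proof -
        have "real K * \<sigma>\<^sup>2 * \<epsilon> = real K * (\<sigma>\<^sup>2 * \<epsilon>)" by simp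
        also have "\<dots> \<le> real (K + 1) * (1 / (36 * real (K + 1)))"
          using \<sigma>\<epsilon> c(4) eps by (intro mult_mono) auto
        also have "\<dots> = 1 / 36" by (simp add: field_simps)
        finally show ?thesis .
      qed
      have "\<exists>T. estimates (compile (estimate_com K)) d \<epsilon> \<sigma> \<delta> N ys \<omega> T \<and>
        frob_norm (W * (S - T) * W) \<le> 2 * (10 * sqrt (V * \<epsilon>) + 3 * sqrt (real K * \<sigma>\<^sup>2 * \<epsilon>))"
        by (rule contaminated_accuracy[OF eps(1) _ e1 e2 e3 Npos xs(2,3) G1]) (use eps c in auto)
      \<comment> \<open>Both \<open>V\<close> and \<open>K * \<sigma>^2\<close> contain the factor
        \<open>\<sigma>^2\<close>, whose root is the \<sigma> of the claimed rate.\<close>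
      moreover have "2 * (10 * sqrt (V * \<epsilon>) + 3 * sqrt (real K * \<sigma>\<^sup>2 * \<epsilon>)) = C' * (\<sigma> * sqrt \<epsilon>)"
        using \<sigma> by (simp add: V_def C'_def real_sqrt_mult algebra_simps)
      ultimately show ?thesis by simp
    qed
    show ?thesis
      using E acc unfolding N_def by (intro bexI[of _ E]) auto
  qed
  show ?thesis
    by (rule exI[of _ c], rule exI[of _ C'], rule exI[of _ pick_com], rule exI[of _ "compile (estimate_com K)"],
        rule exI[of _ sample_size])
      (use c(1) C' poly_time_estimate main in blast)
qed

end
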